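(* Let $n\ge1$ and let $A_1,\ldots,A_n$ be convex bodies in $\mathbb C^n$ whose support functions belong to $\mathcal C^2(\mathbb C^n\setminus\{0\})$. Then $$Q_n(A_1,\ldots,A_n)=\frac{4^n}{\varkappa_n}\int_{B_{2n}}D_n\big(\mathrm{Hess}_{\mathbb C}h_{A_1},\ldots,\mathrm{Hess}_{\mathbb C}h_{A_n}\big)\,\upsilon_{2n},$$ where $\upsilon_{2n}$ is the standard (Lebesgue) volume form on $\mathbb C^n=\mathbb R^{2n}$.
   Context: $\mathbb C^n$ carries the Hermitian product $\langle z,w\rangle=\sum_\ell z_\ell\bar w_\ell$. A convex body is a non-empty compact convex subset; its support function is $h_A(z)=\max_{v\in A}\operatorname{Re}\langle z,v\rangle$. $B_{2n}$ is the closed unit ball of $\mathbb C^n$ centred at the origin and $\varkappa_m$ the Lebesgue measure of the unit ball of $\mathbb R^m$. $d^c=i(\bar\partial-\partial)$, so $dd^c=2i\partial\bar\partial$. Wedge products of the currents $dd^c h_A$ are taken in the Bedford–Taylor sense. The Kazarnovskiĭ mixed pseudovolume is $$Q_n(A_1,\ldots,A_n)=\frac{1}{n!\,\varkappa_n}\int_{B_{2n}}dd^c h_{A_1}\wedge\cdots\wedge dd^c h_{A_n}.$$ $\mathrm{Hess}_{\mathbb C}h=\big(\partial^2h/\partial z_j\partial\bar z_k\big)_{j,k}$ is the complex Hessian. For $n\times n$ matrices $M_\ell=(m^{(\ell)}_{j,k})$, the mixed discriminant is $$D_n(M_1,\ldots,M_n)=\frac1{n!}\sum_{\sigma,\tau\in\mathfrak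 S_n}\operatorname{sgn}(\sigma\tau)\prod_{\ell=1}^n m^{(\ell)}_{\sigma(\ell),\tau(\ell)},$$ so that $D_n(M,\ldots,M)=\det M$. *)

theory Defs
  imports "HOL-Analysis.Analysis" "HOL-Combinatorics.Permutations"
begin

text \<open>
  $\mathbb C^n$ is \<^typ>\<open>complex ^ 'n\<close> with $n$ the cardinality of \<^typ>\<open>'n\<close>. Where differential forms
  occur, \<^typ>\<open>'n\<close> carries a linear order, so that the coordinates are $z_1,\ldots,z_n$. Families
  $A_1,\ldots,A_n$ are indexed by \<^typ>\<open>'n\<close> as well.
\<close>

section \<open>Convex bodies and support functions\<close>

definition herm :: "complex ^ 'n \<Rightarrow> complex ^ 'n \<Rightarrow> complex" where
  "herm z w = (\<Sum>l\<in>UNIV. z $ l * cnj (w $ l))"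

definition convex_body :: "(complex ^ 'n) set \<Rightarrow> bool" where
  "convex_body A \<longleftrightarrow> A \<noteq> {} \<and> compact A \<and> convex A"

definition support_fun :: "(complex ^ 'n) set \<Rightarrow> complex ^ 'n \<Rightarrow> real" where
  "support_fun A z = (SUP v\<in>A. Re (herm z v))"

section \<open>Differentiability classes and Wirtinger derivatives\<close>

text \<open>Meant for open \<open>S\<close> only: the Frechet derivative is the unrestricted one.\<close>

fun Ck_on :: "nat \<Rightarrow> ('a::euclidean_space \<Rightarrow> 'b::real_normed_vector) \<Rightarrow> 'a set \<Rightarrow> bool" where
  "Ck_on 0 f S \<longleftrightarrow> continuous_on S f"
| "Ck_on (Suc k) f S \<longleftrightarrow>
     (\<forall>x\<in>S. f differentiable (at x)) \<and>
     (\<forall>b\<in>Basis. Ck_on k (\<lambda>x. frechet_derivative f (at x) b) S)"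

definition smooth_on :: "('a::euclidean_space \<Rightarrow> 'b::real_normed_vector) \<Rightarrow> 'a set \<Rightarrow> bool" where
  "smooth_on f S \<longleftrightarrow> (\<forall>k. Ck_on k f S)"

text \<open>With $z_j = x_j + i y_j$: $\partial/\partial z_j$ and $\partial/\partial\bar z_j$.\<close>

definition dz :: "'n \<Rightarrow> (complex ^ 'n \<Rightarrow> complex) \<Rightarrow> complex ^ 'n \<Rightarrow> complex" where
  "dz j f z = (frechet_derivative f (at z) (axis j 1)
     - \<i> * frechet_derivative f (at z) (axis j \<i>)) / 2"

definition dzbar :: "'n \<Rightarrow> (complex ^ 'n \<Rightarrow> complex) \<Rightarrow> complex ^ 'n \<Rightarrow> complex" where
  "dzbar j f z = (frechet_derivative f (at z) (axis j 1)
     + \<i> * frechet_derivative f (at z) (axis j \<i>)) / 2"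

definition Hess_C :: "(complex ^ 'n \<Rightarrow> real) \<Rightarrow> complex ^ 'n \<Rightarrow> complex ^ 'n ^ 'n" where
  "Hess_C h z = (\<chi> j k. dz j (dzbar k (\<lambda>w. complex_of_real (h w))) z)"

definition mixed_discriminant :: "('n \<Rightarrow> complex ^ 'n ^ 'n) \<Rightarrow> complex" where
  "mixed_discriminant M =
     (\<Sum>\<sigma> | \<sigma> permutes UNIV. \<Sum>\<tau> | \<tau> permutes UNIV.
        of_int (sign (\<sigma> \<circ> \<tau>)) * (\<Prod>l\<in>UNIV. M l $ \<sigma> l $ \<tau> l)) / fact CARD('n)"

section \<open>Differential forms\<close>

text \<open>
  A (not necessarily homogeneous) form is given by its coefficients: \<open>\<phi> z I J\<close> is the coefficient
  at \<open>z\<close> of $dz_I\wedge d\bar z_J = dz_{i_1}\wedge\cdots\wedge dz_{i_p}\wedge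
  d\bar z_{j_1}\wedge\cdots\wedge d\bar z_{j_q}$, both index sets listed increasingly.
\<close>

type_synonym 'n form = "complex ^ 'n \<Rightarrow> 'n set \<Rightarrow> 'n set \<Rightarrow> complex"

text \<open>
  $\partial\phi=\sum_j dz_j\wedge\partial\phi/\partial z_j$ and
  $\bar\partial\phi=\sum_j d\bar z_j\wedge\partial\phi/\partial\bar z_j$. The signs come from moving
  $dz_j$, resp. $d\bar z_j$, from the far left to its place in $dz_I\wedge d\bar z_J$.
\<close>

definition del :: "'n::{finite,linorder} form \<Rightarrow> 'n form" where
  "del \<phi> z I J =
     (\<Sum>j\<in>I. (-1) ^ card {i\<in>I. i < j} * dz j (\<lambda>w. \<phi> w (I - {j}) J) z)"

definition delbar :: "'n::{finite,linorder} form \<Rightarrow> 'n form" where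
  "delbar \<phi> z I J =
     (\<Sum>j\<in>J. (-1) ^ (card I + card {i\<in>J. i < j}) * dzbar j (\<lambda>w. \<phi> w I (J - {j})) z)"

definition ext_d :: "'n::{finite,linorder} form \<Rightarrow> 'n form" where
  "ext_d \<phi> z I J = del \<phi> z I J + delbar \<phi> z I J"

definition ext_dc :: "'n::{finite,linorder} form \<Rightarrow> 'n form" where
  "ext_dc \<phi> z I J = \<i> * (delbar \<phi> z I J - del \<phi> z I J)"

definition scale_form :: "(complex ^ 'n \<Rightarrow> real) \<Rightarrow> 'n form \<Rightarrow> 'n form" where
  "scale_form u \<phi> z I J = complex_of_real (u z) * \<phi> z I J"

definition function_form :: "(complex ^ 'n \<Rightarrow> complex) \<Rightarrow> 'n form" where
  "function_form f z I J = (if I = {} \<and> J = {} then f z else 0)"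

definition form_supported_in :: "'n form \<Rightarrow> (complex ^ 'n) set \<Rightarrow> bool" where
  "form_supported_in \<phi> K \<longleftrightarrow> (\<forall>z. z \<notin> K \<longrightarrow> (\<forall>I J. \<phi> z I J = 0))"

definition test_form :: "'n::finite form \<Rightarrow> bool" where
  "test_form \<phi> \<longleftrightarrow> (\<forall>I J. smooth_on (\<lambda>z. \<phi> z I J) UNIV) \<and>
     (\<exists>K. compact K \<and> form_supported_in \<phi> K)"

text \<open>
  Integral of the component of top degree. For the standard volume form
  $\upsilon_{2n}=\bigwedge_j \frac i2 dz_j\wedge d\bar z_j$ one has
  $dz_1\wedge\cdots\wedge dz_n\wedge d\bar z_1\wedge\cdots\wedge d\bar z_n
  = (-1)^{n(n-1)/2}(-2i)^n\upsilon_{2n}$.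
\<close>

definition integrate_form :: "'n::{finite,linorder} form \<Rightarrow> complex" where
  "integrate_form \<phi> =
     (-1) ^ (CARD('n) * (CARD('n) - 1) div 2) * (- 2 * \<i>) ^ CARD('n) *
     (LINT z|lborel. \<phi> z UNIV UNIV)"

section \<open>Currents and the Bedford-Taylor product\<close>

text \<open>
  A current is a functional on test forms; a current of bidegree $(k,k)$ only sees the component of
  bidegree $(n-k,n-k)$. A form $\Theta$ is the current $\phi\mapsto\int\Theta\wedge\phi$; in
  particular the constant function $1$ is \<^const>\<open>integrate_form\<close>.
\<close>

type_synonym 'n current = "'n form \<Rightarrow> complex"

text \<open>
  A current of order $0$ extends uniquely to the continuous compactly supported forms, continuously
  for uniform convergence with supports in a fixed compact set. Positive closed currents have
  order $0$. This extension gives the meaning of \<open>u T\<close> for a continuous function \<open>u\<close>; support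
  functions are finite and continuous, so nothing more general is needed here.
\<close>

definition form_converges :: "(nat \<Rightarrow> 'n::finite form) \<Rightarrow> 'n form \<Rightarrow> bool" where
  "form_converges \<psi> \<phi> \<longleftrightarrow>
     (\<exists>K. compact K \<and> (\<forall>m. form_supported_in (\<psi> m) K)) \<and>
     (\<forall>I J. uniform_limit UNIV (\<lambda>m z. \<psi> m z I J) (\<lambda>z. \<phi> z I J) sequentially)"

definition extend_current :: "'n::finite current \<Rightarrow> 'n current" where
  "extend_current T \<phi> =
     (THE c. \<forall>\<psi>. (\<forall>m. test_form (\<psi> m)) \<and> form_converges \<psi> \<phi> \<longrightarrow> (\<lambda>m. T (\<psi> m)) \<longlonglongrightarrow> c)"

definition mult_current :: "(complex ^ 'n \<Rightarrow> real) \<Rightarrow> 'n current \<Rightarrow> 'n current" where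
  "mult_current u T \<phi> = extend_current T (scale_form u \<phi>)"

text \<open>
  For a current of even degree, $\langle dd^c S,\phi\rangle=\langle S,dd^c\phi\rangle$.
\<close>

definition ddc_current :: "'n::{finite,linorder} current \<Rightarrow> 'n current" where
  "ddc_current S \<phi> = S (ext_d (ext_dc \<phi>))"

text \<open>
  $dd^cu_1\wedge\cdots\wedge dd^cu_k$, defined inductively by
  $dd^cu\wedge T = dd^c(uT)$.
\<close>

fun bedford_taylor :: "(complex ^ 'n::{finite,linorder} \<Rightarrow> real) list \<Rightarrow> 'n current" where
  "bedford_taylor [] = integrate_form"
| "bedford_taylor (u # us) = ddc_current (mult_current u (bedford_taylor us))"

text \<open>The (positive) Radon measure that a positive current of bidegree $(n,n)$ is.\<close>

definition current_measure :: "'n::finite current \<Rightarrow> (complex ^ 'n) measure" where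
  "current_measure T =
     (THE \<mu>. sets \<mu> = sets borel \<and>
        (\<forall>K. compact K \<longrightarrow> emeasure \<mu> K < \<infinity>) \<and>
        (\<forall>f. test_form (function_form f) \<longrightarrow> T (function_form f) = (LINT z|\<mu>. f z)))"

definition mixed_pseudovolume :: "('n \<Rightarrow> (complex ^ 'n::{finite,linorder}) set) \<Rightarrow> real" where
  "mixed_pseudovolume A =
     measure (current_measure
         (bedford_taylor (map (\<lambda>l. support_fun (A l)) (sorted_list_of_set UNIV)))) (cball 0 1)
     / (fact CARD('n) * measure lborel (cball (0 :: real ^ 'n::{finite,linorder}) 1))"

end

theory Submission
  imports Defs
begin

text \<open>
  On test forms, $dd^c\varphi=2i\sum_{j,k}dz_j\wedge d\bar z_k\wedge\partial_j\bar\partial_k\varphi$.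
  By induction on the number of factors, $dd^ch_1\wedge\cdots\wedge dd^ch_k$ is the form with locally
  integrable coefficients obtained by wedging the complex Hessians: these are homogeneous of degree
  $-1$, so the coefficients are $O(|z|^{-k})$ with $k\le n<2n$.

  In the induction step $h$ is mollified. Homogeneity turns the mollifications at scale $1/m$ into
  rescalings $u_m(z)=u(mz)/m$ of a single smooth function, which gives the uniform bound
  $|D^2u_m(z)|\le C/|z|$ needed for dominated convergence. For smooth $u$ and
  $T=dd^cg\wedge T'$ the identity $T(u\,dd^c\varphi)=T(dd^cu\wedge\varphi)$ needs no integration by
  parts: $T$ sees only $dd^c$ of its argument, and $dd^c(u\,dd^c\varphi)=dd^c(dd^cu\wedge\varphi)$.
  Stokes' theorem enters only for the empty product.

  In top degree the density is $4^nn!\,D_n(\mathrm{Hess}_{\mathbb C}h_1,\ldots,\mathrm{Hess}_{\mathbb C}h_n)$.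
  It is nonnegative because mixed discriminants of sums of rank one matrices $vv^*$ are, so the
  Radon measure of the current is Lebesgue measure with this density.
\<close>

section \<open>Partial derivatives and smooth functions\<close>

text \<open>\<open>extend_current\<close> and \<open>current_measure\<close> are definite
  descriptions, so each use needs both existence and uniqueness. For h times a current, one sequence
  of test forms decides: v_m dd^c phi, where v_m are smooth approximations of h. Its values converge
  to the integral of h dd^c phi, by uniform convergence, and also to the integral of dd^c h wedge
  phi, by dominated convergence of the Hessians; comparing the two limits gives the induction step.
  The origin is the obstacle: derivatives may fail to exist there and are then arbitrary chosen
  values. All bounds and limits are therefore stated for z \<noteq> 0, and the origin is discarded
  as a null set. The majorant |z|^(-k) is integrated without polar coordinates, against a product of
  one-variable functions involving |t|^(-1/2). This requires 2k \<le> 2n, which k \<le> n factors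
  satisfy. The constant 4^n is (2i)^n from dd^c times (-2i)^n from the orientation of the top form;
  n! cancels between the density and the normalisation of the pseudovolume.\<close>

abbreviation pd :: "'a::euclidean_space \<Rightarrow> ('a \<Rightarrow> 'b::real_normed_vector) \<Rightarrow> 'a \<Rightarrow> 'b" where
  "pd b f x \<equiv> frechet_derivative f (at x) b"

lemma pd_eqI: "(f has_derivative f') (at x) \<Longrightarrow> pd b f x = f' b"
  using frechet_derivative_at by metis

lemma pd_has_derivative: "f differentiable (at x) \<Longrightarrow> (f has_derivative (\<lambda>b. pd b f x)) (at x)"
  using frechet_derivative_works by auto

lemma pd_const [simp]: "pd b (\<lambda>x. c) x = 0"
  by simp

lemma pd_add: "f differentiable (at x) \<Longrightarrow> g differentiable (at x) \<Longrightarrow>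
    pd b (\<lambda>x. f x + g x) x = pd b f x + pd b g x"
  by (rule pd_eqI) (intro has_derivative_add pd_has_derivative)

lemma pd_diff: "f differentiable (at x) \<Longrightarrow> g differentiable (at x) \<Longrightarrow>
    pd b (\<lambda>x. f x - g x) x = pd b f x - pd b g x"
  by (rule pd_eqI) (intro has_derivative_diff pd_has_derivative)

lemma pd_mult: 
  fixes f g :: "'a::euclidean_space \<Rightarrow> 'b::real_normed_algebra"
  shows "f differentiable (at x) \<Longrightarrow> g differentiable (at x) \<Longrightarrow>
    pd b (\<lambda>x. f x * g x) x = f x * pd b g x + pd b f x * g x"
  by (rule pd_eqI) (intro has_derivative_mult pd_has_derivative)

lemma pd_cmult: 
  fixes f :: "'a::euclidean_space \<Rightarrow> 'b::real_normed_algebra"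
  shows "f differentiable (at x) \<Longrightarrow> pd b (\<lambda>x. c * f x) x = c * pd b f x"
  by (rule pd_eqI) (intro has_derivative_mult_right pd_has_derivative)

lemma pd_linear: 
  assumes "bounded_linear L" "f differentiable (at x)"
  shows "pd b (\<lambda>x. L (f x)) x = L (pd b f x)"
  by (rule pd_eqI) (intro bounded_linear.has_derivative[OF assms(1)] pd_has_derivative assms)

lemma pd_sum: 
  assumes "\<And>i. i \<in> I \<Longrightarrow> f i differentiable (at x)"
  shows "pd b (\<lambda>x. \<Sum>i\<in>I. f i x) x = (\<Sum>i\<in>I. pd b (f i) x)"
  by (rule pd_eqI) (intro has_derivative_sum pd_has_derivative assms)

text \<open>\<open>frechet_derivative\<close> chooses a map satisfying a predicate. Functions that
  agree near x satisfy the same predicate, so the choices coincide even where no derivative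
  exists.\<close>

lemma pd_eq_on_open:
  assumes "open S" "x \<in> S" "\<And>y. y \<in> S \<Longrightarrow> f y = g y"
  shows "pd b f x = pd b g x"
proof -
  have "(f has_derivative f') (at x) \<longleftrightarrow> (g has_derivative f') (at x)" for f'
    using has_derivative_transform_within_open assms by (metis (no_types, lifting))
  then show ?thesis by (simp add: frechet_derivative_def)
qed

lemma differentiable_eq_on_open:
  assumes "open S" "x \<in> S" "\<And>y. y \<in> S \<Longrightarrow> f y = g y" "f differentiable (at x)"
  shows "g differentiable (at x)"
  using assms unfolding differentiable_def by (metis has_derivative_transform_within_open)

lemma pd_has_vector_derivative_line:
  assumes "f differentiable (at (x + t *\<^sub>R a))"
  shows "((\<lambda>t. f (x + t *\<^sub>R a)) has_vector_derivative pd a f (x + t *\<^sub>R a)) (at t)"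
proof -
  let ?D = "frechet_derivative f (at (x + t *\<^sub>R a))"
  have *: "((\<lambda>t. f (x + t *\<^sub>R a)) has_derivative (\<lambda>h. ?D (0 + h *\<^sub>R a))) (at t)"
    by (rule has_derivative_compose[where g=f]) (auto intro!: derivative_eq_intros pd_has_derivative assms)
  have "linear ?D" using assms linear_frechet_derivative by blast
  then show ?thesis using * unfolding has_vector_derivative_def
    by (simp add: linear_cmul)
qed

lemma pd_linear_sum:
  assumes "f differentiable (at x)"
  shows "pd a f x = (\<Sum>b\<in>Basis. (a \<bullet> b) *\<^sub>R pd b f x)"
proof -
  have l: "linear (frechet_derivative f (at x))" using assms linear_frechet_derivative by blast
  have "pd a f x = frechet_derivative f (at x) (\<Sum>b\<in>Basis. (a \<bullet> b) *\<^sub>R b)" by (simp add: euclidean_representation)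
  also have "\<dots> = (\<Sum>b\<in>Basis. (a \<bullet> b) *\<^sub>R pd b f x)" 
    by (simp add: linear_sum[OF l] linear_cmul[OF l])
  finally show ?thesis .
qed

text \<open>The mean value theorem is applied twice: along a to the increment of f in direction b,
  then along b to \<open>pd a f\<close>. The bound on e keeps the whole parallelogram inside the
  ball.\<close>

lemma second_difference_mvt:
  fixes f :: "'a::euclidean_space \<Rightarrow> real"
  assumes "\<And>y. y \<in> ball x r \<Longrightarrow> f differentiable (at y)"
    and "\<And>y. y \<in> ball x r \<Longrightarrow> pd a f differentiable (at y)"
    and e: "e > 0" "e * (norm a + norm b) < r"
  shows "\<exists>y\<in>ball x r. f (x + e *\<^sub>R a + e *\<^sub>R b) - f (x + e *\<^sub>R a) - f (x + e *\<^sub>R b) + f x 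
     = e\<^sup>2 * pd b (pd a f) y"
proof -
  have inb: "x + s *\<^sub>R a + t *\<^sub>R b \<in> ball x r" if "0 \<le> s" "s \<le> e" "0 \<le> t" "t \<le> e" for s t
  proof -
    have "norm (s *\<^sub>R a + t *\<^sub>R b) \<le> s * norm a + t * norm b"
      using that norm_triangle_ineq[of "s *\<^sub>R a" "t *\<^sub>R b"] by simp
    also have "\<dots> \<le> e * norm a + e * norm b" using that by (intro add_mono mult_right_mono) auto
    finally show ?thesis using e by (simp add: dist_norm algebra_simps)
      (metis (no_types) ab_group_add_class.ab_diff_conv_add_uminus add.commute add_diff_cancel_left' dist_norm
        minus_add_distrib norm_minus_cancel order.strict_trans1)
  qed
  have D1: "((\<lambda>s. f (x + s *\<^sub>R a + t *\<^sub>R b)) has_real_derivative pd a f (x + s *\<^sub>R a + t *\<^sub>R b)) (at s)"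
    if "0 \<le> s" "s \<le> e" "0 \<le> t" "t \<le> e" for s t
    using pd_has_vector_derivative_line[of f "x + t *\<^sub>R b" s a] assms(1) inb[OF that]
    by (simp add: has_real_derivative_iff_has_vector_derivative algebra_simps)
  have D2: "((\<lambda>t. pd a f (x + s *\<^sub>R a + t *\<^sub>R b)) has_real_derivative pd b (pd a f) (x + s *\<^sub>R a + t *\<^sub>R b)) (at t)"
    if "0 \<le> s" "s \<le> e" "0 \<le> t" "t \<le> e" for s t
    using pd_has_vector_derivative_line[of "pd a f" "x + s *\<^sub>R a" t b] assms(2) inb[OF that]
    by (simp add: has_real_derivative_iff_has_vector_derivative algebra_simps)
  \<comment> \<open>The term \<open>0 *\<^sub>R b\<close> is kept unsimplified so that
    \<open>D1\<close> applies to it with t = 0.\<close>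
  define \<phi> where "\<phi> s = f (x + s *\<^sub>R a + e *\<^sub>R b) - f (x + s *\<^sub>R a + 0 *\<^sub>R b)" for s
  have "\<exists>z>0. z < e \<and> \<phi> e - \<phi> 0 = (e - 0) * (pd a f (x + z *\<^sub>R a + e *\<^sub>R b) - pd a f (x + z *\<^sub>R a + 0 *\<^sub>R b))"
    unfolding \<phi>_def by (rule MVT2) (use e in \<open>auto intro!: DERIV_diff D1 simp del: scaleR_zero_left\<close>)
  then obtain z where z: "0 < z" "z < e" 
    "\<phi> e - \<phi> 0 = e * (pd a f (x + z *\<^sub>R a + e *\<^sub>R b) - pd a f (x + z *\<^sub>R a + 0 *\<^sub>R b))" by auto
  have "\<exists>w>0. w < e \<and> pd a f (x + z *\<^sub>R a + e *\<^sub>R b) - pd a f (x + z *\<^sub>R a + 0 *\<^sub>R b)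
      = (e - 0) * pd b (pd a f) (x + z *\<^sub>R a + w *\<^sub>R b)"
    by (rule MVT2) (use e z in \<open>auto intro!: D2\<close>)
  then obtain w where w: "0 < w" "w < e" "pd a f (x + z *\<^sub>R a + e *\<^sub>R b) - pd a f (x + z *\<^sub>R a + 0 *\<^sub>R b)
      = e * pd b (pd a f) (x + z *\<^sub>R a + w *\<^sub>R b)" by auto
  show ?thesis
    by (rule bexI[of _ "x + z *\<^sub>R a + w *\<^sub>R b"])
      (use z w inb[of z w] in \<open>auto simp: \<phi>_def power2_eq_square algebra_simps\<close>)
qed

text \<open>Schwarz's theorem: the second difference is symmetric in a and b, so it equals e^2 times
  each mixed derivative at some nearby point. Continuity at x then forces the two values to
  agree.\<close>

lemma pd_commute_real:
  fixes f :: "'a::euclidean_space \<Rightarrow> real"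
  assumes S: "open S" "x \<in> S"
    and f: "\<And>y. y \<in> S \<Longrightarrow> f differentiable (at y)"
    and fa: "\<And>y. y \<in> S \<Longrightarrow> pd a f differentiable (at y)"
    and fb: "\<And>y. y \<in> S \<Longrightarrow> pd b f differentiable (at y)"
    and cab: "continuous_on S (pd a (pd b f))" and cba: "continuous_on S (pd b (pd a f))"
  shows "pd a (pd b f) x = pd b (pd a f) x"
proof (rule ccontr)
  assume ne: "pd a (pd b f) x \<noteq> pd b (pd a f) x"
  define \<epsilon> where "\<epsilon> = \<bar>pd a (pd b f) x - pd b (pd a f) x\<bar> / 2"
  have "\<epsilon> > 0" using ne by (simp add: \<epsilon>_def)
  have "isCont (pd a (pd b f)) x" "isCont (pd b (pd a f)) x"
    using S cab cba by (auto simp: continuous_on_eq_continuous_at)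
  then obtain d1 d2 where d: "d1 > 0" "\<And>y. dist y x < d1 \<Longrightarrow> dist (pd a (pd b f) y) (pd a (pd b f) x) < \<epsilon>"
     "d2 > 0" "\<And>y. dist y x < d2 \<Longrightarrow> dist (pd b (pd a f) y) (pd b (pd a f) x) < \<epsilon>"
    using \<open>\<epsilon> > 0\<close> unfolding continuous_at_eps_delta by metis
  obtain d3 where d3: "d3 > 0" "ball x d3 \<subseteq> S" using S by (meson open_contains_ball)
  define r where "r = min d1 (min d2 d3)"
  have r: "r > 0" "r \<le> d1" "r \<le> d2" "ball x r \<subseteq> S" using d d3 by (auto simp: r_def)
  define e where "e = r / (2 * (norm a + norm b + 1))"
  have "0 < norm a + norm b + 1" by (simp add: add_nonneg_pos)
  then have e: "e > 0" "e * (norm a + norm b) < r" "e * (norm b + norm a) < r" 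
    using r by (auto simp: e_def pos_divide_less_eq algebra_simps intro!: divide_pos_pos add_pos_pos add_nonneg_pos)
  have sub: "y \<in> S" if "y \<in> ball x r" for y using r that by blast
  obtain y where y: "y \<in> ball x r" 
    "f (x + e *\<^sub>R a + e *\<^sub>R b) - f (x + e *\<^sub>R a) - f (x + e *\<^sub>R b) + f x = e\<^sup>2 * pd b (pd a f) y"
    using second_difference_mvt[OF f[OF sub] fa[OF sub] e(1,2)] by blast
  obtain z where z: "z \<in> ball x r" 
    "f (x + e *\<^sub>R b + e *\<^sub>R a) - f (x + e *\<^sub>R b) - f (x + e *\<^sub>R a) + f x = e\<^sup>2 * pd a (pd b f) z"
    using second_difference_mvt[OF f[OF sub] fb[OF sub] e(1,3)] by blast
  have "e\<^sup>2 * pd b (pd a f) y = e\<^sup>2 * pd a (pd b f) z"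
    using y(2) z(2) by (simp add: algebra_simps)
  then have "pd b (pd a f) y = pd a (pd b f) z" using e by simp
  moreover have "dist (pd b (pd a f) y) (pd b (pd a f) x) < \<epsilon>" "dist (pd a (pd b f) z) (pd a (pd b f) x) < \<epsilon>"
    using d(2)[of z] d(4)[of y] y(1) z(1) r by (simp_all add: dist_commute)
  ultimately show False unfolding \<epsilon>_def dist_real_def by (auto simp: abs_if split: if_splits)
qed

text \<open>The real case is applied to real and imaginary parts, which commute with partial
  derivatives because they are bounded linear maps.\<close>

lemma pd_commute_complex:
  fixes f :: "'a::euclidean_space \<Rightarrow> complex"
  assumes S: "open S" "x \<in> S"
    and f: "\<And>y. y \<in> S \<Longrightarrow> f differentiable (at y)"
    and fa: "\<And>y. y \<in> S \<Longrightarrow> pd a f differentiable (at y)"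
    and fb: "\<And>y. y \<in> S \<Longrightarrow> pd b f differentiable (at y)"
    and cab: "continuous_on S (pd a (pd b f))" and cba: "continuous_on S (pd b (pd a f))"
  shows "pd a (pd b f) x = pd b (pd a f) x"
proof -
  have L: "pd a (pd b (\<lambda>x. L (f x))) x = pd b (pd a (\<lambda>x. L (f x))) x \<and>
     pd a (pd b (\<lambda>x. L (f x))) x = L (pd a (pd b f) x) \<and> pd b (pd a (\<lambda>x. L (f x))) x = L (pd b (pd a f) x)"
    if L: "bounded_linear L" for L :: "complex \<Rightarrow> real"
  proof -
    have 1: "pd c (\<lambda>x. L (f x)) y = L (pd c f y)" if "y \<in> S" for y c
      using pd_linear[OF L f[OF that]] .
    have df: "(\<lambda>x. L (g x)) differentiable (at y)" if "g differentiable (at y)" for g :: "'a \<Rightarrow> complex" and y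
      using bounded_linear.has_derivative[OF L] that unfolding differentiable_def by blast
    have 2: "pd c (pd e (\<lambda>x. L (f x))) y = L (pd c (pd e f) y)" 
      if "y \<in> S" "pd e f differentiable (at y)" for y c e
    proof -
      have "pd c (pd e (\<lambda>x. L (f x))) y = pd c (\<lambda>y. L (pd e f y)) y"
        by (rule pd_eq_on_open[OF S(1) that(1)]) (simp add: 1)
      then show ?thesis using pd_linear[OF L that(2)] by simp
    qed
    have "pd a (pd b (\<lambda>x. L (f x))) x = pd b (pd a (\<lambda>x. L (f x))) x"
    proof (rule pd_commute_real[OF S])
      show "(\<lambda>x. L (f x)) differentiable at y" if "y \<in> S" for y using df f that by blast
      show "pd a (\<lambda>x. L (f x)) differentiable at y" if "y \<in> S" for y 
        by (rule differentiable_eq_on_open[OF S(1) that _ df[OF fa[OF that]]]) (simp add: 1)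
      show "pd b (\<lambda>x. L (f x)) differentiable at y" if "y \<in> S" for y 
        by (rule differentiable_eq_on_open[OF S(1) that _ df[OF fb[OF that]]]) (simp add: 1)
      have "continuous_on S (\<lambda>y. L (pd a (pd b f) y))" "continuous_on S (\<lambda>y. L (pd b (pd a f) y))"
        using L cab cba bounded_linear.continuous_on by blast+
      then show "continuous_on S (pd a (pd b (\<lambda>x. L (f x))))" "continuous_on S (pd b (pd a (\<lambda>x. L (f x))))"
        by (simp_all add: 2 fa fb cong: continuous_on_cong)
    qed
    then show ?thesis using 2 fa fb S by simp
  qed
  show ?thesis using L[OF bounded_linear_Re] L[OF bounded_linear_Im] by (auto simp: complex_eq_iff)
qed

section \<open>Closure properties of C^k and smooth functions\<close>

lemma Ck_on_Suc_imp: "Ck_on (Suc k) f S \<Longrightarrow> Ck_on k f S"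
proof (induction k arbitrary: f)
  case 0
  then show ?case by (auto intro!: differentiable_imp_continuous_on differentiable_at_imp_differentiable_on)
qed auto

lemma Ck_on_const: "Ck_on k (\<lambda>x. c) S"
  by (induction k arbitrary: c) auto

text \<open>Taking the whole space as domain turns the pointwise derivative rules into equalities of
  functions, which is what the recursion in \<open>Ck_on\<close> rewrites with.\<close>

lemma Ck_on_add: "Ck_on k f UNIV \<Longrightarrow> Ck_on k g UNIV \<Longrightarrow> Ck_on k (\<lambda>x. f x + g x) UNIV"
proof (induction k arbitrary: f g)
  case (Suc k)
  then show ?case by (auto intro!: differentiable_add simp: pd_add)
qed (auto intro!: continuous_intros)

lemma Ck_on_mult: 
  fixes f g :: "'a::euclidean_space \<Rightarrow> 'b::real_normed_algebra"
  shows "Ck_on k f UNIV \<Longrightarrow> Ck_on k g UNIV \<Longrightarrow> Ck_on k (\<lambda>x. f x * g x) UNIV"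
proof (induction k arbitrary: f g)
  case (Suc k)
  then show ?case using Ck_on_Suc_imp[OF Suc.prems(1)] Ck_on_Suc_imp[OF Suc.prems(2)]
    by (auto intro!: differentiable_mult Ck_on_add simp: pd_mult)
qed (auto intro!: continuous_intros)

lemma smooth_const: "smooth_on (\<lambda>x. c) UNIV"
  by (simp add: smooth_on_def Ck_on_const)

lemma smooth_add: "smooth_on f UNIV \<Longrightarrow> smooth_on g UNIV \<Longrightarrow> smooth_on (\<lambda>x. f x + g x) UNIV"
  by (simp add: smooth_on_def Ck_on_add)

lemma smooth_mult: 
  fixes f g :: "'a::euclidean_space \<Rightarrow> 'b::real_normed_algebra"
  shows "smooth_on f UNIV \<Longrightarrow> smooth_on g UNIV \<Longrightarrow> smooth_on (\<lambda>x. f x * g x) UNIV"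
  by (simp add: smooth_on_def Ck_on_mult)

lemma smooth_cmult: 
  fixes f :: "'a::euclidean_space \<Rightarrow> 'b::real_normed_algebra"
  shows "smooth_on f UNIV \<Longrightarrow> smooth_on (\<lambda>x. c * f x) UNIV"
  by (intro smooth_mult smooth_const)

lemma smooth_diff: 
  fixes f g :: "'a::euclidean_space \<Rightarrow> 'b::real_normed_algebra_1"
  shows "smooth_on f UNIV \<Longrightarrow> smooth_on g UNIV \<Longrightarrow> smooth_on (\<lambda>x. f x - g x) UNIV"
  using smooth_add[of f "\<lambda>x. (-1) * g x"] smooth_cmult[of g "-1"] by simp

lemma smooth_sum: "(\<And>i. i \<in> I \<Longrightarrow> smooth_on (f i) UNIV) \<Longrightarrow> smooth_on (\<lambda>x. \<Sum>i\<in>I. f i x) UNIV"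
  by (induction I rule: infinite_finite_induct) (auto intro!: smooth_const smooth_add)

lemma smooth_prod: 
  fixes f :: "'i \<Rightarrow> 'a::euclidean_space \<Rightarrow> 'b::{real_normed_algebra_1, comm_ring_1}"
  shows "(\<And>i. i \<in> I \<Longrightarrow> smooth_on (f i) UNIV) \<Longrightarrow> smooth_on (\<lambda>x. \<Prod>i\<in>I. f i x) UNIV"
  by (induction I rule: infinite_finite_induct) (auto intro!: smooth_const smooth_mult)

lemma smooth_pd: "smooth_on f UNIV \<Longrightarrow> b \<in> Basis \<Longrightarrow> smooth_on (pd b f) UNIV"
  unfolding smooth_on_def by (metis Ck_on.simps(2))

lemma smooth_differentiable: "smooth_on f UNIV \<Longrightarrow> f differentiable (at x)"
  unfolding smooth_on_def by (metis Ck_on.simps(2) UNIV_I)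

lemma smooth_continuous: "smooth_on f UNIV \<Longrightarrow> continuous_on A f"
  unfolding smooth_on_def by (metis Ck_on.simps(1) continuous_on_subset top_greatest)

lemma pd_commute:
  fixes f :: "'a::euclidean_space \<Rightarrow> complex"
  assumes "smooth_on f UNIV" "a \<in> Basis" "b \<in> Basis"
  shows "pd a (pd b f) x = pd b (pd a f) x"
  by (rule pd_commute_complex[of UNIV]) 
     (auto intro!: smooth_differentiable smooth_continuous smooth_pd assms)

section \<open>Bump functions\<close>

text \<open>The classical function exp(-1/t) is the case k = 0. Dividing by powers of t gives a
  family whose derivatives are again combinations of its members.\<close>

definition flat :: "nat \<Rightarrow> real \<Rightarrow> real" where
  "flat k t = (if t > 0 then exp (- 1 / t) / t ^ k else 0)"

text \<open>With s = 1/t this is the decay of s^k exp(-s) at infinity; on the left the function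
  vanishes identically.\<close>

lemma flat_tendsto_0: "(flat k \<longlongrightarrow> 0) (at 0)"
proof -
  have "((\<lambda>t::real. inverse t ^ k / exp (inverse t)) \<longlongrightarrow> 0) (at_right 0)"
    by (rule filterlim_compose[OF tendsto_power_div_exp_0 filterlim_inverse_at_top_right])
  then have "(flat k \<longlongrightarrow> 0) (at_right 0)"
    by (rule Lim_transform_eventually) 
      (auto simp: eventually_at_right_field flat_def exp_minus field_simps intro!: exI[of _ 1])
  moreover have "(flat k \<longlongrightarrow> 0) (at_left 0)"
    by (rule Lim_transform_eventually[of "\<lambda>_. 0"]) 
      (auto simp: eventually_at_left_field flat_def intro!: exI[of _ "-1"])
  ultimately show ?thesis by (simp add: filterlim_split_at)
qed

lemma flat_deriv: "(flat k has_real_derivative (flat (k + 2) t - k * flat (k + 1) t)) (at t)"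
proof (rule linorder_cases[of t 0])
  assume "t < 0"
  have "((\<lambda>_. 0) has_real_derivative 0) (at t)" by simp
  then have "(flat k has_real_derivative 0) (at t)"
    by (rule has_field_derivative_transform_within_open[of _ _ _ "{..<0}"]) (use \<open>t < 0\<close> in \<open>auto simp: flat_def\<close>)
  then show ?thesis using \<open>t < 0\<close> by (simp add: flat_def)
next
  assume t: "t = 0"
  \<comment> \<open>The difference quotient at 0 is \<open>flat (k + 1)\<close> itself.\<close>
  have "((\<lambda>h. (flat k (0 + h) - flat k 0) / h) \<longlongrightarrow> 0) (at 0)"
    by (rule Lim_transform_eventually[OF flat_tendsto_0[of "k+1"]])
       (auto simp: flat_def eventually_at_filter)
  then show ?thesis by (simp add: t DERIV_def) (simp add: flat_def)
next
  assume "t > 0"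
  have "((\<lambda>t. exp (- 1 / t) / t ^ k) has_real_derivative 
     (flat (k + 2) t - k * flat (k + 1) t)) (at t)"
  proof (cases k)
    case 0
    then show ?thesis using \<open>t > 0\<close> 
      by (auto intro!: derivative_eq_intros simp: flat_def field_simps power2_eq_square)
  next
    case (Suc i)
    have [simp]: "t ^ (i + i) = t ^ i * t ^ i" by (simp add: power_add)
    show ?thesis using \<open>t > 0\<close> unfolding Suc
      by (auto intro!: derivative_eq_intros simp: flat_def field_simps power2_eq_square)
        (cases i; simp)
  qed
  then show ?thesis
    by (rule has_field_derivative_transform_within_open[of _ _ _ "{0<..}"]) (use \<open>t > 0\<close> in \<open>auto simp: flat_def\<close>)
qed

lemma flat_affine_derivative:
  fixes b :: "'a::euclidean_space"
  shows "((\<lambda>x. complex_of_real (flat k (c * (x \<bullet> b) + d))) has_derivative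
    (\<lambda>a. complex_of_real (c * (a \<bullet> b) * (flat (k + 2) (c * (x \<bullet> b) + d) - k * flat (k + 1) (c * (x \<bullet> b) + d))))) (at x)"
proof -
  have "((\<lambda>x. flat k (c * (x \<bullet> b) + d)) has_derivative
      (\<lambda>a. (flat (k + 2) (c * (x \<bullet> b) + d) - k * flat (k + 1) (c * (x \<bullet> b) + d)) * (c * (a \<bullet> b)))) (at x)"
    by (rule has_derivative_compose[where g="flat k" and f="\<lambda>x. c * (x \<bullet> b) + d", OF _ flat_deriv[unfolded has_field_derivative_def]])
       (auto intro!: derivative_eq_intros)
  from has_derivative_of_real[OF this] show ?thesis by (simp add: mult_ac)
qed

text \<open>The index k stays arbitrary in the induction, because one derivative produces the
  functions of index k + 1 and k + 2.\<close>

lemma Ck_on_flat_affine: "Ck_on n (\<lambda>x::'a::euclidean_space. complex_of_real (flat k (c * (x \<bullet> b) + d))) UNIV"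
proof (induction n arbitrary: k)
  case 0
  show ?case using has_derivative_continuous[OF flat_affine_derivative]
    unfolding Ck_on.simps continuous_on_eq_continuous_at[OF open_UNIV] by blast
next
  case (Suc n)
  have "Ck_on n (pd a (\<lambda>x::'a. complex_of_real (flat k (c * (x \<bullet> b) + d)))) UNIV" for a
  proof -
    have "pd a (\<lambda>x::'a. complex_of_real (flat k (c * (x \<bullet> b) + d))) = 
       (\<lambda>x. complex_of_real (c * (a \<bullet> b)) * complex_of_real (flat (k + 2) (c * (x \<bullet> b) + d)) + 
          complex_of_real (- (c * (a \<bullet> b)) * k) * complex_of_real (flat (k + 1) (c * (x \<bullet> b) + d)))"
      by (rule ext, subst pd_eqI[OF flat_affine_derivative]) (simp add: algebra_simps)
    then show ?thesis by (simp only:) (intro Ck_on_add Ck_on_mult Ck_on_const Suc.IH)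
  qed
  moreover have "(\<lambda>x. complex_of_real (flat k (c * (x \<bullet> b) + d))) differentiable (at x)" for x :: 'a
    using flat_affine_derivative differentiable_def by blast
  ultimately show ?case by auto
qed

text \<open>For t > 0 each factor has the form exp(-1/(m t)), which tends to 1 as m grows, so these
  functions approximate the indicator of the open box. The case m = 1 also supplies the
  mollifier.\<close>

definition bump :: "'a::euclidean_space \<Rightarrow> 'a \<Rightarrow> nat \<Rightarrow> 'a \<Rightarrow> real" where
  "bump l u m x = (\<Prod>b\<in>Basis. flat 0 (m * (x \<bullet> b - l \<bullet> b)) * flat 0 (m * (u \<bullet> b - x \<bullet> b)))"

lemma smooth_bump: "smooth_on (\<lambda>x. complex_of_real (bump l u m x)) UNIV"
proof -
  have "(\<lambda>x. complex_of_real (bump l u m x)) = (\<lambda>x. \<Prod>b\<in>Basis. 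
      complex_of_real (flat 0 (real m * (x \<bullet> b) + (- real m * (l \<bullet> b)))) * complex_of_real (flat 0 ((- real m) * (x \<bullet> b) + real m * (u \<bullet> b))))"
    by (simp add: bump_def algebra_simps)
  moreover have "smooth_on \<dots> UNIV"
    by (intro smooth_prod smooth_mult) (simp_all only: smooth_on_def Ck_on_flat_affine simp_thms)
  ultimately show ?thesis by simp
qed

lemma flat_0_bounds: "0 \<le> flat 0 t" "flat 0 t \<le> 1"
  by (auto simp: flat_def)

lemma bump_bounds: "0 \<le> bump l u m x" "bump l u m x \<le> 1"
  unfolding bump_def by (auto intro!: prod_nonneg prod_le_1 mult_nonneg_nonneg mult_le_one flat_0_bounds)

lemma bump_outside: 
  assumes "x \<notin> box l u" 
  shows "bump l u m x = 0"
proof -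
  obtain b where b: "b \<in> Basis" "x \<bullet> b \<le> l \<bullet> b \<or> u \<bullet> b \<le> x \<bullet> b" using assms by (auto simp: mem_box not_less)
  then have "flat 0 (m * (x \<bullet> b - l \<bullet> b)) * flat 0 (m * (u \<bullet> b - x \<bullet> b)) = 0"
    by (auto simp: flat_def zero_less_mult_iff)
  then show ?thesis unfolding bump_def using b(1) by (meson finite_Basis prod_zero)
qed

lemma bump_pos: "x \<in> box l u \<Longrightarrow> m > 0 \<Longrightarrow> bump l u m x > 0"
  by (auto simp: bump_def mem_box flat_def intro!: prod_pos)

lemma bump_tendsto: "(\<lambda>m. bump l u m x) \<longlonglongrightarrow> indicator (box l u) x"
proof (cases "x \<in> box l u")
  case True
  have f: "(\<lambda>m. flat 0 (real m * t)) \<longlonglongrightarrow> 1" if "t > 0" for t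
  proof -
    have "(\<lambda>m. exp (- inverse t * inverse (real m))) \<longlonglongrightarrow> exp (- inverse t * 0)"
      by (intro tendsto_intros lim_inverse_n)
    then have "(\<lambda>m. exp (- inverse t * inverse (real m))) \<longlonglongrightarrow> 1" by simp
    then show ?thesis 
      by (rule Lim_transform_eventually) 
        (use that in \<open>auto simp: eventually_sequentially flat_def field_simps intro!: exI[of _ 1]\<close>)
  qed
  have "(\<lambda>m. bump l u m x) \<longlonglongrightarrow> (\<Prod>b\<in>(Basis::'a set). 1 * 1)"
    unfolding bump_def using True by (intro tendsto_prod tendsto_mult f) (auto simp: mem_box)
  then show ?thesis using True by simp
qed (simp add: bump_outside)

section \<open>Wirtinger derivatives\<close>

text \<open>Treats both Wirtinger derivatives at once: s = -\<i> gives \<open>dz\<close> and s =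
  \<i> gives \<open>dzbar\<close>.\<close>

definition wd :: "complex \<Rightarrow> 'n \<Rightarrow> (complex ^ 'n \<Rightarrow> complex) \<Rightarrow> complex ^ 'n \<Rightarrow> complex" where
  "wd s j f z = (pd (axis j 1) f z + s * pd (axis j \<i>) f z) / 2"

lemma dz_eq_wd: "dz j f = wd (- \<i>) j f"
  by (auto simp: dz_def wd_def fun_eq_iff)

lemma dzbar_eq_wd: "dzbar j f = wd \<i> j f"
  by (auto simp: dzbar_def wd_def fun_eq_iff)

lemma axis_Basis_complex [simp]: "axis j (1::complex) \<in> Basis" "axis j \<i> \<in> Basis"
  by (auto simp: Basis_vec_def Basis_complex_def)

lemma wd_smooth: "smooth_on f UNIV \<Longrightarrow> smooth_on (wd s j f) UNIV"
proof -
  assume f: "smooth_on f UNIV"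
  have "wd s j f = (\<lambda>z. (1/2) * (pd (axis j 1) f z + s * pd (axis j \<i>) f z))"
    by (auto simp: wd_def fun_eq_iff)
  then show ?thesis using f by (simp only:) (intro smooth_cmult smooth_add smooth_pd f axis_Basis_complex)
qed

lemma wd_const [simp]: "wd s j (\<lambda>z. c) z = 0"
  by (simp add: wd_def)

lemma wd_cmult: "smooth_on f UNIV \<Longrightarrow> wd s j (\<lambda>z. c * f z) z = c * wd s j f z"
  by (simp add: wd_def pd_cmult smooth_differentiable algebra_simps)

lemma wd_add: "smooth_on f UNIV \<Longrightarrow> smooth_on g UNIV \<Longrightarrow> wd s j (\<lambda>z. f z + g z) z = wd s j f z + wd s j g z"
  by (simp add: wd_def pd_add smooth_differentiable field_simps)

lemma wd_diff: "smooth_on f UNIV \<Longrightarrow> smooth_on g UNIV \<Longrightarrow> wd s j (\<lambda>z. f z - g z) z = wd s j f z - wd s j g z"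
  by (simp add: wd_def pd_diff smooth_differentiable field_simps)

lemma wd_mult: "smooth_on f UNIV \<Longrightarrow> smooth_on g UNIV \<Longrightarrow> 
    wd s j (\<lambda>z. f z * g z) z = f z * wd s j g z + wd s j f z * g z"
  by (simp add: wd_def pd_mult smooth_differentiable field_simps)

lemma wd_sum: "(\<And>i. i \<in> I \<Longrightarrow> smooth_on (f i) UNIV) \<Longrightarrow> 
    wd s j (\<lambda>z. \<Sum>i\<in>I. f i z) z = (\<Sum>i\<in>I. wd s j (f i) z)"
proof -
  assume *: "\<And>i. i \<in> I \<Longrightarrow> smooth_on (f i) UNIV"
  have "pd b (\<lambda>z. \<Sum>i\<in>I. f i z) z = (\<Sum>i\<in>I. pd b (f i) z)" for b
    by (rule pd_sum) (rule smooth_differentiable[OF *])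
  then show ?thesis unfolding wd_def by (simp only: sum_distrib_left sum.distrib[symmetric] sum_divide_distrib)
qed

text \<open>Both sides expand into the same four second partials, in the directions 1 and \<i> of
  the two coordinates, and these commute by \<open>pd_commute\<close>.\<close>

lemma wd_commute:
  assumes f: "smooth_on f UNIV"
  shows "wd s i (wd t j f) z = wd t j (wd s i f) z"
proof -
  have ex: "wd s i (wd t j f) z = (1/4) * (pd (axis i 1) (pd (axis j 1) f) z + t * pd (axis i 1) (pd (axis j \<i>) f) z
     + s * pd (axis i \<i>) (pd (axis j 1) f) z + s * t * pd (axis i \<i>) (pd (axis j \<i>) f) z)" for s t i j
  proof -
    have *: "wd t j f = (\<lambda>z. (1/2) * (pd (axis j 1) f z + t * pd (axis j \<i>) f z))"
      by (auto simp: wd_def fun_eq_iff)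
    have pdd: "pd b (wd t j f) z = (1/2) * (pd b (pd (axis j 1) f) z + t * pd b (pd (axis j \<i>) f) z)" for b
    proof -
      have d: "pd (axis j 1) f differentiable (at z)" "pd (axis j \<i>) f differentiable (at z)"
        "(\<lambda>z. t * pd (axis j \<i>) f z) differentiable (at z)"
        "(\<lambda>z. pd (axis j 1) f z + t * pd (axis j \<i>) f z) differentiable (at z)"
        by (intro smooth_differentiable smooth_add smooth_cmult smooth_pd f axis_Basis_complex)+
      show ?thesis unfolding * pd_cmult[OF d(4)] pd_add[OF d(1,3)] pd_cmult[OF d(2)] by (rule refl)
    qed
    show ?thesis unfolding wd_def[of s i] pdd by (simp add: algebra_simps)
  qed
  have c: "pd (axis j x) (pd (axis i y) f) z = pd (axis i y) (pd (axis j x) f) z" if "x \<in> {1, \<i>}" "y \<in> {1, \<i>}" for x y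
    using that by (intro pd_commute f) auto
  show ?thesis unfolding ex[of s i t j] ex[of t j s i] c[OF insertI1 insertI1] c[OF insertI1 insertI2, OF singletonI]
      c[OF insertI2 insertI1, OF singletonI] c[OF insertI2 insertI2, OF singletonI singletonI]
    by (simp add: algebra_simps)
qed

text \<open>The entries of \<open>Hess_C\<close> for complex-valued functions, so that it also
  applies to coefficients of forms.\<close>

definition hess :: "(complex ^ 'n \<Rightarrow> complex) \<Rightarrow> complex ^ 'n \<Rightarrow> 'n \<Rightarrow> 'n \<Rightarrow> complex" where
  "hess f z j k = wd (- \<i>) j (wd \<i> k f) z"

lemma Hess_C_eq_hess: "Hess_C h z $ j $ k = hess (\<lambda>w. complex_of_real (h w)) z j k"
  by (simp add: Hess_C_def hess_def dz_eq_wd dzbar_eq_wd)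

lemma smooth_hess: "smooth_on f UNIV \<Longrightarrow> smooth_on (\<lambda>z. hess f z j k) UNIV"
  unfolding hess_def by (intro wd_smooth)

lemma hess_mult: 
  assumes f: "smooth_on f UNIV" and g: "smooth_on g UNIV"
  shows "hess (\<lambda>z. f z * g z) z j k = hess f z j k * g z + wd \<i> k f z * wd (- \<i>) j g z 
      + wd (- \<i>) j f z * wd \<i> k g z + f z * hess g z j k"
proof -
  have "wd \<i> k (\<lambda>z. f z * g z) = (\<lambda>z. f z * wd \<i> k g z + wd \<i> k f z * g z)"
    using f g by (auto simp: wd_mult)
  then show ?thesis unfolding hess_def
    by (simp add: wd_add wd_mult f g wd_smooth smooth_mult algebra_simps)
qed

section \<open>Exterior multiplication on coefficient arrays\<close>

type_synonym 'n arr = "'n set \<Rightarrow> 'n set \<Rightarrow> complex"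

text \<open>$dz_j\wedge\cdot$ and $d\bar z_k\wedge\cdot$\<close>

definition ew :: "'n::{finite,linorder} \<Rightarrow> 'n arr \<Rightarrow> 'n arr" where
  "ew j a I J = (if j \<in> I then (-1) ^ card {i\<in>I. i < j} * a (I - {j}) J else 0)"

definition fw :: "'n::{finite,linorder} \<Rightarrow> 'n arr \<Rightarrow> 'n arr" where
  "fw k a I J = (if k \<in> J then (-1) ^ (card I + card {i\<in>J. i < k}) * a I (J - {k}) else 0)"

definition efw :: "'n::{finite,linorder} \<Rightarrow> 'n \<Rightarrow> 'n arr \<Rightarrow> 'n arr" where
  "efw j k a = ew j (fw k a)"

text \<open>Removing the smaller index lowers the count belonging to the larger one by one; removing
  the larger index does not affect the count of the smaller. This is the sign of dz_i wedge dz_j = -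
  dz_j wedge dz_i.\<close>

lemma minus_one_power_removal:
  fixes i j :: "'n::{finite,linorder}"
  assumes "i \<in> I" "j \<in> I" "i \<noteq> j"
  shows "(-1::complex) ^ card {x\<in>I. x < i} * (-1) ^ card {x\<in>I - {i}. x < j} = 
      - ((-1) ^ card {x\<in>I. x < j} * (-1) ^ card {x\<in>I - {j}. x < i})"
proof -
  have *: "(-1::complex) ^ card {x\<in>I. x < i} * (-1) ^ card {x\<in>I - {i}. x < j} = 
      - ((-1) ^ card {x\<in>I. x < j} * (-1) ^ card {x\<in>I - {j}. x < i})"
    if "i < j" "i \<in> I" "j \<in> I" for i j
  proof -
    have "{x\<in>I. x < j} = insert i {x\<in>I - {i}. x < j}" "{x\<in>I - {j}. x < i} = {x\<in>I. x < i}"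
      using that by auto
    then show ?thesis by (simp add: card_insert_if)
  qed
  show ?thesis using assms *[of i j] *[of j i] by (cases "i < j") auto
qed

lemma ew_ew: "ew i (ew j a) I J = - ew j (ew i a) I J"
proof (cases "i \<in> I \<and> j \<in> I \<and> i \<noteq> j")
  case True
  have "I - {j} - {i} = I - {i} - {j}" "j \<noteq> i" using True by auto
  then show ?thesis using True minus_one_power_removal[of i I j]
    by (simp add: ew_def mult.assoc[symmetric]) 
qed (auto simp: ew_def)

lemma fw_fw: "fw i (fw j a) I J = - fw j (fw i a) I J"
proof (cases "i \<in> J \<and> j \<in> J \<and> i \<noteq> j")
  case True
  have J: "J - {j} - {i} = J - {i} - {j}" "j \<noteq> i" using True by auto
  have *: "(p * x) * ((p * y) * a I K) = - ((p * z) * ((p * w) * a I K))" 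
    if "x * y = - (z * w)" for p x y z w :: complex and K
  proof -
    have "(p * x) * ((p * y) * a I K) = p * p * (x * y) * a I K" by (simp add: mult_ac)
    then show ?thesis using that by (simp add: mult_ac)
  qed
  show ?thesis using True J *[OF minus_one_power_removal[of i J j]]
    by (simp add: fw_def power_add)
qed (auto simp: fw_def)

text \<open>The sign arises because \<open>card I\<close> in the exponent of \<open>fw\<close> drops
  by one when \<open>ew\<close> has taken j out of I.\<close>

lemma fw_ew: "fw k (ew j a) I J = - ew j (fw k a) I J"
proof (cases "j \<in> I")
  case True
  obtain m where "card I = Suc m" "card (I - {j}) = m" using True by (metis card.remove finite)
  then show ?thesis using True by (simp add: fw_def ew_def power_add mult_ac del: card_Diff_insert card_Diff_singleton)
qed (auto simp: fw_def ew_def)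

lemma ew_minus: "ew j (\<lambda>I J. - a I J) I J = - ew j a I J"
  by (simp add: ew_def)

text \<open>Once both \<open>ew\<close> factors stand in front of both \<open>fw\<close> factors,
  exchanging the two \<open>ew\<close> factors costs one sign. The same rearrangement handles the
  \<open>fw\<close> factors in \<open>efw_efw_right\<close>; the two exchanges together make the
  2-forms commute.\<close>

lemma efw_efw_left: "efw a b (efw c d x) I J = - efw c b (efw a d x) I J"
proof -
  have fe: "fw k (ew j a) = (\<lambda>I J. - ew j (fw k a) I J)" for k j and a :: "'a arr"
    by (intro ext) (rule fw_ew)
  show ?thesis unfolding efw_def fe ew_minus using ew_ew[of a c] by simp
qed

lemma efw_efw_right: "efw a b (efw c d x) I J = - efw a d (efw c b x) I J"
proof -
  have fe: "fw k (ew j a) = (\<lambda>I J. - ew j (fw k a) I J)" for k j and a :: "'a arr"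
    by (intro ext) (rule fw_ew)
  have ff: "fw b (fw d x) = (\<lambda>I J. - fw d (fw b x) I J)" by (intro ext) (rule fw_fw)
  have ee: "ew a (\<lambda>I J. - y I J) = (\<lambda>I J. - ew a y I J)" for y a by (intro ext) (rule ew_minus)
  show ?thesis unfolding efw_def fe ew_minus ff ee by simp
qed

lemma efw_commute: "efw a b (efw c d x) = efw c d (efw a b x)"
  by (intro ext) (subst efw_efw_left, subst efw_efw_right, simp)

lemma efw_sum: "efw j k (\<lambda>I J. \<Sum>s\<in>S. a s I J) I J = (\<Sum>s\<in>S. efw j k (a s) I J)"
  by (simp add: efw_def ew_def fw_def sum_distrib_left)

lemma efw_add: "efw j k (\<lambda>I J. a I J + b I J) I J = efw j k a I J + efw j k b I J"
  by (simp add: efw_def ew_def fw_def algebra_simps)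

lemma efw_cmult: "efw j k (\<lambda>I J. c * a I J) I J = c * efw j k a I J"
  by (simp add: efw_def ew_def fw_def)

lemma antisymmetric_sum_zero:
  fixes F :: "'n::finite \<Rightarrow> 'n \<Rightarrow> complex"
  assumes "\<And>j k. F j k = - F k j"
  shows "(\<Sum>j\<in>UNIV. \<Sum>k\<in>UNIV. F j k) = 0"
proof -
  have "(\<Sum>j\<in>UNIV. \<Sum>k\<in>UNIV. F j k) = (\<Sum>j\<in>UNIV. \<Sum>k\<in>UNIV. - F k j)" by (intro sum.cong refl assms)
  also have "\<dots> = - (\<Sum>j\<in>UNIV. \<Sum>k\<in>UNIV. F j k)" by (subst sum.swap) (simp add: sum_negf)
  finally show ?thesis by simp
qed

text \<open>The sum of dz_a wedge d zbar_b wedge dz_j wedge d zbar_k wedge c_abjk, the common shape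
  of both sides in \<open>ddc_ddc\<close>.\<close>

definition ew4 :: "('n::{finite,linorder} \<Rightarrow> 'n \<Rightarrow> 'n \<Rightarrow> 'n \<Rightarrow> 'n arr) \<Rightarrow> 'n arr" where
  "ew4 c I J = (\<Sum>a\<in>UNIV. \<Sum>b\<in>UNIV. \<Sum>j\<in>UNIV. \<Sum>k\<in>UNIV. efw a b (efw j k (c a b j k)) I J)"

lemma ew4_add: "ew4 (\<lambda>a b j k I J. c a b j k I J + d a b j k I J) I J = ew4 c I J + ew4 d I J"
proof -
  have "efw j k (\<lambda>I J. x I J + y I J) = (\<lambda>I J. efw j k x I J + efw j k y I J)" for j k and x y :: "'a arr"
    by (intro ext) (rule efw_add)
  then show ?thesis unfolding ew4_def by (simp add: efw_add sum.distrib)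
qed

text \<open>A coefficient symmetric in the two dz indices is summed against a product antisymmetric
  in them.\<close>

lemma ew4_zero_left:
  assumes "\<And>a b j k. c a b j k = c j b a k"
  shows "ew4 c I J = 0"
proof -
  have "ew4 c I J = (\<Sum>b\<in>UNIV. \<Sum>k\<in>UNIV. \<Sum>a\<in>UNIV. \<Sum>j\<in>UNIV. efw a b (efw j k (c a b j k)) I J)"
    unfolding ew4_def by (simp add: sum.cartesian_product split_def) 
      (rule sum.reindex_bij_witness[of _ "\<lambda>(b,k,a,j). (a,b,j,k)" "\<lambda>(a,b,j,k). (b,k,a,j)"]; auto)
  also have "\<dots> = 0"
    by (intro sum.neutral ballI antisymmetric_sum_zero) (subst efw_efw_left, subst assms, rule refl)
  finally show ?thesis .
qed

lemma ew4_zero_right: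
  assumes "\<And>a b j k. c a b j k = c a k j b"
  shows "ew4 c I J = 0"
proof -
  have "ew4 c I J = (\<Sum>a\<in>UNIV. \<Sum>j\<in>UNIV. \<Sum>b\<in>UNIV. \<Sum>k\<in>UNIV. efw a b (efw j k (c a b j k)) I J)"
    unfolding ew4_def
    by (rule sum.cong[OF refl]) (rule sum.swap)
  also have "\<dots> = 0"
    by (intro sum.neutral ballI antisymmetric_sum_zero) (subst efw_efw_right, subst assms, rule refl)
  finally show ?thesis .
qed

lemma ew4_swap: "ew4 c I J = ew4 (\<lambda>a b j k. c j k a b) I J"
proof -
  have sw: "(\<Sum>a\<in>UNIV. \<Sum>b\<in>UNIV. \<Sum>j\<in>UNIV. \<Sum>k\<in>UNIV. G a b j k) 
     = (\<Sum>j\<in>UNIV. \<Sum>k\<in>UNIV. \<Sum>a\<in>UNIV. \<Sum>b\<in>UNIV. G a b j k)" for G :: "'a \<Rightarrow> 'a \<Rightarrow> 'a \<Rightarrow> 'a \<Rightarrow> complex"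
    by (simp add: sum.cartesian_product split_def) 
      (rule sum.reindex_bij_witness[of _ "\<lambda>(j,k,a,b). (a,b,j,k)" "\<lambda>(a,b,j,k). (j,k,a,b)"]; auto)
  show ?thesis unfolding ew4_def by (subst sw) (intro sum.cong refl fun_cong[OF fun_cong[OF efw_commute]])
qed

section \<open>The operator $dd^c$ on smooth forms\<close>

definition smooth_form :: "'n::finite form \<Rightarrow> bool" where
  "smooth_form \<phi> \<longleftrightarrow> (\<forall>I J. smooth_on (\<lambda>z. \<phi> z I J) UNIV)"

text \<open>For H the complex Hessian of u this is dd^c u wedge a; the factor 2\<i> is the one in
  dd^c.\<close>

definition wedge11 :: "('n::{finite,linorder} \<Rightarrow> 'n \<Rightarrow> complex) \<Rightarrow> 'n arr \<Rightarrow> 'n arr" where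
  "wedge11 H a I J = 2 * \<i> * (\<Sum>j\<in>UNIV. \<Sum>k\<in>UNIV. H j k * efw j k a I J)"

lemma smooth_ew: "smooth_form \<phi> \<Longrightarrow> smooth_form (\<lambda>z. ew j (\<phi> z))"
  unfolding smooth_form_def
proof (intro allI)
  fix I J
  assume "\<forall>I J. smooth_on (\<lambda>z. \<phi> z I J) UNIV"
  then show "smooth_on (\<lambda>z. ew j (\<phi> z) I J) UNIV"
    unfolding ew_def by (cases "j \<in> I") (simp_all add: smooth_cmult smooth_const)
qed

lemma smooth_fw: "smooth_form \<phi> \<Longrightarrow> smooth_form (\<lambda>z. fw j (\<phi> z))"
  unfolding smooth_form_def
proof (intro allI)
  fix I J
  assume "\<forall>I J. smooth_on (\<lambda>z. \<phi> z I J) UNIV"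
  then show "smooth_on (\<lambda>z. fw j (\<phi> z) I J) UNIV"
    unfolding fw_def by (cases "j \<in> J") (simp_all add: smooth_cmult smooth_const)
qed

lemma smooth_efw: "smooth_form \<phi> \<Longrightarrow> smooth_form (\<lambda>z. efw j k (\<phi> z))"
  unfolding efw_def by (intro smooth_ew smooth_fw)

lemma wd_ew: "smooth_form \<phi> \<Longrightarrow> wd s j (\<lambda>w. ew k (\<phi> w) I J) z = ew k (\<lambda>I J. wd s j (\<lambda>w. \<phi> w I J) z) I J"
  unfolding smooth_form_def ew_def by (cases "k \<in> I") (simp_all add: wd_cmult)

lemma wd_fw: "smooth_form \<phi> \<Longrightarrow> wd s j (\<lambda>w. fw k (\<phi> w) I J) z = fw k (\<lambda>I J. wd s j (\<lambda>w. \<phi> w I J) z) I J"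
  unfolding smooth_form_def fw_def by (cases "k \<in> J") (simp_all add: wd_cmult)

lemma wd_efw: "smooth_form \<phi> \<Longrightarrow> wd s j (\<lambda>w. efw i k (\<phi> w) I J) z = efw i k (\<lambda>I J. wd s j (\<lambda>w. \<phi> w I J) z) I J"
  unfolding efw_def by (simp add: wd_ew smooth_fw wd_fw)

lemma smooth_form_wd: "smooth_form \<phi> \<Longrightarrow> smooth_form (\<lambda>z I J. wd s j (\<lambda>w. \<phi> w I J) z)"
  unfolding smooth_form_def by (auto intro!: wd_smooth)

lemma smooth_form_hess: "smooth_form \<phi> \<Longrightarrow> smooth_form (\<lambda>z I J. hess (\<lambda>w. \<phi> w I J) z j k)"
  unfolding smooth_form_def by (auto intro!: smooth_hess)

lemma del_eq: "del \<phi> z I J = (\<Sum>j\<in>UNIV. ew j (\<lambda>I J. wd (- \<i>) j (\<lambda>w. \<phi> w I J) z) I J)"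
  unfolding del_def dz_eq_wd ew_def by (rule sum.mono_neutral_cong_left) auto

lemma delbar_eq: "delbar \<phi> z I J = (\<Sum>j\<in>UNIV. fw j (\<lambda>I J. wd \<i> j (\<lambda>w. \<phi> w I J) z) I J)"
  unfolding delbar_def dzbar_eq_wd fw_def by (rule sum.mono_neutral_cong_left) auto

text \<open>Expanding d d^c gives four blocks. The two with equal types of derivatives vanish, being
  symmetric derivatives summed against antisymmetric products; the two mixed ones coincide and
  produce the factor 2.\<close>

lemma ddc_smooth:
  assumes \<phi>: "smooth_form \<phi>"
  shows "ext_d (ext_dc \<phi>) z I J = 2 * \<i> * (\<Sum>j\<in>UNIV. \<Sum>k\<in>UNIV. efw j k (\<lambda>I J. hess (\<lambda>w. \<phi> w I J) z j k) I J)"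
proof -
  let ?d = "\<lambda>k z I J. wd (- \<i>) k (\<lambda>w. \<phi> w I J) z" and ?b = "\<lambda>k z I J. wd \<i> k (\<lambda>w. \<phi> w I J) z"
  have sd: "smooth_form (?d k)" and sb: "smooth_form (?b k)" for k
    by (intro smooth_form_wd \<phi>)+
  have dc: "ext_dc \<phi> w I J = \<i> * ((\<Sum>k\<in>UNIV. fw k (?b k w) I J) - (\<Sum>k\<in>UNIV. ew k (?d k w) I J))" for w I J
    by (simp add: ext_dc_def del_eq delbar_eq)
  have sm: "smooth_on (\<lambda>w. fw k (?b k w) I J) UNIV" "smooth_on (\<lambda>w. ew k (?d k w) I J) UNIV" for k I J
    using smooth_fw[OF sb, of k k] smooth_ew[OF sd, of k k] by (auto simp: smooth_form_def)
  have smA: "smooth_on (\<lambda>w. \<Sum>k\<in>UNIV. fw k (?b k w) I J) UNIV" "smooth_on (\<lambda>w. \<Sum>k\<in>UNIV. ew k (?d k w) I J) UNIV" for I J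
    by (intro smooth_sum sm)+
  have w: "wd s j (\<lambda>w. ext_dc \<phi> w I J) z = \<i> * ((\<Sum>k\<in>UNIV. fw k (\<lambda>I J. wd s j (\<lambda>w. ?b k w I J) z) I J) 
       - (\<Sum>k\<in>UNIV. ew k (\<lambda>I J. wd s j (\<lambda>w. ?d k w I J) z) I J))" for s j I J
    unfolding dc wd_cmult[OF smooth_diff[OF smA]] wd_diff[OF smA] wd_sum[OF sm(1)] wd_sum[OF sm(2)] 
      wd_ew[OF sd] wd_fw[OF sb] ..
  have ewl: "ew j (\<lambda>I J. \<i> * ((\<Sum>k\<in>UNIV. X k I J) - (\<Sum>k\<in>UNIV. Y k I J))) I J 
     = \<i> * ((\<Sum>k\<in>UNIV. ew j (X k) I J) - (\<Sum>k\<in>UNIV. ew j (Y k) I J))" for j and X Y :: "'a \<Rightarrow> 'a arr"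
  proof (cases "j \<in> I")
    case True
    have "c * (\<i> * (S - T)) = \<i> * (c * S - c * T)" for c S T :: complex by (simp add: algebra_simps)
    then show ?thesis using True unfolding ew_def by (simp only: if_True sum_distrib_left[symmetric])
  qed (simp add: ew_def)
  have fwl: "fw j (\<lambda>I J. \<i> * ((\<Sum>k\<in>UNIV. X k I J) - (\<Sum>k\<in>UNIV. Y k I J))) I J 
     = \<i> * ((\<Sum>k\<in>UNIV. fw j (X k) I J) - (\<Sum>k\<in>UNIV. fw j (Y k) I J))" for j and X Y :: "'a \<Rightarrow> 'a arr"
  proof (cases "j \<in> J")
    case True
    have "c * (\<i> * (S - T)) = \<i> * (c * S - c * T)" for c S T :: complex by (simp add: algebra_simps)
    then show ?thesis using True unfolding fw_def by (simp only: if_True sum_distrib_left[symmetric])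
  qed (simp add: fw_def)
  have s\<phi>: "smooth_on (\<lambda>w. \<phi> w I J) UNIV" for I J using \<phi> by (simp add: smooth_form_def)
  have comm: "(\<lambda>I J. wd s j (\<lambda>w. wd t k (\<lambda>w. \<phi> w I J) w) z) = (\<lambda>I J. wd t k (\<lambda>w. wd s j (\<lambda>w. \<phi> w I J) w) z)" for s t j k
    by (intro ext wd_commute s\<phi>)
  have 1: "(\<Sum>j\<in>UNIV. \<Sum>k\<in>UNIV. ew j (ew k (\<lambda>I J. wd (- \<i>) j (\<lambda>w. ?d k w I J) z)) I J) = 0"
    by (rule antisymmetric_sum_zero) (subst ew_ew, subst comm, rule refl)
  have 2: "(\<Sum>j\<in>UNIV. \<Sum>k\<in>UNIV. fw j (fw k (\<lambda>I J. wd \<i> j (\<lambda>w. ?b k w I J) z)) I J) = 0"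
    by (rule antisymmetric_sum_zero) (subst fw_fw, subst comm, rule refl)
  \<comment> \<open>The mixed blocks: the sign of \<open>fw_ew\<close> cancels the minus in the
    definition of d^c, so they add up instead of cancelling.\<close>
  have 3: "(\<Sum>j\<in>UNIV. \<Sum>k\<in>UNIV. fw j (ew k (\<lambda>I J. wd \<i> j (\<lambda>w. ?d k w I J) z)) I J) =
    - (\<Sum>j\<in>UNIV. \<Sum>k\<in>UNIV. ew j (fw k (\<lambda>I J. wd (- \<i>) j (\<lambda>w. ?b k w I J) z)) I J)"
    unfolding sum_negf[symmetric] by (subst sum.swap, subst fw_ew, subst comm) (rule refl)
  have A: "(\<Sum>j\<in>UNIV. \<i> * (A j - B j)) = \<i> * ((\<Sum>j\<in>UNIV. A j) - (\<Sum>j\<in>UNIV. B j))" for A B :: "'a \<Rightarrow> complex"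
    by (simp only: sum_subtractf[symmetric] sum_distrib_left)
  have "ext_d (ext_dc \<phi>) z I J = 
       (\<Sum>j\<in>UNIV. \<i> * ((\<Sum>k\<in>UNIV. ew j (fw k (\<lambda>I J. wd (- \<i>) j (\<lambda>w. ?b k w I J) z)) I J)
          - (\<Sum>k\<in>UNIV. ew j (ew k (\<lambda>I J. wd (- \<i>) j (\<lambda>w. ?d k w I J) z)) I J))) +
       (\<Sum>j\<in>UNIV. \<i> * ((\<Sum>k\<in>UNIV. fw j (fw k (\<lambda>I J. wd \<i> j (\<lambda>w. ?b k w I J) z)) I J)
          - (\<Sum>k\<in>UNIV. fw j (ew k (\<lambda>I J. wd \<i> j (\<lambda>w. ?d k w I J) z)) I J)))"
      unfolding ext_d_def del_eq delbar_eq w ewl fwl ..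
    then have "ext_d (ext_dc \<phi>) z I J = 2 * \<i> * (\<Sum>j\<in>UNIV. \<Sum>k\<in>UNIV. ew j (fw k (\<lambda>I J. wd (- \<i>) j (\<lambda>w. ?b k w I J) z)) I J)"
    unfolding A by (simp add: 1 2 3)
    then show ?thesis unfolding efw_def hess_def .
qed

lemma smooth_efw_sum: 
  assumes "\<And>j k. smooth_form (G j k)"
  shows "smooth_form (\<lambda>w I J. c * (\<Sum>j\<in>UNIV. \<Sum>k\<in>UNIV. efw j k (G j k w) I J))"
  using smooth_efw[OF assms] unfolding smooth_form_def
  by (intro allI smooth_cmult smooth_sum) simp

lemma hess_efw_sum:
  assumes G: "\<And>j k. smooth_form (G j k)"
  shows "hess (\<lambda>w. c * (\<Sum>j\<in>UNIV. \<Sum>k\<in>UNIV. efw j k (G j k w) I J)) z a b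
    = c * (\<Sum>j\<in>UNIV. \<Sum>k\<in>UNIV. efw j k (\<lambda>I J. hess (\<lambda>w. G j k w I J) z a b) I J)"
proof -
  have *: "wd s a (\<lambda>w. c * (\<Sum>j\<in>UNIV. \<Sum>k\<in>UNIV. efw j k (G j k w) I J)) z = 
     c * (\<Sum>j\<in>UNIV. \<Sum>k\<in>UNIV. efw j k (\<lambda>I J. wd s a (\<lambda>w. G j k w I J) z) I J)"
    if G: "\<And>j k. smooth_form (G j k)" for s a z and G :: "'a \<Rightarrow> 'a \<Rightarrow> 'a form"
  proof -
    have "smooth_on (\<lambda>w. efw j k (G j k w) I J) UNIV" for j k
      using smooth_efw[OF G] by (auto simp: smooth_form_def)
    note sm = this
    have s2: "smooth_on (\<lambda>w. \<Sum>k\<in>UNIV. efw j k (G j k w) I J) UNIV" 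
      "smooth_on (\<lambda>w. \<Sum>j\<in>UNIV. \<Sum>k\<in>UNIV. efw j k (G j k w) I J) UNIV" for j by (intro smooth_sum sm)+
    show ?thesis unfolding wd_cmult[OF s2(2)] wd_sum[OF s2(1)] wd_sum[OF sm] wd_efw[OF G] ..
  qed
  have 1: "wd \<i> b (\<lambda>w. c * (\<Sum>j\<in>UNIV. \<Sum>k\<in>UNIV. efw j k (G j k w) I J)) = 
     (\<lambda>z. c * (\<Sum>j\<in>UNIV. \<Sum>k\<in>UNIV. efw j k (\<lambda>I J. wd \<i> b (\<lambda>w. G j k w I J) z) I J))"
    by (intro ext * G)
  show ?thesis unfolding hess_def 1 *[OF smooth_form_wd[OF G]] ..
qed

text \<open>By the Leibniz rule both sides become sums of products of derivatives of u and of
  \<phi>. Whenever three or four derivatives fall on one factor, the coefficient is symmetric in two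
  dz or two d zbar indices and the term vanishes. What survives is Hessian times Hessian, and it is
  the same on both sides because 2-forms commute.\<close>

lemma ddc_ddc:
  assumes \<phi>: "smooth_form \<phi>" and u: "smooth_on u UNIV"
  shows "ext_d (ext_dc (\<lambda>z I J. u z * ext_d (ext_dc \<phi>) z I J)) 
       = ext_d (ext_dc (\<lambda>z. wedge11 (hess u z) (\<phi> z)))"
proof (intro ext)
  fix z I J
  have s\<phi>: "smooth_on (\<lambda>w. \<phi> w I J) UNIV" for I J using \<phi> by (simp add: smooth_form_def)
  let ?L = "\<lambda>j k w I J. u w * hess (\<lambda>w. \<phi> w I J) w j k"
  let ?R = "\<lambda>j k w I J. hess u w j k * \<phi> w I J"
  have sL: "smooth_form (?L j k)" and sR: "smooth_form (?R j k)" for j k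
    unfolding smooth_form_def by (intro allI smooth_mult smooth_hess u s\<phi>)+
  have L: "(\<lambda>z I J. u z * ext_d (ext_dc \<phi>) z I J) = 
     (\<lambda>w I J. 2 * \<i> * (\<Sum>j\<in>UNIV. \<Sum>k\<in>UNIV. efw j k (?L j k w) I J))"
    unfolding ddc_smooth[OF \<phi>] efw_cmult sum_distrib_left[symmetric] by (intro ext) (rule mult.left_commute)
  have R: "(\<lambda>z. wedge11 (hess u z) (\<phi> z)) = (\<lambda>w I J. 2 * \<i> * (\<Sum>j\<in>UNIV. \<Sum>k\<in>UNIV. efw j k (?R j k w) I J))"
    by (intro ext) (simp only: wedge11_def efw_cmult)
  \<comment> \<open>Both sides have the form dd^c of an \<open>efw\<close> sum, so one formula
    reduces them to \<open>ew4\<close> expressions.\<close>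
  have gen: "ext_d (ext_dc (\<lambda>w I J. 2 * \<i> * (\<Sum>j\<in>UNIV. \<Sum>k\<in>UNIV. efw j k (G j k w) I J))) z I J
      = (2 * \<i>)\<^sup>2 * ew4 (\<lambda>a b j k I J. hess (\<lambda>w. G j k w I J) z a b) I J"
    if G: "\<And>j k. smooth_form (G j k)" for G :: "'a \<Rightarrow> 'a \<Rightarrow> 'a form"
  proof -
    have e: "efw a b (\<lambda>I J. c * (\<Sum>j\<in>UNIV. \<Sum>k\<in>UNIV. X j k I J)) I J = c * (\<Sum>j\<in>UNIV. \<Sum>k\<in>UNIV. efw a b (X j k) I J)"
      for a b c and X :: "'a \<Rightarrow> 'a \<Rightarrow> 'a arr"
      by (simp only: efw_cmult efw_sum)
    let ?H = "\<lambda>a b j k I J. hess (\<lambda>w. G j k w I J) z a b"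
    have "ext_d (ext_dc (\<lambda>w I J. 2 * \<i> * (\<Sum>j\<in>UNIV. \<Sum>k\<in>UNIV. efw j k (G j k w) I J))) z I J
      = 2 * \<i> * (\<Sum>a\<in>UNIV. \<Sum>b\<in>UNIV. 2 * \<i> * (\<Sum>j\<in>UNIV. \<Sum>k\<in>UNIV. efw a b (efw j k (?H a b j k)) I J))"
      unfolding ddc_smooth[OF smooth_efw_sum[OF G]] hess_efw_sum[OF G] e ..
    moreover have "(\<Sum>a\<in>UNIV. \<Sum>b\<in>UNIV. c * S a b) = c * (\<Sum>a\<in>UNIV. \<Sum>b\<in>UNIV. S a b)" 
      for c and S :: "'a \<Rightarrow> 'a \<Rightarrow> complex"
      by (simp only: sum_distrib_left)
    ultimately show ?thesis
      by (simp only: ew4_def power2_eq_square mult.assoc)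
  qed
  have h1: "hess (\<lambda>w. ?L j k w I J) z a b = 
      hess u z a b * hess (\<lambda>w. \<phi> w I J) z j k + wd \<i> b u z * wd (- \<i>) a (\<lambda>z. hess (\<lambda>w. \<phi> w I J) z j k) z
      + wd (- \<i>) a u z * wd \<i> b (\<lambda>z. hess (\<lambda>w. \<phi> w I J) z j k) z
      + u z * hess (\<lambda>z. hess (\<lambda>w. \<phi> w I J) z j k) z a b" for a b j k I J
    by (rule hess_mult[OF u smooth_hess[OF s\<phi>]])
  have h2: "hess (\<lambda>w. ?R j k w I J) z a b = 
      hess (\<lambda>z. hess u z j k) z a b * \<phi> z I J + wd \<i> b (\<lambda>z. hess u z j k) z * wd (- \<i>) a (\<lambda>w. \<phi> w I J) z
      + wd (- \<i>) a (\<lambda>z. hess u z j k) z * wd \<i> b (\<lambda>w. \<phi> w I J) z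
      + hess u z j k * hess (\<lambda>w. \<phi> w I J) z a b" for a b j k I J
    by (rule hess_mult[OF smooth_hess[OF u] s\<phi>])
  have sym1: "wd (- \<i>) a (\<lambda>z. hess f z j k) z = wd (- \<i>) j (\<lambda>z. hess f z a k) z" if f: "smooth_on f UNIV" for f a j k z
    unfolding hess_def using wd_commute[OF wd_smooth[OF f], of "- \<i>" a "- \<i>" j \<i> k z] by simp
  have sym2: "wd \<i> b (\<lambda>z. hess f z j k) z = wd \<i> k (\<lambda>z. hess f z j b) z" if f: "smooth_on f UNIV" for f b j k z
  proof -
    have "wd \<i> b (\<lambda>z. hess f z j k) z = wd (- \<i>) j (\<lambda>z. wd \<i> b (wd \<i> k f) z) z" for k b
      unfolding hess_def using wd_commute[OF wd_smooth[OF f]] by simp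
    moreover have "(\<lambda>z. wd \<i> b (wd \<i> k f) z) = (\<lambda>z. wd \<i> k (wd \<i> b f) z)"
      by (intro ext wd_commute[OF f])
    ultimately show ?thesis by simp
  qed
  have sym3: "hess (\<lambda>z. hess f z j k) z a b = hess (\<lambda>z. hess f z a k) z j b" if f: "smooth_on f UNIV" for f a b j k
  proof -
    have "hess (\<lambda>z. hess f z j k) z a b = wd \<i> b (wd (- \<i>) a (\<lambda>z. hess f z j k)) z" for a j
      unfolding hess_def[of "\<lambda>z. hess f z j k"] by (rule wd_commute[OF smooth_hess[OF f]])
    moreover have "wd (- \<i>) a (\<lambda>z. hess f z j k) = wd (- \<i>) j (\<lambda>z. hess f z a k)"
      by (intro ext sym1 f)
    ultimately show ?thesis by simp
  qed
  have "ew4 (\<lambda>a b j k I J. hess (\<lambda>w. ?L j k w I J) z a b) I J = 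
     ew4 (\<lambda>a b j k I J. hess u z a b * hess (\<lambda>w. \<phi> w I J) z j k) I J"
  proof -
    have "ew4 (\<lambda>a b j k I J. wd \<i> b u z * wd (- \<i>) a (\<lambda>z. hess (\<lambda>w. \<phi> w I J) z j k) z) I J = 0"
      by (rule ew4_zero_left) (intro ext, subst sym1[OF s\<phi>], rule refl)
    moreover have "ew4 (\<lambda>a b j k I J. wd (- \<i>) a u z * wd \<i> b (\<lambda>z. hess (\<lambda>w. \<phi> w I J) z j k) z) I J = 0"
      by (rule ew4_zero_right) (intro ext, subst sym2[OF s\<phi>], rule refl)
    moreover have "ew4 (\<lambda>a b j k I J. u z * hess (\<lambda>z. hess (\<lambda>w. \<phi> w I J) z j k) z a b) I J = 0"
      by (rule ew4_zero_left) (intro ext, subst sym3[OF s\<phi>], rule refl)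
    ultimately show ?thesis unfolding h1 ew4_add by simp
  qed
  also have "\<dots> = ew4 (\<lambda>a b j k I J. hess u z j k * hess (\<lambda>w. \<phi> w I J) z a b) I J"
    by (rule ew4_swap)
  also have "\<dots> = ew4 (\<lambda>a b j k I J. hess (\<lambda>w. ?R j k w I J) z a b) I J"
  proof -
    have "ew4 (\<lambda>a b j k I J. wd \<i> b (\<lambda>z. hess u z j k) z * wd (- \<i>) a (\<lambda>w. \<phi> w I J) z) I J = 0"
      by (rule ew4_zero_right) (intro ext, subst sym2[OF u], rule refl)
    moreover have "ew4 (\<lambda>a b j k I J. wd (- \<i>) a (\<lambda>z. hess u z j k) z * wd \<i> b (\<lambda>w. \<phi> w I J) z) I J = 0"
      by (rule ew4_zero_left) (intro ext, subst sym1[OF u], rule refl)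
    moreover have "ew4 (\<lambda>a b j k I J. hess (\<lambda>z. hess u z j k) z a b * \<phi> z I J) I J = 0"
      by (rule ew4_zero_left) (intro ext, subst sym3[OF u], rule refl)
    ultimately show ?thesis unfolding h2 ew4_add by simp
  qed
  finally show "ext_d (ext_dc (\<lambda>z I J. u z * ext_d (ext_dc \<phi>) z I J)) z I J
       = ext_d (ext_dc (\<lambda>z. wedge11 (hess u z) (\<phi> z))) z I J"
    unfolding L R gen[OF sL] gen[OF sR] by simp
qed

section \<open>Integrability of powers of the norm\<close>

text \<open>The exponent -1/2 exceeds -1, hence is integrable at 0. The summand 1 makes the factor
  at least 1, so that surplus factors in a product do no harm.\<close>

lemma nn_integral_abs_powr_finite:
  assumes "R \<ge> 0"
  shows "(\<integral>\<^sup>+t. ennreal (1 + \<bar>t\<bar> powr (- 1 / 2)) * indicator {- R..R} t \<partial>lborel) < \<infinity>"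
proof -
  define I where "I = R powr (- 1 / 2 + 1) / (- 1 / 2 + 1)"
  have 1: "((\<lambda>x. x powr (- 1 / 2)) has_integral I) {0..R}"
    unfolding I_def by (rule has_integral_powr_from_0) (use assms in auto)
  have A: "((\<lambda>x. \<bar>x\<bar> powr (- 1 / 2)) has_integral I) {0..R}" 
    by (rule has_integral_eq[OF _ 1]) auto
  then have B: "((\<lambda>x. \<bar>x\<bar> powr (- 1 / 2)) has_integral I) {- R..0}"
    using has_integral_reflect_real[where f="\<lambda>x. \<bar>x\<bar> powr (- 1 / 2)" and a=0 and b=R and i=I] by simp
  have C: "((\<lambda>x. \<bar>x\<bar> powr (- 1 / 2)) has_integral I + I) {- R..R}"
    by (rule has_integral_combine[OF _ _ B A]) (use assms in auto)
  have "((\<lambda>x. 1 + \<bar>x\<bar> powr (- 1 / 2)) has_integral (2 * R + (I + I))) {- R..R}"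
    by (rule has_integral_add[OF _ C]) (use has_integral_const_real[of "1::real" "-R" R] assms in simp)
  from nn_integral_has_integral_lebesgue'[OF _ this] show ?thesis by simp
qed

text \<open>Coordinate hyperplanes have to be excluded because \<open>0 powr (- 1 / 2)\<close> is 0,
  which would break the product bound that follows.\<close>

lemma AE_lborel_inner_neq_0: "AE x in lborel. \<forall>b\<in>Basis. x \<bullet> b \<noteq> (0::real)"
proof (rule AE_finite_allI[OF finite_Basis])
  fix b :: 'a assume b: "b \<in> Basis"
  have "{x::'a. x \<bullet> b = 0} \<in> null_sets lebesgue"
    using negligible_standard_hyperplane[OF b, of 0] by (simp add: negligible_iff_null_sets)
  moreover have "{x::'a. x \<bullet> b = 0} \<in> sets lborel" by simp
  ultimately have "{x::'a. x \<bullet> b = 0} \<in> null_sets lborel"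
    by (simp add: null_sets_completion_iff)
  from AE_not_in[OF this] show "AE x in lborel. x \<bullet> b \<noteq> 0" by simp
qed

text \<open>|z|^(-k) = (|z|^(-1/2))^(2k) \<le> (1 + |z|^(-1/2))^DIM, and each of the DIM factors is
  at most 1 + |z_b|^(-1/2) since |z_b| \<le> |z|. The product separates into one-dimensional
  integrals. On complex n-space the condition reads k \<le> n.\<close>

lemma integrable_inverse_norm_power:
  fixes K :: "'a::euclidean_space set"
  assumes k: "2 * k \<le> DIM('a)" and K: "compact K"
  shows "integrable lborel (\<lambda>z. indicator K z * inverse (norm z) ^ k)"
proof -
  obtain R where R: "R \<ge> 0" "\<And>z. z \<in> K \<Longrightarrow> norm z \<le> R"
    using compact_imp_bounded[OF K] bounded_pos by (metis less_eq_real_def)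
  have Kb: "K \<in> sets borel" using K by (simp add: borel_closed compact_imp_closed)
  define g where "g t = ennreal (1 + \<bar>t\<bar> powr (- 1 / 2)) * indicator {- R..R} t" for t
  have gm: "g \<in> borel_measurable borel" unfolding g_def by measurable
  have le: "inverse (norm z) ^ k \<le> (\<Prod>b\<in>Basis. 1 + \<bar>z \<bullet> b\<bar> powr (- 1 / 2))" if nz: "\<forall>b\<in>Basis. z \<bullet> b \<noteq> 0" for z :: 'a
  proof -
    obtain b0 :: 'a where "b0 \<in> Basis" by (meson nonempty_Basis ex_in_conv)
    then have s: "norm z > 0" using nz by force
    let ?q = "1 + norm z powr (- 1 / 2)"
    have "inverse (norm z) = (norm z powr (- 1 / 2))\<^sup>2"
    proof -
      have "norm z powr (- 1 / 2) * norm z powr (- 1 / 2) = norm z powr (- 1 / 2 + - 1 / 2)"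
        by (rule powr_add[symmetric])
      also have "\<dots> = inverse (norm z)" using s by (simp add: powr_minus)
      finally show ?thesis by (simp add: power2_eq_square)
    qed
    also have "\<dots> \<le> ?q\<^sup>2" by (intro power_mono) auto
    finally have "inverse (norm z) ^ k \<le> (?q\<^sup>2) ^ k" by (intro power_mono) (use s in auto)
    also have "\<dots> = ?q ^ (2 * k)" by (simp add: power_mult)
    also have "\<dots> \<le> ?q ^ DIM('a)" by (intro power_increasing k) auto
    also have "\<dots> = (\<Prod>b\<in>(Basis::'a set). ?q)" by simp
    also have "\<dots> \<le> (\<Prod>b\<in>Basis. 1 + \<bar>z \<bullet> b\<bar> powr (- 1 / 2))"
      by (intro prod_mono conjI add_left_mono powr_mono2') (use nz Basis_le_norm in auto)
    finally show ?thesis .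
  qed
  have "(\<integral>\<^sup>+z. ennreal (norm (indicator K z * inverse (norm z) ^ k)) \<partial>lborel) \<le> 
      (\<integral>\<^sup>+z. (\<Prod>b\<in>Basis. g (z \<bullet> b)) \<partial>(lborel :: 'a measure))"
  proof (rule nn_integral_mono_AE, use AE_lborel_inner_neq_0 in eventually_elim)
    fix z :: 'a assume nz: "\<forall>b\<in>Basis. z \<bullet> b \<noteq> 0"
    show "ennreal (norm (indicator K z * inverse (norm z) ^ k)) \<le> (\<Prod>b\<in>Basis. g (z \<bullet> b))"
    proof (cases "z \<in> K")
      case True
      have "- R \<le> z \<bullet> b \<and> z \<bullet> b \<le> R" if "b \<in> Basis" for b
        using Basis_le_norm[OF that, of z] R(2)[OF True] by linarith
      then have "(\<Prod>b\<in>Basis. g (z \<bullet> b)) = (\<Prod>b\<in>Basis. ennreal (1 + \<bar>z \<bullet> b\<bar> powr (- 1 / 2)))"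
        by (intro prod.cong) (auto simp: g_def)
      also have "\<dots> = ennreal (\<Prod>b\<in>Basis. 1 + \<bar>z \<bullet> b\<bar> powr (- 1 / 2))"
        by (rule prod_ennreal) auto
      finally show ?thesis using le[OF nz] True by (simp add: ennreal_leI)
    qed auto
  qed
  also have "\<dots> = (\<Prod>b\<in>(Basis::'a set). (\<integral>\<^sup>+t. g t \<partial>lborel))"
    by (rule nn_integral_lborel_prod) (use gm in auto)
  also have "\<dots> < \<infinity>"
    using nn_integral_abs_powr_finite[OF R(1)] unfolding g_def[symmetric]
    by (simp add: less_top[symmetric] power_eq_top_ennreal)
  finally show ?thesis using Kb by (intro integrableI_bounded) auto
qed

section \<open>Integrals of compactly supported functions\<close>

text \<open>Bridge between gauge integrals over boxes, under which derivatives are taken, and the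
  Lebesgue integrals that define currents.\<close>

lemma integral_cbox_eq_lborel:
  fixes f :: "'a::euclidean_space \<Rightarrow> 'b::euclidean_space"
  assumes f: "continuous_on UNIV f" and 0: "\<And>z. z \<notin> cbox a b \<Longrightarrow> f z = 0"
  shows "integrable lborel f" "integral (cbox a b) f = (LINT z|lborel. f z)"
proof -
  have eq: "(\<lambda>x. indicator (cbox a b) x *\<^sub>R f x) = f" using 0 by (auto simp: indicator_def fun_eq_iff)
  show i: "integrable lborel f"
    using borel_integrable_compact[OF compact_cbox continuous_on_subset[OF f subset_UNIV], of a b] unfolding eq .
  have "(\<lambda>x. if x \<in> cbox a b then f x else 0) = f" using 0 by auto
  then show "integral (cbox a b) f = (LINT z|lborel. f z)"
    using integral_lborel[OF i] integral_restrict_UNIV[of "cbox a b" f] by simp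
qed

lemma compact_support_integrable:
  fixes f :: "'a::euclidean_space \<Rightarrow> 'b::euclidean_space"
  assumes f: "continuous_on UNIV f" and K: "compact K" and 0: "\<And>z. z \<notin> K \<Longrightarrow> f z = 0"
  shows "integrable lborel f"
proof -
  obtain a where "K \<subseteq> cbox (-a) a" using bounded_subset_cbox_symmetric[OF compact_imp_bounded[OF K]] .
  then show ?thesis using integral_cbox_eq_lborel[OF f, of "-a" a] 0 by blast
qed

lemma compact_support_bounded:
  fixes f :: "'a::euclidean_space \<Rightarrow> 'b::real_normed_vector"
  assumes f: "continuous_on UNIV f" and K: "compact K" and 0: "\<And>z. z \<notin> K \<Longrightarrow> f z = 0"
  obtains B where "\<And>z. norm (f z) \<le> B"
proof -
  have "bounded (f ` K)" by (intro compact_imp_bounded compact_continuous_image K continuous_on_subset[OF f]) auto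
  then obtain B where "B > 0" "\<And>z. z \<in> K \<Longrightarrow> norm (f z) \<le> B" by (auto simp: bounded_pos)
  then have "norm (f z) \<le> B" for z using 0 by (cases "z \<in> K") auto
  then show ?thesis using that by blast
qed

lemma lborel_integral_translate:
  fixes f :: "'a::euclidean_space \<Rightarrow> 'b::euclidean_space"
  assumes "continuous_on UNIV f"
  shows "(LINT z|lborel. f (c + z)) = (LINT z|lborel. f z)"
proof -
  have m: "f \<in> borel_measurable borel" using assms by (rule borel_measurable_continuous_onI)
  have "(LINT z|lborel. f z) = (LINT z|distr lborel borel ((+) c). f z)" by (simp add: lborel_distr_plus)
  also have "\<dots> = (LINT z|lborel. f (c + z))" by (rule integral_distr) (use m in auto)
  finally show ?thesis by simp
qed

lemma pd_zero_outside:
  assumes K: "compact K" and 0: "\<And>z. z \<notin> K \<Longrightarrow> f z = 0" and z: "z \<notin> K"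
  shows "pd b f z = 0"
proof -
  have "pd b f z = pd b (\<lambda>_. 0) z"
    by (rule pd_eq_on_open[of "- K"]) (use K 0 z compact_imp_closed in auto)
  then show ?thesis by simp
qed

text \<open>The integral of f(z + t b) is independent of t by translation invariance, and its
  derivative at t = 0 is the integral of \<open>pd b f\<close>.\<close>

lemma integral_pd_zero:
  fixes f :: "'a::euclidean_space \<Rightarrow> complex"
  assumes f: "smooth_on f UNIV" and K: "compact K" and 0: "\<And>z. z \<notin> K \<Longrightarrow> f z = 0" and b: "b \<in> Basis"
  shows "(LINT z|lborel. pd b f z) = 0"
proof -
  \<comment> \<open>The set swept out by K under shifts with |t| \<le> 1, so that a single box
    contains the supports of all translates.\<close>
  define K' where "K' = (\<lambda>(x, t). x + t *\<^sub>R b) ` (K \<times> {- 1..1})"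
  have "compact K'" unfolding K'_def split_def
    by (intro compact_continuous_image compact_Times K continuous_intros) auto
  then obtain a where a: "K' \<subseteq> cbox (-a) a" using bounded_subset_cbox_symmetric compact_imp_bounded by metis
  have out: "z + t *\<^sub>R b \<notin> K" if "z \<notin> cbox (-a) a" "t \<in> {- 1..1}" for z t
  proof
    assume "z + t *\<^sub>R b \<in> K"
    then have "(z + t *\<^sub>R b) + (- t) *\<^sub>R b \<in> K'" unfolding K'_def using that
      by (intro image_eqI[where x="(z + t *\<^sub>R b, - t)"]) auto
    then show False using a that by auto
  qed
  have cf: "continuous_on UNIV f" and cp: "continuous_on UNIV (pd b f)"
    by (intro smooth_continuous smooth_pd f b)+
  have cft: "continuous_on A (\<lambda>z. f (z + t *\<^sub>R b))" for A t
    by (intro continuous_on_compose2[OF cf] continuous_intros) auto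
  have eq: "integral (cbox (-a) a) (\<lambda>z. f (z + t *\<^sub>R b)) = (LINT z|lborel. f z)" if "t \<in> {- 1..1}" for t
    using integral_cbox_eq_lborel(2)[OF cft, of "-a" a t] 0 out[OF _ that] lborel_integral_translate[OF cf, of "t *\<^sub>R b"]
    by (simp add: add.commute)
  have "((\<lambda>t. integral (cbox (-a) a) (\<lambda>z. f (z + t *\<^sub>R b))) has_vector_derivative 
       integral (cbox (-a) a) (\<lambda>z. pd b f (z + 0 *\<^sub>R b))) (at 0 within {- 1..1})"
  proof (rule leibniz_rule_vector_derivative)
    show "((\<lambda>t. f (z + t *\<^sub>R b)) has_vector_derivative pd b f (z + t *\<^sub>R b)) (at t within {- 1..1})" for z t
      by (rule has_vector_derivative_at_within[OF pd_has_vector_derivative_line]) (rule smooth_differentiable[OF f])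
    show "(\<lambda>z. f (z + t *\<^sub>R b)) integrable_on cbox (-a) a" for t
      by (rule integrable_continuous[OF cft])
    show "continuous_on ({- 1..1} \<times> cbox (-a) a) (\<lambda>(t, z). pd b f (z + t *\<^sub>R b))"
      unfolding split_def by (intro continuous_on_compose2[OF cp] continuous_intros) auto
  qed auto
  moreover have "((\<lambda>t. integral (cbox (-a) a) (\<lambda>z. f (z + t *\<^sub>R b))) has_vector_derivative 0) (at 0 within {- 1..1})"
    by (rule has_vector_derivative_transform[where f="\<lambda>_. (LINT z|lborel. f z)"]) (auto simp: eq)
  ultimately have "integral (cbox (-a) a) (\<lambda>z. pd b f (z + 0 *\<^sub>R b)) = 0"
    by (rule vector_derivative_unique_within[rotated]) (simp add: at_within_Icc_at)
  moreover have "z \<notin> cbox (-a) a \<Longrightarrow> pd b f z = 0" for z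
    using pd_zero_outside[OF K 0] out[of z 0] by auto
  ultimately show ?thesis using integral_cbox_eq_lborel(2)[OF cp, of "-a" a] by simp
qed

lemma integral_wd_zero:
  assumes f: "smooth_on f UNIV" and K: "compact K" and 0: "\<And>z. z \<notin> K \<Longrightarrow> f z = 0"
  shows "(LINT z|lborel. wd s j f z) = 0"
proof -
  have i: "integrable lborel (pd b f)" if "b \<in> Basis" for b
    by (rule compact_support_integrable[OF _ K pd_zero_outside[OF K 0]])
      (intro smooth_continuous smooth_pd f that)
  have "(LINT z|lborel. wd s j f z) = ((LINT z|lborel. pd (axis j 1) f z) + s * (LINT z|lborel. pd (axis j \<i>) f z)) / 2"
    unfolding wd_def by (simp add: i)
  then show ?thesis using integral_pd_zero[OF f K 0] by simp
qed

lemma wd_zero_outside: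
  assumes K: "compact K" and 0: "\<And>z. z \<notin> K \<Longrightarrow> f z = 0" and z: "z \<notin> K"
  shows "wd s j f z = 0"
  unfolding wd_def using pd_zero_outside[OF assms] by simp

lemma hess_zero_outside:
  assumes K: "compact K" and 0: "\<And>z. z \<notin> K \<Longrightarrow> f z = 0" and z: "z \<notin> K"
  shows "hess f z j k = 0"
  unfolding hess_def by (rule wd_zero_outside[OF K wd_zero_outside[OF K 0] z])

text \<open>Integration by parts twice. Compact support of f alone suffices, since every boundary
  term carries f or a derivative of f.\<close>

lemma integral_hess_swap:
  assumes f: "smooth_on f UNIV" and w: "smooth_on w UNIV" and K: "compact K" and 0: "\<And>z. z \<notin> K \<Longrightarrow> f z = 0"
  shows "(LINT z|lborel. w z * hess f z j k) = (LINT z|lborel. hess w z j k * f z)"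
proof -
  let ?A = "\<lambda>z. w z * wd \<i> k f z" and ?B = "\<lambda>z. f z * wd (- \<i>) j w z"
  have sA: "smooth_on ?A UNIV" and sB: "smooth_on ?B UNIV"
    by (intro smooth_mult wd_smooth f w)+
  have sC: "smooth_on (\<lambda>z. hess w z j k * f z) UNIV" 
    by (intro smooth_mult smooth_hess f w)
  have A0: "?A z = 0" and B0: "?B z = 0" if "z \<notin> K" for z
    using wd_zero_outside[OF K 0 that] 0[OF that] by simp_all
  have i: "integrable lborel (wd s l g)" if "smooth_on g UNIV" "\<And>z. z \<notin> K \<Longrightarrow> g z = 0" for s l g
    by (rule compact_support_integrable[OF smooth_continuous[OF wd_smooth[OF that(1)]] K]) 
      (rule wd_zero_outside[OF K that(2)])
  have iC: "integrable lborel (\<lambda>z. hess w z j k * f z)"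
    by (rule compact_support_integrable[OF smooth_continuous[OF sC] K]) (simp add: 0)
  \<comment> \<open>The two integrands differ by two total derivatives; the products of first
    derivatives inside them cancel, and the second derivatives of w commute.\<close>
  have "w z * hess f z j k = wd (- \<i>) j ?A z - wd \<i> k ?B z + hess w z j k * f z" for z
    unfolding wd_mult[OF w wd_smooth[OF f]] wd_mult[OF f wd_smooth[OF w]] hess_def
    using wd_commute[OF w, of \<i> k "- \<i>" j z] by (simp add: algebra_simps)
  then have "(LINT z|lborel. w z * hess f z j k) = 
     (LINT z|lborel. wd (- \<i>) j ?A z) - (LINT z|lborel. wd \<i> k ?B z) + (LINT z|lborel. hess w z j k * f z)"
    by (simp add: i[OF sA A0] i[OF sB B0] iC)
  then show ?thesis using integral_wd_zero[OF sA K A0] integral_wd_zero[OF sB K B0] by simp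
qed

text \<open>Isolates the sign (or 0) of \<open>efw\<close> as a constant, so that sums over forms
  can be pulled through integrals, limits and measurability.\<close>

lemma efw_at: "efw j k a I J = efw j k (\<lambda>_ _. 1) I J * a (I - {j}) (J - {k})"
  by (simp add: efw_def ew_def fw_def)

text \<open>The start of the induction. Only coefficients with one index missing on each side
  contribute, and \<open>integral_hess_swap\<close> applies to each of them.\<close>

lemma integrate_form_ddc:
  fixes \<phi> :: "'n::{finite,linorder} form"
  assumes \<phi>: "smooth_form \<phi>" and w: "smooth_on w UNIV" and K: "compact K" and 0: "form_supported_in \<phi> K"
  shows "integrate_form (\<lambda>z I J. w z * ext_d (ext_dc \<phi>) z I J) = integrate_form (\<lambda>z. wedge11 (hess w z) (\<phi> z))"
proof -
  let ?c = "\<lambda>j k. efw j k (\<lambda>_ _. 1) UNIV UNIV" and ?f = "\<lambda>j k w. \<phi> w (UNIV - {j}) (UNIV - {k})"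
  have sf: "smooth_on (?f j k) UNIV" and f0: "\<And>z. z \<notin> K \<Longrightarrow> ?f j k z = 0" for j k
    using \<phi> 0 by (auto simp: smooth_form_def form_supported_in_def)
  have i1: "integrable lborel (\<lambda>z. w z * hess (?f j k) z j k)" for j k
    by (rule compact_support_integrable[OF _ K])
      (intro smooth_continuous smooth_mult smooth_hess w sf, simp add: hess_zero_outside[OF K f0])
  have i2: "integrable lborel (\<lambda>z. hess w z j k * ?f j k z)" for j k
    by (rule compact_support_integrable[OF _ K])
      (intro smooth_continuous smooth_mult smooth_hess w sf, simp add: f0)
  have "(LINT z|lborel. w z * ext_d (ext_dc \<phi>) z UNIV UNIV) = 
     (LINT z|lborel. 2 * \<i> * (\<Sum>j\<in>UNIV. \<Sum>k\<in>UNIV. ?c j k * (w z * hess (?f j k) z j k)))"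
    unfolding ddc_smooth[OF \<phi>] by (subst efw_at) (simp only: sum_distrib_left mult_ac)
  also have "\<dots> = 2 * \<i> * (\<Sum>j\<in>UNIV. \<Sum>k\<in>UNIV. ?c j k * (LINT z|lborel. w z * hess (?f j k) z j k))"
    by (simp add: i1)
  also have "\<dots> = 2 * \<i> * (\<Sum>j\<in>UNIV. \<Sum>k\<in>UNIV. ?c j k * (LINT z|lborel. hess w z j k * ?f j k z))"
    using integral_hess_swap[OF sf w K f0] by simp
  also have "\<dots> = (LINT z|lborel. 2 * \<i> * (\<Sum>j\<in>UNIV. \<Sum>k\<in>UNIV. ?c j k * (hess w z j k * ?f j k z)))"
    by (simp add: i2)
  also have "\<dots> = (LINT z|lborel. wedge11 (hess w z) (\<phi> z) UNIV UNIV)"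
    unfolding wedge11_def by (subst (2) efw_at) (simp only: mult_ac)
  finally show ?thesis unfolding integrate_form_def by simp
qed

section \<open>Wedge products of Hessians as coefficient operators\<close>

text \<open>The head of the list acts first on the argument. This matches
  \<open>bedford_taylor (u # us)\<close>, where dd^c u is moved onto the test form before the
  remaining product sees it.\<close>

abbreviation wedges :: "(complex ^ 'n::{finite,linorder} \<Rightarrow> complex) list \<Rightarrow> complex ^ 'n::{finite,linorder} \<Rightarrow> 'n arr \<Rightarrow> 'n arr" where
  "wedges us z \<equiv> fold (\<lambda>u. wedge11 (hess u z)) us"

lemma norm_efw_le:
  assumes "\<And>I J. norm (a I J) \<le> B"
  shows "norm (efw j k a I J) \<le> B"
proof -
  have "0 \<le> B" using assms[of I J] norm_ge_zero[of "a I J"] by linarith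
  then show ?thesis using assms by (simp add: efw_def ew_def fw_def norm_mult norm_power)
qed

lemma norm_wedge11_le:
  fixes a :: "'n::{finite,linorder} arr"
  assumes H: "\<And>j k. norm (H j k) \<le> C" and a: "\<And>I J. norm (a I J) \<le> B"
  shows "norm (wedge11 H a I J) \<le> (2 * (real CARD('n))\<^sup>2 * C) * B"
proof -
  have C: "0 \<le> C" using H norm_ge_zero order_trans by metis
  have "norm (\<Sum>j\<in>UNIV. \<Sum>k\<in>UNIV. H j k * efw j k a I J) \<le> (\<Sum>j\<in>(UNIV::'n set). \<Sum>k\<in>(UNIV::'n set). C * B)"
    by (intro sum_norm_le) (auto simp: norm_mult intro!: mult_mono H norm_efw_le a C)
  then show ?thesis by (simp add: wedge11_def norm_mult power2_eq_square algebra_simps)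
qed

lemma norm_wedges_le:
  fixes a :: "'n::{finite,linorder} arr"
  assumes "\<And>u j k. u \<in> set us \<Longrightarrow> norm (hess u z j k) \<le> C" and "\<And>I J. norm (a I J) \<le> B"
  shows "norm (wedges us z a I J) \<le> (2 * (real CARD('n))\<^sup>2 * C) ^ length us * B"
  using assms
proof (induction us arbitrary: a B)
  case (Cons u us)
  have "norm (wedges us z (wedge11 (hess u z) a) I J) \<le> 
      (2 * (real CARD('n))\<^sup>2 * C) ^ length us * ((2 * (real CARD('n))\<^sup>2 * C) * B)"
    by (rule Cons.IH) (use Cons.prems in \<open>auto intro!: norm_wedge11_le\<close>)
  then show ?case by (simp add: mult_ac)
qed simp

lemma measurable_efw:
  assumes "\<And>I J. (\<lambda>z. \<phi> z I J) \<in> borel_measurable M"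
  shows "(\<lambda>z. efw j k (\<phi> z) I J) \<in> borel_measurable M"
proof -
  have "(\<lambda>z. efw j k (\<phi> z) I J) = (\<lambda>z. efw j k (\<lambda>_ _. 1) I J * \<phi> z (I - {j}) (J - {k}))"
    by (rule ext) (rule efw_at)
  then show ?thesis using assms by simp
qed

lemma measurable_wedge11:
  assumes "\<And>I J. (\<lambda>z. \<phi> z I J) \<in> borel_measurable M" "\<And>j k. (\<lambda>z. H z j k) \<in> borel_measurable M"
  shows "(\<lambda>z. wedge11 (H z) (\<phi> z) I J) \<in> borel_measurable M"
  unfolding wedge11_def by (intro borel_measurable_times borel_measurable_sum borel_measurable_const measurable_efw assms)

lemma measurable_wedges:
  assumes "\<And>u j k. u \<in> set us \<Longrightarrow> (\<lambda>z. hess u z j k) \<in> borel_measurable M" 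
    and "\<And>I J. (\<lambda>z. \<phi> z I J) \<in> borel_measurable M"
  shows "(\<lambda>z. wedges us z (\<phi> z) I J) \<in> borel_measurable M"
  using assms
proof (induction us arbitrary: \<phi>)
  case (Cons u us)
  have "(\<lambda>z. wedges us z (wedge11 (hess u z) (\<phi> z)) I J) \<in> borel_measurable M"
    by (rule Cons.IH) (use Cons.prems in \<open>auto intro!: measurable_wedge11\<close>)
  then show ?case by simp
qed simp

lemma tendsto_efw:
  assumes "\<And>I J. ((\<lambda>m. a m I J) \<longlongrightarrow> b I J) F"
  shows "((\<lambda>m. efw j k (a m) I J) \<longlongrightarrow> efw j k b I J) F"
  unfolding efw_at[of j k "a _"] efw_at[of j k b] by (intro tendsto_intros assms)

lemma tendsto_wedge11:
  assumes "\<And>I J. ((\<lambda>m. a m I J) \<longlongrightarrow> b I J) F" "\<And>j k. ((\<lambda>m. H m j k) \<longlongrightarrow> G j k) F"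
  shows "((\<lambda>m. wedge11 (H m) (a m) I J) \<longlongrightarrow> wedge11 G b I J) F"
  unfolding wedge11_def by (intro tendsto_intros assms tendsto_efw)

lemma tendsto_wedges:
  assumes "\<And>I J. ((\<lambda>m. a m I J) \<longlongrightarrow> b I J) F"
  shows "((\<lambda>m. wedges us z (a m) I J) \<longlongrightarrow> wedges us z b I J) F"
  using assms
proof (induction us arbitrary: a b)
  case (Cons u us)
  then show ?case by (auto intro!: Cons.IH tendsto_wedge11)
qed simp

text \<open>Continuity allows multiplication of currents by u; measurability and the bound of order
  -1 off the origin provide the integrable majorants.\<close>

definition mild :: "(complex ^ 'n \<Rightarrow> complex) \<Rightarrow> bool" where
  "mild u \<longleftrightarrow> continuous_on UNIV u \<and> (\<forall>j k. (\<lambda>z. hess u z j k) \<in> borel_measurable borel) \<and>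
     (\<exists>C. \<forall>z j k. z \<noteq> 0 \<longrightarrow> norm (hess u z j k) \<le> C * inverse (norm z))"

lemma mild_common_bound:
  fixes us :: "(complex ^ 'n \<Rightarrow> complex) list"
  assumes "\<forall>u\<in>set us. mild u"
  shows "\<exists>C\<ge>0. \<forall>u\<in>set us. \<forall>z j k. z \<noteq> 0 \<longrightarrow> norm (hess u z j k) \<le> C * inverse (norm z)"
  using assms
proof (induction us)
  case (Cons u us)
  then obtain C where C: "C \<ge> 0" "\<forall>u\<in>set us. \<forall>z j k. z \<noteq> 0 \<longrightarrow> norm (hess u z j k) \<le> C * inverse (norm z)" by auto
  obtain C' where C': "\<forall>z j k. z \<noteq> 0 \<longrightarrow> norm (hess u z j k) \<le> C' * inverse (norm z)" 
    using Cons.prems by (auto simp: mild_def)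
  have m: "C * inverse (norm z) \<le> max C C' * inverse (norm z)" "C' * inverse (norm z) \<le> max C C' * inverse (norm z)" 
    for z :: "complex ^ 'n" by (intro mult_right_mono; simp)+
  show ?case
  proof (intro exI[of _ "max C C'"] conjI ballI allI impI)
    fix v and z :: "complex ^ 'n" and j k assume "v \<in> set (u # us)" "z \<noteq> 0"
    then have "norm (hess v z j k) \<le> C * inverse (norm z) \<or> norm (hess v z j k) \<le> C' * inverse (norm z)"
      using C(2) C' by auto
    then show "norm (hess v z j k) \<le> max C C' * inverse (norm z)" using m[of z] by linarith
  qed (use C in auto)
qed auto

text \<open>The candidate for the Bedford-Taylor product: wedge the pointwise Hessians onto the test
  form and integrate.\<close>

definition hess_current :: "(complex ^ 'n::{finite,linorder} \<Rightarrow> complex) list \<Rightarrow> 'n current" where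
  "hess_current us \<phi> = integrate_form (\<lambda>z. wedges us z (\<phi> z))"

text \<open>The number p is the order of a singularity already present in the argument: 0 for
  bounded forms, 1 when a Hessian has been wedged on before. The majorant w is chosen before \<phi>,
  hence is common to a whole sequence.\<close>

lemma wedges_dominated:
  fixes us :: "(complex ^ 'n::{finite,linorder} \<Rightarrow> complex) list"
  assumes us: "\<forall>u\<in>set us. mild u" and K: "compact K" and len: "length us + p \<le> CARD('n)"
  shows "\<exists>w. integrable lborel w \<and> (\<forall>\<phi>::'n form. (\<forall>z I J. z \<noteq> 0 \<longrightarrow> norm (\<phi> z I J) \<le> B * inverse (norm z) ^ p * indicator K z) \<longrightarrow>
      (\<forall>z I J. z \<noteq> 0 \<longrightarrow> norm (wedges us z (\<phi> z) I J) \<le> w z))"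
proof -
  obtain C where C': "\<forall>u\<in>set us. \<forall>z j k. z \<noteq> 0 \<longrightarrow> norm (hess u z j k) \<le> C * inverse (norm z)"
    using mild_common_bound[OF us] by blast
  then have C: "norm (hess u z j k) \<le> C * inverse (norm z)" if "u \<in> set us" "z \<noteq> 0" for u z j k
    using that by blast
  define D where "D = (2 * (real CARD('n))\<^sup>2 * C) ^ length us * B"
  define w where "w z = D * (indicator K z * inverse (norm z) ^ (length us + p))" for z :: "complex ^ 'n::{finite,linorder}"
  have "integrable lborel w" unfolding w_def
    by (intro integrable_mult_right integrable_inverse_norm_power K) (use len in auto)
  moreover have "norm (wedges us z (\<phi> z) I J) \<le> w z" 
    if "\<forall>z I J. z \<noteq> 0 \<longrightarrow> norm (\<phi> z I J) \<le> B * inverse (norm z) ^ p * indicator K z" "z \<noteq> 0" 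
    for \<phi> :: "'n form" and z I J
  proof -
    have "norm (wedges us z (\<phi> z) I J) \<le> (2 * (real CARD('n))\<^sup>2 * (C * inverse (norm z))) ^ length us 
         * (B * inverse (norm z) ^ p * indicator K z)"
      using C that by (intro norm_wedges_le) auto
    also have "\<dots> = w z"
      by (simp add: w_def D_def power_mult_distrib power_add mult_ac)
    finally show ?thesis .
  qed
  ultimately show ?thesis by blast
qed

lemma wedges_integrable:
  fixes us :: "(complex ^ 'n::{finite,linorder} \<Rightarrow> complex) list"
  assumes us: "\<forall>u\<in>set us. mild u" and K: "compact K" and len: "length us \<le> CARD('n)"
    and m: "\<And>I J. (\<lambda>z. \<phi> z I J) \<in> borel_measurable borel"
    and B: "\<And>z I J. norm (\<phi> z I J) \<le> B * indicator K z"
  shows "integrable lborel (\<lambda>z. wedges us z (\<phi> z) I J)"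
proof -
  have len0: "length us + 0 \<le> CARD('n)" using len by simp
  from wedges_dominated[OF us K len0, of B] obtain w where w: "integrable lborel w" 
    "\<forall>\<phi>::'n form. (\<forall>z I J. z \<noteq> 0 \<longrightarrow> norm (\<phi> z I J) \<le> B * inverse (norm z) ^ 0 * indicator K z) \<longrightarrow>
      (\<forall>z I J. z \<noteq> 0 \<longrightarrow> norm (wedges us z (\<phi> z) I J) \<le> w z)"
    by (elim exE conjE)
  have "norm (wedges us z (\<phi> z) I J) \<le> norm (w z)" if "z \<noteq> 0" for z
    using w(2) B that by (simp add: abs_le_D1 order_trans[OF _ abs_ge_self])
  then show ?thesis
    using AE_lborel_singleton[of 0] us
    by (intro Bochner_Integration.integrable_bound[OF w(1)])
      (auto intro!: measurable_wedges m simp: mild_def)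
qed

text \<open>Dominated convergence; the bound and the pointwise limit are required off the origin
  only, which is a null set.\<close>

lemma hess_current_tendsto:
  fixes us :: "(complex ^ 'n::{finite,linorder} \<Rightarrow> complex) list"
  assumes us: "\<forall>u\<in>set us. mild u" and K: "compact K" and len: "length us + p \<le> CARD('n)"
    and m: "\<And>i I J. (\<lambda>z. \<psi> i z I J) \<in> borel_measurable borel" "\<And>I J. (\<lambda>z. \<phi> z I J) \<in> borel_measurable borel"
    and B: "\<And>i z I J. z \<noteq> 0 \<Longrightarrow> norm (\<psi> i z I J) \<le> B * inverse (norm z) ^ p * indicator K z"
    and lim: "\<And>z I J. z \<noteq> 0 \<Longrightarrow> (\<lambda>i. \<psi> i z I J) \<longlonglongrightarrow> \<phi> z I J"
  shows "(\<lambda>i. hess_current us (\<psi> i)) \<longlonglongrightarrow> hess_current us \<phi>"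
proof -
  from wedges_dominated[OF us K len, of B] obtain w where w: "integrable lborel w" 
    "\<forall>\<phi>::'n form. (\<forall>z I J. z \<noteq> 0 \<longrightarrow> norm (\<phi> z I J) \<le> B * inverse (norm z) ^ p * indicator K z) \<longrightarrow>
      (\<forall>z I J. z \<noteq> 0 \<longrightarrow> norm (wedges us z (\<phi> z) I J) \<le> w z)"
    by (elim exE conjE)
  have w2: "norm (wedges us z (\<psi> i z) I J) \<le> w z" if "z \<noteq> 0" for i z I J
    using w(2) B that by blast
  have h: "(\<lambda>z. hess u z j k) \<in> borel_measurable borel" if "u \<in> set us" for u j k
    using us that by (simp add: mild_def)
  have "(\<lambda>i. LINT z|lborel. wedges us z (\<psi> i z) UNIV UNIV) \<longlonglongrightarrow> (LINT z|lborel. wedges us z (\<phi> z) UNIV UNIV)"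
  proof (rule integral_dominated_convergence[OF _ _ w(1)])
    show "AE z in lborel. (\<lambda>i. wedges us z (\<psi> i z) UNIV UNIV) \<longlonglongrightarrow> wedges us z (\<phi> z) UNIV UNIV"
      using AE_lborel_singleton[of 0] by eventually_elim (intro tendsto_wedges lim)
    show "AE z in lborel. norm (wedges us z (\<psi> i z) UNIV UNIV) \<le> w z" for i
      using AE_lborel_singleton[of 0] by eventually_elim (rule w2)
  qed (auto intro!: measurable_wedges m h)
  then show ?thesis unfolding hess_current_def integrate_form_def by (intro tendsto_intros)
qed

section \<open>Test forms\<close>

lemma smooth_form_measurable: "smooth_form \<phi> \<Longrightarrow> (\<lambda>z. \<phi> z I J) \<in> borel_measurable borel"
  unfolding smooth_form_def using borel_measurable_continuous_onI smooth_continuous by blast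

lemma test_form_iff: "test_form \<phi> \<longleftrightarrow> smooth_form \<phi> \<and> (\<exists>K. compact K \<and> form_supported_in \<phi> K)"
  by (simp add: test_form_def smooth_form_def)

lemma form_bounded:
  fixes \<phi> :: "'n::finite form"
  assumes "\<And>I J. continuous_on UNIV (\<lambda>z. \<phi> z I J)" "compact K" "form_supported_in \<phi> K"
  obtains B where "B \<ge> 0" "\<And>z I J. norm (\<phi> z I J) \<le> B * indicator K z"
proof -
  have "\<exists>B. \<forall>z. norm (\<phi> z I J) \<le> B" for I J
    using compact_support_bounded[of "\<lambda>z. \<phi> z I J" K] assms unfolding form_supported_in_def by metis
  then obtain B where B: "\<And>I J z. norm (\<phi> z I J) \<le> B I J" by metis
  have B0: "0 \<le> B I J" for I J using B norm_ge_zero order_trans by blast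
  define C where "C = (\<Sum>I\<in>UNIV. \<Sum>J\<in>UNIV. B I J)"
  have "B I J \<le> C" for I J
  proof -
    have "B I J \<le> (\<Sum>J\<in>UNIV. B I J)" by (rule member_le_sum) (use B0 in auto)
    also have "\<dots> \<le> C" unfolding C_def by (rule member_le_sum[where f="\<lambda>I. \<Sum>J\<in>UNIV. B I J"]) (use B0 in \<open>auto intro: sum_nonneg\<close>)
    finally show ?thesis .
  qed
  then have "norm (\<phi> z I J) \<le> C * indicator K z" for z I J
    using B[of z I J] assms(3) unfolding form_supported_in_def by (cases "z \<in> K") (auto intro: order_trans)
  moreover have "C \<ge> 0" unfolding C_def by (intro sum_nonneg B0)
  ultimately show ?thesis using that by blast
qed

lemma smooth_form_bounded:
  fixes \<phi> :: "'n::finite form"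
  assumes "smooth_form \<phi>" "compact K" "form_supported_in \<phi> K"
  obtains B where "B \<ge> 0" "\<And>z I J. norm (\<phi> z I J) \<le> B * indicator K z"
  using form_bounded[of \<phi> K] assms smooth_continuous unfolding smooth_form_def by blast

lemma smooth_scale: "smooth_form \<phi> \<Longrightarrow> smooth_on w UNIV \<Longrightarrow> smooth_form (\<lambda>z I J. w z * \<phi> z I J)"
  unfolding smooth_form_def by (auto intro: smooth_mult)

lemma smooth_wedge11: 
  assumes "smooth_form \<phi>" "smooth_on w UNIV"
  shows "smooth_form (\<lambda>z. wedge11 (hess w z) (\<phi> z))"
proof -
  have "smooth_on (\<lambda>z. efw j k (\<phi> z) I J) UNIV" for j k I J
    using smooth_efw[OF assms(1)] by (simp add: smooth_form_def)
  then show ?thesis unfolding smooth_form_def wedge11_def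
    by (intro allI smooth_cmult smooth_sum smooth_mult[of "\<lambda>z. hess w z _ _"] smooth_hess assms)
qed

lemma smooth_ddc: "smooth_form \<phi> \<Longrightarrow> smooth_form (ext_d (ext_dc \<phi>))"
proof -
  assume \<phi>: "smooth_form \<phi>"
  have "ext_d (ext_dc \<phi>) = (\<lambda>z I J. 2 * \<i> * (\<Sum>j\<in>UNIV. \<Sum>k\<in>UNIV. efw j k (\<lambda>I J. hess (\<lambda>w. \<phi> w I J) z j k) I J))"
    by (intro ext ddc_smooth \<phi>)
  then show ?thesis using smooth_efw_sum[OF smooth_form_hess[OF \<phi>]] by simp
qed

lemma efw_zero: "(\<And>I J. a I J = 0) \<Longrightarrow> efw j k a I J = 0"
  by (simp add: efw_def ew_def fw_def)

lemma wedge11_zero: "(\<And>I J. a I J = 0) \<Longrightarrow> wedge11 H a I J = 0"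
  by (simp add: wedge11_def efw_zero)

lemma supported_scale: "form_supported_in \<phi> K \<Longrightarrow> form_supported_in (\<lambda>z I J. w z * \<phi> z I J) K"
  by (simp add: form_supported_in_def)

lemma supported_wedge11: "form_supported_in \<phi> K \<Longrightarrow> form_supported_in (\<lambda>z. wedge11 (H z) (\<phi> z)) K"
  by (simp add: form_supported_in_def wedge11_zero)

lemma supported_ddc: "smooth_form \<phi> \<Longrightarrow> compact K \<Longrightarrow> form_supported_in \<phi> K \<Longrightarrow> form_supported_in (ext_d (ext_dc \<phi>)) K"
  by (simp add: form_supported_in_def ddc_smooth efw_zero hess_zero_outside)

section \<open>Bedford--Taylor products of functions with mild singularities\<close>

text \<open>Locally uniform convergence gives \<open>form_converges\<close> after multiplication by
  a test form. The bound uniform in m and the pointwise convergence of Hessians feed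
  \<open>hess_current_tendsto\<close>.\<close>

definition smoothly_approximable :: "(complex ^ 'n \<Rightarrow> complex) \<Rightarrow> bool" where
  "smoothly_approximable u \<longleftrightarrow> (\<exists>v. (\<forall>m. smooth_on (v m) UNIV) \<and> 
     (\<forall>K. compact K \<longrightarrow> uniform_limit K v u sequentially) \<and> 
     (\<exists>C. \<forall>m z j k. z \<noteq> 0 \<longrightarrow> norm (hess (v m) z j k) \<le> C * inverse (norm z)) \<and> 
     (\<forall>z j k. z \<noteq> 0 \<longrightarrow> (\<lambda>m. hess (v m) z j k) \<longlonglongrightarrow> hess u z j k))"

text \<open>Expresses that \<open>hess_current\<close> has order 0: it is continuous for the
  convergence by which \<open>extend_current\<close> is defined.\<close>

lemma hess_current_tendsto_uniform:
  fixes us :: "(complex ^ 'n::{finite,linorder} \<Rightarrow> complex) list"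
  assumes us: "\<forall>u\<in>set us. mild u" and len: "length us \<le> CARD('n)"
    and \<psi>: "\<And>i. smooth_form (\<psi> i)" and c: "form_converges \<psi> \<phi>"
    and \<phi>: "\<And>I J. continuous_on UNIV (\<lambda>z. \<phi> z I J)"
  shows "(\<lambda>i. hess_current us (\<psi> i)) \<longlonglongrightarrow> hess_current us \<phi>"
proof -
  obtain K where K: "compact K" "\<And>i. form_supported_in (\<psi> i) K" using c by (auto simp: form_converges_def)
  have ul: "uniform_limit UNIV (\<lambda>m z. \<psi> m z I J) (\<lambda>z. \<phi> z I J) sequentially" for I J
    using c by (auto simp: form_converges_def)
  have lim: "(\<lambda>i. \<psi> i z I J) \<longlonglongrightarrow> \<phi> z I J" for z I J
    using tendsto_uniform_limitI[OF ul, of z] by simp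
  have "form_supported_in \<phi> K"
  proof (unfold form_supported_in_def, intro allI impI)
    fix z I J assume "z \<notin> K"
    then have "(\<lambda>i. \<psi> i z I J) = (\<lambda>_. 0)" using K by (auto simp: form_supported_in_def)
    then show "\<phi> z I J = 0" using lim[of z I J] by (simp add: LIMSEQ_const_iff)
  qed
  then obtain B where B: "B \<ge> 0" "\<And>z I J. norm (\<phi> z I J) \<le> B * indicator K z" using form_bounded[of \<phi> K, OF \<phi> K(1)] by blast
  \<comment> \<open>There are finitely many index pairs, so all coefficients are eventually within 1
    of their limits. This yields the common bound B + 1 after dropping an initial segment.\<close>
  have "\<forall>\<^sub>F i in sequentially. \<forall>I J z. dist (\<psi> i z I J) (\<phi> z I J) < 1"
  proof -
    have "\<forall>\<^sub>F i in sequentially. \<forall>z\<in>UNIV. dist (\<psi> i z (fst p) (snd p)) (\<phi> z (fst p) (snd p)) < 1" for p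
      using ul[of "fst p" "snd p"] unfolding uniform_limit_iff by auto
    then have "\<forall>\<^sub>F i in sequentially. \<forall>p. \<forall>z\<in>UNIV. dist (\<psi> i z (fst p) (snd p)) (\<phi> z (fst p) (snd p)) < 1"
      by (rule eventually_all_finite)
    then show ?thesis by (rule eventually_mono) (metis UNIV_I fst_conv snd_conv)
  qed
  then obtain N where N: "\<And>i I J z. i \<ge> N \<Longrightarrow> dist (\<psi> i z I J) (\<phi> z I J) < 1"
    unfolding eventually_sequentially by blast
  have bd: "norm (\<psi> (i + N) z I J) \<le> (B + 1) * inverse (norm z) ^ 0 * indicator K z" for i z I J
  proof (cases "z \<in> K")
    case True
    have "norm (\<psi> (i + N) z I J) \<le> norm (\<phi> z I J) + dist (\<psi> (i + N) z I J) (\<phi> z I J)"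
      by (metis add.commute dist_norm norm_triangle_sub)
    also have "\<dots> \<le> B + 1" using B(2)[of z I J] N[of "i + N" z I J] True by simp
    finally show ?thesis using True by simp
  qed (use K in \<open>auto simp: form_supported_in_def\<close>)
  have "(\<lambda>i. hess_current us (\<psi> (i + N))) \<longlonglongrightarrow> hess_current us \<phi>"
  proof (rule hess_current_tendsto[OF us K(1) _ _ _ bd])
    show "(\<lambda>i. \<psi> (i + N) z I J) \<longlonglongrightarrow> \<phi> z I J" for z I J
      by (rule LIMSEQ_ignore_initial_segment[OF lim])
  qed (use len in \<open>auto intro: smooth_form_measurable \<psi> borel_measurable_continuous_onI \<phi>\<close>)
  then show ?thesis by (rule LIMSEQ_offset)
qed

text \<open>For a nonempty list the functional depends on its argument only through dd^c, and
  \<open>ddc_ddc\<close> says that both arguments have the same one. The empty list is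
  \<open>integrate_form_ddc\<close>.\<close>

lemma bedford_taylor_smooth_factor:
  fixes us :: "(complex ^ 'n::{finite,linorder} \<Rightarrow> real) list"
  assumes \<phi>: "test_form \<phi>" and w: "smooth_on w UNIV"
  shows "bedford_taylor us (\<lambda>z I J. w z * ext_d (ext_dc \<phi>) z I J) = bedford_taylor us (\<lambda>z. wedge11 (hess w z) (\<phi> z))"
proof (cases us)
  case Nil
  then show ?thesis using integrate_form_ddc[OF _ w] \<phi> by (auto simp: test_form_iff)
next
  case (Cons g gs)
  then show ?thesis using ddc_ddc[OF _ w] \<phi> by (simp add: ddc_current_def test_form_iff)
qed

text \<open>In the step, \<eta> m approximates u dd^c \<phi> and \<omega> m approximates dd^c u
  wedge \<phi>. The product over \<open>us\<close> takes equal values on them, so the two limits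
  agree.\<close>

lemma bedford_taylor_eq_hess_current:
  fixes us :: "(complex ^ 'n::{finite,linorder} \<Rightarrow> real) list"
  defines "cx \<equiv> (\<lambda>u z. complex_of_real (u z))"
  assumes "\<And>u. u \<in> set us \<Longrightarrow> mild (cx u)" and "\<And>u. u \<in> set us \<Longrightarrow> smoothly_approximable (cx u)"
    and "length us \<le> CARD('n)" and "test_form \<phi>"
  shows "bedford_taylor us \<phi> = hess_current (map cx us) \<phi>"
  using assms(2-)
proof (induction us arbitrary: \<phi>)
  case Nil
  then show ?case by (simp add: hess_current_def)
next
  case (Cons u us)
  let ?T = "bedford_taylor us" and ?H = "hess_current (map cx us)" and ?\<psi> = "ext_d (ext_dc \<phi>)"
  have TH: "?T \<eta> = ?H \<eta>" if "test_form \<eta>" for \<eta> using Cons that by auto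
  have us: "\<forall>v\<in>set (map cx us). mild v" using Cons.prems(1) by auto
  have len: "length (map cx us) + 1 \<le> CARD('n)" using Cons.prems(3) by simp
  obtain K where \<phi>: "smooth_form \<phi>" "compact K" "form_supported_in \<phi> K" using Cons.prems(4) by (auto simp: test_form_iff)
  have \<psi>: "smooth_form ?\<psi>" "form_supported_in ?\<psi> K" using smooth_ddc supported_ddc \<phi> by auto
  obtain v C where v: "\<And>m. smooth_on (v m) UNIV" "uniform_limit K v (cx u) sequentially"
     "\<And>m z j k. z \<noteq> 0 \<Longrightarrow> norm (hess (v m) z j k) \<le> C * inverse (norm z)"
     "\<And>z j k. z \<noteq> 0 \<Longrightarrow> (\<lambda>m. hess (v m) z j k) \<longlonglongrightarrow> hess (cx u) z j k"
    using Cons.prems(2)[of u] \<phi>(2) unfolding smoothly_approximable_def by (metis list.set_intros(1))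
  have mu: "mild (cx u)" using Cons.prems(1) by simp
  then have cu: "continuous_on UNIV (cx u)" by (simp add: mild_def)
  define \<Psi> where "\<Psi> = scale_form u ?\<psi>"
  have c\<Psi>: "continuous_on UNIV (\<lambda>z. \<Psi> z I J)" for I J
  proof -
    have "continuous_on UNIV (\<lambda>z. cx u z * ?\<psi> z I J)"
      by (rule continuous_on_mult[OF cu smooth_continuous]) (use \<psi>(1) in \<open>simp add: smooth_form_def\<close>)
    then show ?thesis by (simp add: \<Psi>_def scale_form_def cx_def)
  qed
  define \<eta> where "\<eta> m = (\<lambda>z I J. v m z * ?\<psi> z I J)" for m
  have t\<eta>: "test_form (\<eta> m)" for m
    unfolding \<eta>_def test_form_iff using smooth_scale[OF \<psi>(1) v(1)] supported_scale[OF \<psi>(2)] \<phi>(2) by blast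
  have conv: "form_converges \<eta> \<Psi>"
    unfolding form_converges_def
  proof (intro conjI exI[of _ K] allI \<phi>(2))
    show "form_supported_in (\<eta> m) K" for m unfolding \<eta>_def by (rule supported_scale[OF \<psi>(2)])
    fix I J
    obtain B where B: "B \<ge> 0" "\<And>z I J. norm (?\<psi> z I J) \<le> B * indicator K z"
      using smooth_form_bounded[OF \<psi>(1) \<phi>(2) \<psi>(2)] by blast
    show "uniform_limit UNIV (\<lambda>m z. \<eta> m z I J) (\<lambda>z. \<Psi> z I J) sequentially"
    proof (rule uniform_limitI)
      fix e :: real assume e: "e > 0"
      \<comment> \<open>Dividing by B + 1 avoids a zero denominator and leaves the final estimate e
        B / (B + 1) < e strict.\<close>
      have "\<forall>\<^sub>F m in sequentially. \<forall>z\<in>K. dist (v m z) (cx u z) < e / (B + 1)"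
        using v(2) e B(1) by (auto simp: uniform_limit_iff)
      then show "\<forall>\<^sub>F m in sequentially. \<forall>z\<in>UNIV. dist (\<eta> m z I J) (\<Psi> z I J) < e"
      proof eventually_elim
        case (elim m)
        show ?case
        proof
          fix z
          have "dist (\<eta> m z I J) (\<Psi> z I J) = dist (v m z) (cx u z) * norm (?\<psi> z I J)"
            by (simp add: \<eta>_def \<Psi>_def scale_form_def cx_def dist_norm left_diff_distrib[symmetric] norm_mult)
          also have "\<dots> < e"
          proof (cases "z \<in> K")
            case True
            have "dist (v m z) (cx u z) * norm (?\<psi> z I J) \<le> e / (B + 1) * B"
              using elim True B(2)[of z I J] e B(1) by (intro mult_mono) (auto intro: less_imp_le)
            also have "\<dots> < e" using e B(1) by (simp add: field_simps)
            finally show ?thesis .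
          next
            case False
            then show ?thesis using \<psi>(2) e by (simp add: form_supported_in_def)
          qed
          finally show "dist (\<eta> m z I J) (\<Psi> z I J) < e" .
        qed
      qed
    qed
  qed
  have lim: "(\<lambda>m. ?T (\<psi>' m)) \<longlonglongrightarrow> ?H \<Psi>" if "\<And>m. test_form (\<psi>' m)" "form_converges \<psi>' \<Psi>" for \<psi>'
    using hess_current_tendsto_uniform[OF us _ _ that(2) c\<Psi>] that(1) len by (simp add: TH test_form_iff)
  \<comment> \<open>Existence holds because every admissible sequence has this limit; uniqueness
    needs at least one admissible sequence, namely \<eta>.\<close>
  have "extend_current ?T \<Psi> = ?H \<Psi>"
    unfolding extend_current_def
  proof (rule the_equality)
    show "\<forall>\<psi>'. (\<forall>m. test_form (\<psi>' m)) \<and> form_converges \<psi>' \<Psi> \<longrightarrow> (\<lambda>m. ?T (\<psi>' m)) \<longlonglongrightarrow> ?H \<Psi>"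
      using lim by blast
    fix c assume "\<forall>\<psi>'. (\<forall>m. test_form (\<psi>' m)) \<and> form_converges \<psi>' \<Psi> \<longrightarrow> (\<lambda>m. ?T (\<psi>' m)) \<longlonglongrightarrow> c"
    then have "(\<lambda>m. ?T (\<eta> m)) \<longlonglongrightarrow> c" using t\<eta> conv by blast
    then show "c = ?H \<Psi>" using lim[OF t\<eta> conv] LIMSEQ_unique by blast
  qed
  then have "bedford_taylor (u # us) \<phi> = ?H \<Psi>"
    by (simp add: ddc_current_def mult_current_def \<Psi>_def)
  moreover have "(\<lambda>m. ?T (\<eta> m)) \<longlonglongrightarrow> ?H (\<lambda>z. wedge11 (hess (cx u) z) (\<phi> z))"
  proof -
    define \<omega> where "\<omega> m = (\<lambda>z. wedge11 (hess (v m) z) (\<phi> z))" for m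
    have \<omega>: "smooth_form (\<omega> m)" "form_supported_in (\<omega> m) K" for m
      unfolding \<omega>_def using smooth_wedge11[OF \<phi>(1) v(1)] supported_wedge11[OF \<phi>(3)] by blast+
    have T: "?T (\<eta> m) = ?H (\<omega> m)" for m
    proof -
      have "?T (\<eta> m) = ?T (\<omega> m)"
        unfolding \<eta>_def \<omega>_def by (rule bedford_taylor_smooth_factor[OF Cons.prems(4) v(1)])
      moreover have "test_form (\<omega> m)" using \<omega> \<phi>(2) unfolding test_form_iff by blast
      ultimately show ?thesis using TH by simp
    qed
    obtain B where B: "B \<ge> 0" "\<And>z I J. norm (\<phi> z I J) \<le> B * indicator K z"
      using smooth_form_bounded[OF \<phi>] by blast
    have "(\<lambda>m. ?H (\<omega> m)) \<longlonglongrightarrow> ?H (\<lambda>z. wedge11 (hess (cx u) z) (\<phi> z))"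
    proof (rule hess_current_tendsto[OF us \<phi>(2) len])
      show "(\<lambda>z. \<omega> m z I J) \<in> borel_measurable borel" for m I J
        by (rule smooth_form_measurable[OF \<omega>(1)])
      show "(\<lambda>z. wedge11 (hess (cx u) z) (\<phi> z) I J) \<in> borel_measurable borel" for I J
        by (rule measurable_wedge11[OF smooth_form_measurable[OF \<phi>(1)]]) (use mu in \<open>simp add: mild_def\<close>)
      \<comment> \<open>Here p = 1: one Hessian already sits in \<omega> m, and the
        \<open>length us\<close> remaining ones bring the order to at most n.\<close>
      show "norm (\<omega> m z I J) \<le> (2 * (real CARD('n))\<^sup>2 * C * B) * inverse (norm z) ^ 1 * indicator K z" if "z \<noteq> 0" for m z I J
        using norm_wedge11_le[of "hess (v m) z" "C * inverse (norm z)" "\<phi> z" "B * indicator K z" I J] v(3)[OF that] B(2)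
        by (simp add: \<omega>_def mult_ac)
      show "(\<lambda>m. \<omega> m z I J) \<longlonglongrightarrow> wedge11 (hess (cx u) z) (\<phi> z) I J" if "z \<noteq> 0" for z I J
        unfolding \<omega>_def by (intro tendsto_wedge11 tendsto_const v(4) that)
    qed
    then show ?thesis by (simp add: T)
  qed
  ultimately have "bedford_taylor (u # us) \<phi> = ?H (\<lambda>z. wedge11 (hess (cx u) z) (\<phi> z))"
    using lim[OF t\<eta> conv] LIMSEQ_unique by metis
  then show ?case by (simp add: hess_current_def)
qed

section \<open>Differentiation under the integral sign\<close>

lemma has_derivative_scale_arg:
  assumes "f differentiable (at (c *\<^sub>R x))"
  shows "((\<lambda>x. f (c *\<^sub>R x)) has_derivative (\<lambda>b. c *\<^sub>R pd b f (c *\<^sub>R x))) (at x)"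
proof -
  have "((\<lambda>x. f (c *\<^sub>R x)) has_derivative (\<lambda>b. pd (c *\<^sub>R b) f (c *\<^sub>R x))) (at x)"
    by (rule has_derivative_compose[where g=f and f="\<lambda>x. c *\<^sub>R x" and f'="\<lambda>b. c *\<^sub>R b" and g'="\<lambda>b. pd b f (c *\<^sub>R x)"])
      (auto intro!: derivative_eq_intros pd_has_derivative assms)
  then show ?thesis using linear_frechet_derivative[OF assms] by (simp add: linear_cmul)
qed

lemma has_derivative_shift_arg:
  assumes "f differentiable (at (x - y))"
  shows "((\<lambda>x. f (x - y)) has_derivative (\<lambda>b. pd b f (x - y))) (at x)"
  by (rule has_derivative_compose[where g=f and f="\<lambda>x. x - y" and f'="\<lambda>b. b" and g'="\<lambda>b. pd b f (x - y)"])
    (auto intro!: derivative_eq_intros pd_has_derivative assms)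

text \<open>The Leibniz rule in terms of partial derivatives: continuity of the partials along basis
  vectors is enough to make the full derivative continuous as an operator.\<close>

lemma differentiable_param_integral:
  fixes f :: "'a::euclidean_space \<Rightarrow> 'b::euclidean_space \<Rightarrow> complex"
  assumes U: "open U" "convex U" "x0 \<in> U"
    and d: "\<And>x t. x \<in> U \<Longrightarrow> t \<in> cbox a b \<Longrightarrow> (\<lambda>x. f x t) differentiable (at x)"
    and c: "\<And>e. e \<in> Basis \<Longrightarrow> continuous_on (U \<times> cbox a b) (\<lambda>(x, t). pd e (\<lambda>x. f x t) x)"
    and i: "\<And>x. x \<in> U \<Longrightarrow> continuous_on (cbox a b) (f x)"
  shows "(\<lambda>x. integral (cbox a b) (f x)) differentiable (at x0)"
    and "pd e (\<lambda>x. integral (cbox a b) (f x)) x0 = integral (cbox a b) (\<lambda>t. pd e (\<lambda>x. f x t) x0)"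
proof -
  \<comment> \<open>Derivatives are packed as bounded linear maps, because
    \<open>leibniz_rule\<close> asks for a continuous family of such maps.\<close>
  define fx where "fx x t = Blinfun (frechet_derivative (\<lambda>x. f x t) (at x))" for x t
  have fx: "blinfun_apply (fx x t) = frechet_derivative (\<lambda>x. f x t) (at x)" if "x \<in> U" "t \<in> cbox a b" for x t
    unfolding fx_def by (intro bounded_linear_Blinfun_apply has_derivative_bounded_linear[OF pd_has_derivative] d that)
  have cfx: "continuous_on (U \<times> cbox a b) (\<lambda>(x, t). fx x t)"
  proof (rule continuous_on_blinfun_componentwise)
    fix e :: 'a assume "e \<in> Basis"
    from c[OF this] show "continuous_on (U \<times> cbox a b) (\<lambda>x. blinfun_apply (case x of (x, t) \<Rightarrow> fx x t) e)"
      by (rule continuous_on_eq) (auto simp: fx)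
  qed
  have "((\<lambda>x. integral (cbox a b) (f x)) has_derivative integral (cbox a b) (fx x0)) (at x0 within U)"
  proof (rule leibniz_rule[OF _ _ cfx U(3,2)])
    show "((\<lambda>x. f x t) has_derivative blinfun_apply (fx x t)) (at x within U)" if "x \<in> U" "t \<in> cbox a b" for x t
      unfolding fx[OF that] by (rule has_derivative_at_withinI[OF pd_has_derivative[OF d[OF that]]])
  qed (intro integrable_continuous i)
  then have D: "((\<lambda>x. integral (cbox a b) (f x)) has_derivative integral (cbox a b) (fx x0)) (at x0)"
    using at_within_open[OF U(3,1)] by simp
  then show "(\<lambda>x. integral (cbox a b) (f x)) differentiable (at x0)" by (rule differentiableI)
  have "continuous_on (cbox a b) (\<lambda>t. case (x0, t) of (x, t) \<Rightarrow> fx x t)"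
    by (rule continuous_on_compose2[OF cfx]) (use U in \<open>auto intro!: continuous_intros\<close>)
  then have "fx x0 integrable_on cbox a b" by (intro integrable_continuous) simp
  then have "pd e (\<lambda>x. integral (cbox a b) (f x)) x0 = integral (cbox a b) (\<lambda>t. blinfun_apply (fx x0 t) e)"
    using pd_eqI[OF D] by (simp add: blinfun_apply_integral)
  also have "\<dots> = integral (cbox a b) (\<lambda>t. pd e (\<lambda>x. f x t) x0)"
    by (rule integral_cong) (simp add: fx U)
  finally show "pd e (\<lambda>x. integral (cbox a b) (f x)) x0 = integral (cbox a b) (\<lambda>t. pd e (\<lambda>x. f x t) x0)" .
qed

section \<open>Mollification\<close>

text \<open>A cube rather than a ball, to fit both the coordinatewise \<open>bump\<close> and
  integrals over \<open>cbox\<close>.\<close>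

definition unit_box :: "'a::euclidean_space set" where
  "unit_box = cbox (- One) One"

lemma compact_unit_box: "compact unit_box"
  by (simp add: unit_box_def)

text \<open>The variable x sits in the kernel, so derivatives fall on the smooth factor \<rho> and
  only continuity of g is used for smoothness.\<close>

definition conv :: "('a::euclidean_space \<Rightarrow> complex) \<Rightarrow> ('a \<Rightarrow> complex) \<Rightarrow> 'a \<Rightarrow> complex" where
  "conv g \<rho> x = (LINT v|lborel. g v * \<rho> (x - v))"

lemma lborel_integral_reflect:
  fixes f :: "'a::euclidean_space \<Rightarrow> 'b::euclidean_space"
  assumes "continuous_on UNIV f"
  shows "(LINT y|lborel. f (c - y)) = (LINT y|lborel. f y)"
proof -
  have m: "f \<in> borel_measurable borel" using assms by (rule borel_measurable_continuous_onI)
  have l: "(lborel :: 'a measure) = distr lborel borel (\<lambda>x. c - x)"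
    using lborel_affine[of "-1" c] by (simp add: density_1)
  have "(LINT y|lborel. f y) = (LINT y|distr lborel borel (\<lambda>x. c - x). f y)" using l by simp
  also have "\<dots> = (LINT y|lborel. f (c - y))" by (rule integral_distr) (use m in auto)
  finally show ?thesis by simp
qed

text \<open>Substituting y = x - v moves x into g. In this form the convolution is an average of g
  near x, and derivatives can fall on g.\<close>

lemma conv_eq_integral_unit_box:
  assumes g: "continuous_on UNIV g" and \<rho>: "continuous_on UNIV \<rho>" and 0: "\<And>y. y \<notin> unit_box \<Longrightarrow> \<rho> y = 0"
  shows "conv g \<rho> x = integral unit_box (\<lambda>y. \<rho> y * g (x - y))"
proof -
  have c: "continuous_on UNIV (\<lambda>v. g v * \<rho> (x - v))" "continuous_on UNIV (\<lambda>y. \<rho> y * g (x - y))"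
    by (intro continuous_intros continuous_on_compose2[OF \<rho>] continuous_on_compose2[OF g]; auto)+
  have "conv g \<rho> x = (LINT y|lborel. \<rho> y * g (x - y))"
    unfolding conv_def using lborel_integral_reflect[OF c(1), of x] by (simp add: mult.commute)
  also have "\<dots> = integral unit_box (\<lambda>y. \<rho> y * g (x - y))"
    unfolding unit_box_def using integral_cbox_eq_lborel(2)[OF c(2), of "- One" One] 0 by (simp add: unit_box_def)
  finally show ?thesis .
qed

lemma conv_differentiable:
  fixes g :: "'a::euclidean_space \<Rightarrow> complex"
  assumes g: "continuous_on UNIV g" and \<rho>: "smooth_on \<rho> UNIV" and 0: "\<And>y. y \<notin> unit_box \<Longrightarrow> \<rho> y = 0"
  shows "conv g \<rho> differentiable (at x0)" "b \<in> Basis \<Longrightarrow> pd b (conv g \<rho>) x0 = conv g (pd b \<rho>) x0"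
proof -
  \<comment> \<open>One box containing every v that matters for x within distance 1 of x0, so that
    the domain of integration is fixed while x varies.\<close>
  have "compact ((\<lambda>(x, y). x - y) ` (cball x0 1 \<times> (unit_box :: 'a set)))"
    unfolding split_def by (intro compact_continuous_image compact_Times compact_cball compact_unit_box continuous_intros)
  then obtain a where a: "(\<lambda>(x, y). x - y) ` (cball x0 1 \<times> unit_box) \<subseteq> cbox (-a) a"
    using bounded_subset_cbox_symmetric compact_imp_bounded by metis
  have out: "x - v \<notin> unit_box" if "x \<in> ball x0 1" "v \<notin> cbox (-a) a" for x v
  proof
    assume "x - v \<in> unit_box"
    then have "x - (x - v) \<in> cbox (-a) a"
      using a that(1) by (intro subsetD[OF a] image_eqI[where x="(x, x - v)"]) auto
    then show False using that by simp
  qed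
  have c: "continuous_on A (\<lambda>v. g v * \<sigma> (x - v))" if "continuous_on UNIV \<sigma>" for \<sigma> x A
    by (intro continuous_intros continuous_on_compose2[OF that] continuous_on_subset[OF g]) auto
  have eq: "conv g \<sigma> x = integral (cbox (-a) a) (\<lambda>v. g v * \<sigma> (x - v))" 
    if "x \<in> ball x0 1" "continuous_on UNIV \<sigma>" "\<And>y. y \<notin> unit_box \<Longrightarrow> \<sigma> y = 0" for x \<sigma>
    unfolding conv_def using integral_cbox_eq_lborel(2)[OF c[OF that(2)], of "-a" a x] that(3) out[OF that(1)] by simp
  have D: "((\<lambda>x. g v * \<rho> (x - v)) has_derivative (\<lambda>b. g v * pd b \<rho> (x - v))) (at x)" for v x
    by (intro has_derivative_mult_right has_derivative_shift_arg smooth_differentiable \<rho>)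
  have p: "pd e (\<lambda>x. g v * \<rho> (x - v)) x = g v * pd e \<rho> (x - v)" for e v x
    by (rule pd_eqI[OF D])
  have cp: "continuous_on UNIV (pd e \<rho>)" if "e \<in> Basis" for e
    by (intro smooth_continuous smooth_pd \<rho> that)
  note * = differentiable_param_integral[of "ball x0 1" x0 "-a" a "\<lambda>x v. g v * \<rho> (x - v)"]
  have c1: "continuous_on (ball x0 1 \<times> cbox (- a) a) (\<lambda>(x, t). pd e (\<lambda>x. g t * \<rho> (x - t)) x)" if "e \<in> Basis" for e
    unfolding p split_def
    by (intro continuous_intros continuous_on_compose2[OF cp[OF that]] continuous_on_compose2[OF g]) auto
  have I: "(\<lambda>x. integral (cbox (-a) a) (\<lambda>v. g v * \<rho> (x - v))) differentiable (at x0)"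
    by (rule *(1)) (use differentiableI[OF D] c1 c[OF smooth_continuous[OF \<rho>]] in auto)
  then show "conv g \<rho> differentiable (at x0)"
    by (rule differentiable_eq_on_open[OF open_ball centre_in_ball[THEN iffD2, OF zero_less_one], rotated])
      (rule eq[symmetric]; use 0 smooth_continuous[OF \<rho>] in auto)
  assume b: "b \<in> Basis"
  have "pd b (conv g \<rho>) x0 = pd b (\<lambda>x. integral (cbox (-a) a) (\<lambda>v. g v * \<rho> (x - v))) x0"
    by (rule pd_eq_on_open[OF open_ball centre_in_ball[THEN iffD2, OF zero_less_one]])
      (rule eq; use 0 smooth_continuous[OF \<rho>] in auto)
  also have "\<dots> = integral (cbox (-a) a) (\<lambda>v. pd b (\<lambda>x. g v * \<rho> (x - v)) x0)"
    by (rule *(2)) (use differentiableI[OF D] c1 c[OF smooth_continuous[OF \<rho>]] in auto)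
  also have "\<dots> = conv g (pd b \<rho>) x0"
    unfolding p by (rule eq[symmetric]) (use cp[OF b] pd_zero_outside[OF compact_unit_box 0] in auto)
  finally show "pd b (conv g \<rho>) x0 = conv g (pd b \<rho>) x0" .
qed

lemma smooth_conv:
  fixes g :: "'a::euclidean_space \<Rightarrow> complex"
  assumes g: "continuous_on UNIV g" and \<rho>: "smooth_on \<rho> UNIV" and 0: "\<And>y. y \<notin> unit_box \<Longrightarrow> \<rho> y = 0"
  shows "smooth_on (conv g \<rho>) UNIV"
proof -
  have "Ck_on k (conv g \<rho>) UNIV" for k using \<rho> 0
  proof (induction k arbitrary: \<rho>)
    case 0
    show ?case using conv_differentiable(1)[OF g 0] 
      by (auto simp: continuous_on_eq_continuous_at intro!: differentiable_imp_continuous_within)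
  next
    case (Suc k)
    have "Ck_on k (pd b (conv g \<rho>)) UNIV" if b: "b \<in> Basis" for b
    proof -
      have "pd b (conv g \<rho>) = conv g (pd b \<rho>)" by (intro ext conv_differentiable(2)[OF g Suc.prems b])
      moreover have "Ck_on k (conv g (pd b \<rho>)) UNIV"
        by (rule Suc.IH[OF smooth_pd[OF Suc.prems(1) b] pd_zero_outside[OF compact_unit_box Suc.prems(2)]])
      ultimately show ?thesis by simp
    qed
    then show ?case using conv_differentiable(1)[OF g Suc.prems] by auto
  qed
  then show ?thesis by (simp add: smooth_on_def)
qed

lemma smooth_scale_arg:
  fixes f :: "'a::euclidean_space \<Rightarrow> complex"
  assumes "smooth_on f UNIV"
  shows "smooth_on (\<lambda>x. f (c *\<^sub>R x)) UNIV"
proof -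
  have "Ck_on k (\<lambda>x. f (c *\<^sub>R x)) UNIV" for k using assms
  proof (induction k arbitrary: f)
    case 0
    show ?case using continuous_on_compose2[OF smooth_continuous[OF 0, of UNIV], of UNIV "\<lambda>x. c *\<^sub>R x"]
      by (simp add: continuous_intros)
  next
    case (Suc k)
    have d: "((\<lambda>x. f (c *\<^sub>R x)) has_derivative (\<lambda>b. c *\<^sub>R pd b f (c *\<^sub>R x))) (at x)" for x
      by (rule has_derivative_scale_arg[OF smooth_differentiable[OF Suc.prems]])
    have "Ck_on k (pd b (\<lambda>x. f (c *\<^sub>R x))) UNIV" if "b \<in> Basis" for b
    proof -
      have "pd b (\<lambda>x. f (c *\<^sub>R x)) = (\<lambda>x. of_real c * pd b f (c *\<^sub>R x))"
        by (rule ext) (simp add: pd_eqI[OF d] scaleR_conv_of_real)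
      then show ?thesis using Suc.IH[OF smooth_pd[OF Suc.prems that]] by (simp only: Ck_on_mult Ck_on_const)
    qed
    then show ?case using differentiableI[OF d] by auto
  qed
  then show ?thesis by (simp add: smooth_on_def)
qed

lemma mollifier_exists:
  obtains \<rho> :: "'a::euclidean_space \<Rightarrow> real" where "smooth_on (\<lambda>y. complex_of_real (\<rho> y)) UNIV" "\<And>y. 0 \<le> \<rho> y"
    "\<And>y. y \<notin> unit_box \<Longrightarrow> \<rho> y = 0" "continuous_on UNIV \<rho>" "integral unit_box \<rho> = 1"
proof -
  define \<beta> :: "'a \<Rightarrow> real" where "\<beta> = bump (- One) One 1"
  have sm: "smooth_on (\<lambda>y. complex_of_real (\<beta> y)) UNIV" unfolding \<beta>_def by (rule smooth_bump)
  have "continuous_on UNIV (\<lambda>y. Re (complex_of_real (\<beta> y)))"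
    by (intro continuous_on_Re smooth_continuous sm)
  then have c: "continuous_on UNIV \<beta>" by simp
  have 0: "\<beta> y = 0" if "y \<notin> unit_box" for y
    using bump_outside that box_subset_cbox unfolding \<beta>_def unit_box_def by blast
  have i: "integrable lborel \<beta>" "integral unit_box \<beta> = (LINT y|lborel. \<beta> y)"
    using integral_cbox_eq_lborel[OF c, of "- One" One] 0 by (auto simp: unit_box_def)
  have nn: "AE y in lborel. 0 \<le> \<beta> y" by (simp add: \<beta>_def bump_bounds(1))
  \<comment> \<open>A vanishing integral would make the bump zero almost everywhere, but it is
    positive on an open box of positive volume.\<close>
  have "(LINT y|lborel. \<beta> y) \<noteq> 0"
  proof
    assume "(LINT y|lborel. \<beta> y) = 0"
    then have "AE y in lborel. \<beta> y = 0"
      using integral_nonneg_eq_0_iff_AE[OF i(1) nn] by simp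
    then have "AE y in lborel. y \<notin> box (- One) (One::'a)"
    proof eventually_elim
      case (elim y)
      then show ?case using bump_pos[of y "- One" One 1] by (auto simp: \<beta>_def)
    qed
    then have "emeasure lborel (box (- One) (One::'a)) = 0"
      by (subst (asm) AE_iff_measurable[OF _ refl]) auto
    moreover have "(\<Prod>b\<in>Basis. ((One::'a) - (- One)) \<bullet> b) > 0"
      by (rule prod_pos) (simp only: inner_diff_left inner_minus_left, simp)
    ultimately show False by (auto simp: emeasure_lborel_box_eq inner_add_left)
  qed
  moreover have "(LINT y|lborel. \<beta> y) \<ge> 0" using nn by (rule integral_nonneg_AE)
  ultimately have pos: "integral unit_box \<beta> > 0" using i by simp
  define \<rho> where "\<rho> y = inverse (integral unit_box \<beta>) * \<beta> y" for y
  show ?thesis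
  proof (rule that[of \<rho>])
    show "smooth_on (\<lambda>y. complex_of_real (\<rho> y)) UNIV"
      unfolding \<rho>_def of_real_mult by (intro smooth_cmult sm)
    show "integral unit_box \<rho> = 1" using pos by (simp add: \<rho>_def[abs_def])
    show "0 \<le> \<rho> y" for y
      unfolding \<rho>_def \<beta>_def[symmetric] using pos by (intro mult_nonneg_nonneg) (simp_all add: \<beta>_def bump_bounds(1))
    show "continuous_on UNIV \<rho>" unfolding \<rho>_def by (intro continuous_intros c)
  qed (simp add: \<rho>_def 0)
qed

section \<open>Homogeneous functions with a conical singularity\<close>

text \<open>The features of a support function, made complex-valued: Lipschitz, positively
  homogeneous of degree 1, and C^2 off the origin.\<close>

locale conical =
  fixes g :: "'a::euclidean_space \<Rightarrow> complex" and L :: real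
  assumes lip: "norm (g x - g y) \<le> L * norm (x - y)"
    and hom: "t > 0 \<Longrightarrow> g (t *\<^sub>R x) = of_real t * g x"
    and d1: "x \<noteq> 0 \<Longrightarrow> g differentiable (at x)"
    and d2: "x \<noteq> 0 \<Longrightarrow> b \<in> Basis \<Longrightarrow> pd b g differentiable (at x)"
    and c2: "a \<in> Basis \<Longrightarrow> b \<in> Basis \<Longrightarrow> continuous_on (- {0}) (pd a (pd b g))"
begin

lemma continuous: "continuous_on UNIV g"
proof (rule continuous_onI)
  fix x :: 'a and e :: real assume e: "e > 0"
  have L1: "L \<le> \<bar>L\<bar> + 1" by simp
  show "\<exists>d>0. \<forall>x'\<in>UNIV. dist x' x < d \<longrightarrow> dist (g x') (g x) \<le> e"
  proof (intro exI[of _ "e / (\<bar>L\<bar> + 1)"] conjI ballI impI)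
    fix y assume "dist y x < e / (\<bar>L\<bar> + 1)"
    then have "(\<bar>L\<bar> + 1) * norm (y - x) \<le> e" by (simp add: dist_norm field_simps)
    moreover have "dist (g y) (g x) \<le> (\<bar>L\<bar> + 1) * norm (y - x)"
      using lip[of y x] mult_right_mono[OF L1, of "norm (y - x)"] by (simp add: dist_norm)
    ultimately show "dist (g y) (g x) \<le> e" by simp
  qed (use e in simp)
qed

text \<open>Differentiating g(t x) = t g(x) gives degree 0 for first derivatives; one more
  derivative gives degree -1 in \<open>pd2_hom\<close>.\<close>

lemma pd_hom:
  assumes t: "t > 0" and x: "x \<noteq> 0"
  shows "pd b g (t *\<^sub>R x) = pd b g x"
proof -
  have "pd b (\<lambda>x. g (t *\<^sub>R x)) x = t *\<^sub>R pd b g (t *\<^sub>R x)"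
    by (rule pd_eqI[OF has_derivative_scale_arg]) (use d1 t x in simp)
  moreover have "(\<lambda>x. g (t *\<^sub>R x)) = (\<lambda>x. of_real t * g x)" using hom[OF t] by auto
  ultimately have "of_real t * pd b g x = of_real t * pd b g (t *\<^sub>R x)"
    using pd_cmult[OF d1[OF x], where b=b and c="of_real t"] by (simp add: scaleR_conv_of_real)
  then show ?thesis using t by simp
qed

lemma pd2_hom:
  assumes t: "t > 0" and x: "x \<noteq> 0" and b: "b \<in> Basis"
  shows "of_real t * pd a (pd b g) (t *\<^sub>R x) = pd a (pd b g) x"
proof -
  have "pd a (\<lambda>x. pd b g (t *\<^sub>R x)) x = t *\<^sub>R pd a (pd b g) (t *\<^sub>R x)"
    by (rule pd_eqI[OF has_derivative_scale_arg]) (use d2[OF _ b] t x in simp)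
  moreover have "pd a (\<lambda>x. pd b g (t *\<^sub>R x)) x = pd a (pd b g) x"
    by (rule pd_eq_on_open[of "- {0}"]) (use x pd_hom[OF t] in auto)
  ultimately show ?thesis by (simp add: scaleR_conv_of_real)
qed

text \<open>C bounds the second derivative on the compact unit sphere; homogeneity of degree -1
  spreads the bound to all x \<noteq> 0.\<close>

lemma pd2_bound_one:
  assumes a: "a \<in> Basis" and b: "b \<in> Basis"
  shows "\<exists>C. \<forall>x. x \<noteq> 0 \<longrightarrow> norm (pd a (pd b g) x) \<le> C * inverse (norm x)"
proof -
  have "bounded (pd a (pd b g) ` sphere 0 1)"
    by (intro compact_imp_bounded compact_continuous_image compact_sphere continuous_on_subset[OF c2[OF a b]]) auto
  then obtain C where C: "\<And>x. x \<in> sphere 0 1 \<Longrightarrow> norm (pd a (pd b g) x) \<le> C" unfolding bounded_iff by blast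
  have "norm (pd a (pd b g) x) \<le> C * inverse (norm x)" if x: "x \<noteq> 0" for x
  proof -
    have "pd a (pd b g) x = of_real (inverse (norm x)) * pd a (pd b g) (inverse (norm x) *\<^sub>R x)"
      using pd2_hom[of "inverse (norm x)" x b a] x b by simp
    then have "norm (pd a (pd b g) x) = inverse (norm x) * norm (pd a (pd b g) (inverse (norm x) *\<^sub>R x))"
      by (simp add: norm_mult norm_inverse)
    also have "\<dots> \<le> inverse (norm x) * C" by (intro mult_left_mono C) (use x in auto)
    finally show ?thesis by (simp add: mult.commute)
  qed
  then show ?thesis by blast
qed

end

text \<open>If |x0| > R, then x - y stays away from 0 for x near x0 and y in the box. The
  singularity is never met, and derivatives may fall on G.\<close>

lemma conv_differentiable_away:
  fixes G :: "'a::euclidean_space \<Rightarrow> complex"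
  assumes R: "\<And>y. y \<in> unit_box \<Longrightarrow> norm (y::'a) < R" and \<rho>: "continuous_on UNIV \<rho>"
    and d: "\<And>x. x \<noteq> 0 \<Longrightarrow> G differentiable (at x)"
    and c: "\<And>e. e \<in> Basis \<Longrightarrow> continuous_on (- {0}) (pd e G)" and x0: "norm x0 > R"
  shows "(\<lambda>x. integral unit_box (\<lambda>y. \<rho> y * G (x - y))) differentiable (at x0)"
    and "pd e (\<lambda>x. integral unit_box (\<lambda>y. \<rho> y * G (x - y))) x0 = integral unit_box (\<lambda>y. \<rho> y * pd e G (x0 - y))"
proof -
  let ?U = "ball x0 (norm x0 - R)"
  have ne: "x - y \<noteq> 0" if "x \<in> ?U" "y \<in> unit_box" for x y
  proof
    assume "x - y = 0"
    then have "norm x < R" using R[OF that(2)] by simp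
    moreover have "norm x0 \<le> norm x + dist x0 x" by (metis add.commute dist_norm norm_triangle_sub)
    ultimately show False using that(1) by simp
  qed
  have ne': "x \<notin> unit_box" if "dist x0 x < norm x0 - R" for x using ne[of x x] that by auto
  have D: "((\<lambda>x. \<rho> y * G (x - y)) has_derivative (\<lambda>b. \<rho> y * pd b G (x - y))) (at x)" if "x \<in> ?U" "y \<in> unit_box" for x y
    by (intro has_derivative_mult_right has_derivative_shift_arg d ne that)
  have cG: "continuous_on (- {0}) G"
    by (intro continuous_at_imp_continuous_on ballI differentiable_imp_continuous_within d) simp
  have 1: "continuous_on (?U \<times> unit_box) (\<lambda>(x, y). pd e (\<lambda>x. \<rho> y * G (x - y)) x)" if "e \<in> Basis" for e
  proof -
    have "continuous_on (?U \<times> unit_box) (\<lambda>p. \<rho> (snd p) * pd e G (fst p - snd p))"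
      by (intro continuous_intros continuous_on_compose2[OF \<rho>] continuous_on_compose2[OF c[OF that]]) (use ne' in auto)
    then show ?thesis by (rule continuous_on_eq) (use pd_eqI[OF D] in auto)
  qed
  have 2: "continuous_on unit_box (\<lambda>y. \<rho> y * G (x - y))" if "x \<in> ?U" for x
    by (intro continuous_intros continuous_on_subset[OF \<rho>] continuous_on_compose2[OF cG]) (use ne' that in auto)
  have x0U: "x0 \<in> ?U" using x0 by simp
  note * = differentiable_param_integral[OF open_ball convex_ball x0U, where a="- One" and b=One and f="\<lambda>x y. \<rho> y * G (x - y)", 
      folded unit_box_def, OF differentiableI[OF D] 1 2]
  show "(\<lambda>x. integral unit_box (\<lambda>y. \<rho> y * G (x - y))) differentiable (at x0)" by (rule *(1))
  have "pd e (\<lambda>x. integral unit_box (\<lambda>y. \<rho> y * G (x - y))) x0 = integral unit_box (\<lambda>y. pd e (\<lambda>x. \<rho> y * G (x - y)) x0)"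
    by (rule *(2))
  also have "\<dots> = integral unit_box (\<lambda>y. \<rho> y * pd e G (x0 - y))"
    by (rule integral_cong) (use pd_eqI[OF D[OF x0U]] in auto)
  finally show "pd e (\<lambda>x. integral unit_box (\<lambda>y. \<rho> y * G (x - y))) x0 = integral unit_box (\<lambda>y. \<rho> y * pd e G (x0 - y))" .
qed

text \<open>An average against a probability density stays as close to c as the averaged values do.
  With c = 0 it serves as a norm bound.\<close>

lemma weighted_integral_dist:
  fixes \<rho> :: "'a::euclidean_space \<Rightarrow> real" and F :: "'a \<Rightarrow> complex"
  assumes \<rho>: "continuous_on UNIV \<rho>" "\<And>y. 0 \<le> \<rho> y" "integral unit_box \<rho> = 1"
    and F: "continuous_on unit_box F" "\<And>y. y \<in> unit_box \<Longrightarrow> norm (F y - c) \<le> e"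
  shows "norm (integral unit_box (\<lambda>y. of_real (\<rho> y) * F y) - c) \<le> e"
proof -
  have i\<rho>: "\<rho> integrable_on unit_box" unfolding unit_box_def
    by (intro integrable_continuous continuous_on_subset[OF \<rho>(1)]) auto
  have iF: "(\<lambda>y. of_real (\<rho> y) * F y) integrable_on unit_box" "(\<lambda>y. of_real (\<rho> y) * (F y - c)) integrable_on unit_box" 
    "(\<lambda>y. of_real (\<rho> y) * c) integrable_on unit_box"
    using F(1) unfolding unit_box_def 
    by (intro integrable_continuous continuous_intros continuous_on_subset[OF \<rho>(1)]; auto)+
  have "integral unit_box (\<lambda>y. of_real (\<rho> y) * c) = c"
    using has_integral_mult_left[OF has_integral_linear[OF integrable_integral[OF i\<rho>] bounded_linear_of_real], of c] \<rho>(3)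
    by (intro integral_unique) (simp add: o_def)
  then have "integral unit_box (\<lambda>y. of_real (\<rho> y) * F y) - c = integral unit_box (\<lambda>y. of_real (\<rho> y) * (F y - c))"
    using integral_diff[OF iF(1,3)] by (simp add: right_diff_distrib)
  moreover have "norm (integral unit_box (\<lambda>y. of_real (\<rho> y) * (F y - c))) \<le> integral unit_box (\<lambda>y. \<rho> y * e)"
  proof (rule Henstock_Kurzweil_Integration.integral_norm_bound_integral[OF iF(2)])
    show "(\<lambda>y. \<rho> y * e) integrable_on unit_box" by (rule integrable_on_mult_left[OF i\<rho>])
    show "norm (of_real (\<rho> y) * (F y - c)) \<le> \<rho> y * e" if "y \<in> unit_box" for y
      using mult_left_mono[OF F(2)[OF that] \<rho>(2)] \<rho>(2)[of y] by (simp add: norm_mult)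
  qed
  moreover have "integral unit_box (\<lambda>y. \<rho> y * e) = e" using \<rho>(3) by simp
  ultimately show ?thesis using \<rho>(3) by simp
qed

lemma (in conical) smooth_approximation:
  obtains v where "\<And>m::nat. smooth_on (v m) UNIV" "uniform_limit UNIV v g sequentially"
    "\<And>a b. a \<in> Basis \<Longrightarrow> b \<in> Basis \<Longrightarrow> \<exists>C. \<forall>m x. x \<noteq> 0 \<longrightarrow> norm (pd a (pd b (v m)) x) \<le> C * inverse (norm x)"
    "\<And>a b x. a \<in> Basis \<Longrightarrow> b \<in> Basis \<Longrightarrow> x \<noteq> 0 \<Longrightarrow> (\<lambda>m. pd a (pd b (v m)) x) \<longlonglongrightarrow> pd a (pd b g) x"
proof -
  obtain \<rho> :: "'a \<Rightarrow> real" where \<rho>: "smooth_on (\<lambda>y. complex_of_real (\<rho> y)) UNIV" "\<And>y. 0 \<le> \<rho> y"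
    "\<And>y. y \<notin> unit_box \<Longrightarrow> \<rho> y = 0" "continuous_on UNIV \<rho>" "integral unit_box \<rho> = 1"
    using mollifier_exists by blast
  let ?\<rho> = "\<lambda>y. complex_of_real (\<rho> y)"
  define U where "U = conv g ?\<rho>"
  have c\<rho>: "continuous_on UNIV ?\<rho>" by (rule smooth_continuous[OF \<rho>(1)])
  have smU: "smooth_on U UNIV" unfolding U_def by (rule smooth_conv[OF continuous \<rho>(1)]) (simp add: \<rho>(3))
  have UI: "U = (\<lambda>x. integral unit_box (\<lambda>y. ?\<rho> y * g (x - y)))"
    unfolding U_def by (rule ext, rule conv_eq_integral_unit_box[OF continuous c\<rho>]) (simp add: \<rho>(3))
  obtain R' where R': "R' > 0" "\<And>y. y \<in> (unit_box :: 'a set) \<Longrightarrow> norm y \<le> R'"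
    using compact_imp_bounded[OF compact_unit_box] unfolding bounded_pos by blast
  define R where "R = R' + 1"
  have R: "R > 0" "\<And>y. y \<in> (unit_box :: 'a set) \<Longrightarrow> norm y < R" using R' by (auto simp: R_def less_add_one intro: le_less_trans[OF _ less_add_one])
  have cpd: "continuous_on (- {0}) (pd b g)" if "b \<in> Basis" for b
    by (intro continuous_at_imp_continuous_on ballI differentiable_imp_continuous_within d2 that) simp
  have p1: "pd b U x = integral unit_box (\<lambda>y. ?\<rho> y * pd b g (x - y))" if "norm x > R" "b \<in> Basis" for x b
    unfolding UI by (rule conv_differentiable_away(2)[OF R(2) c\<rho> d1 cpd that(1)])
  have p2: "pd a (pd b U) x = integral unit_box (\<lambda>y. ?\<rho> y * pd a (pd b g) (x - y))" 
    if "norm x > R" "a \<in> Basis" "b \<in> Basis" for x a b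
  proof -
    have "open {x::'a. norm x > R}" by (intro open_Collect_less continuous_intros)
    then have "pd a (pd b U) x = pd a (\<lambda>x. integral unit_box (\<lambda>y. ?\<rho> y * pd b g (x - y))) x"
      by (rule pd_eq_on_open) (use that p1 in auto)
    also have "\<dots> = integral unit_box (\<lambda>y. ?\<rho> y * pd a (pd b g) (x - y))"
      by (rule conv_differentiable_away(2)[OF R(2) c\<rho> d2[OF _ that(3)] c2[OF _ that(3)] that(1)])
    finally show ?thesis .
  qed
  have cshift: "continuous_on unit_box (\<lambda>y. pd a (pd b g) (x - y))" 
    if "norm x > R" "a \<in> Basis" "b \<in> Basis" for x a b
  proof (rule continuous_on_compose2[OF c2[OF that(2,3)]])
    show "(\<lambda>y. x - y) ` unit_box \<subseteq> - {0}" using R(2) that(1) by force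
  qed (intro continuous_intros)
  \<comment> \<open>By homogeneity this is g mollified at scale 1/(m + 1); \<open>Suc m\<close>
    keeps the scale defined for m = 0.\<close>
  define v where "v m x = of_real (inverse (real (Suc m))) * U (real (Suc m) *\<^sub>R x)" for m x
  have smv: "smooth_on (v m) UNIV" for m
    unfolding v_def by (intro smooth_cmult smooth_scale_arg smU)
  have v1: "pd b (v m) = (\<lambda>x. pd b U (real (Suc m) *\<^sub>R x))" for b m
  proof (rule ext)
    fix x
    have d: "((\<lambda>x. U (real (Suc m) *\<^sub>R x)) has_derivative (\<lambda>b. real (Suc m) *\<^sub>R pd b U (real (Suc m) *\<^sub>R x))) (at x)"
      by (rule has_derivative_scale_arg[OF smooth_differentiable[OF smU]])
    show "pd b (v m) x = pd b U (real (Suc m) *\<^sub>R x)"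
      using pd_eqI[OF has_derivative_mult_right[OF d, of "of_real (inverse (real (Suc m)))"], of b]
      by (simp add: v_def[abs_def] scaleR_conv_of_real field_simps del: of_nat_Suc)
  qed
  have v2: "pd a (pd b (v m)) x = of_real (real (Suc m)) * pd a (pd b U) (real (Suc m) *\<^sub>R x)" if "b \<in> Basis" for a b m x
    unfolding v1 by (subst pd_eqI[OF has_derivative_scale_arg[OF smooth_differentiable[OF smooth_pd[OF smU that]]]])
      (simp add: scaleR_conv_of_real)
  \<comment> \<open>The error of the fixed mollification is bounded uniformly in x, so rescaling
    divides it by m + 1.\<close>
  have Ug: "norm (U x - g x) \<le> \<bar>L\<bar> * R" for x
    unfolding UI
  proof (rule weighted_integral_dist[OF \<rho>(4,2,5)])
    show "continuous_on unit_box (\<lambda>y. g (x - y))"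
      by (intro continuous_on_compose2[OF continuous] continuous_intros) auto
    show "norm (g (x - y) - g x) \<le> \<bar>L\<bar> * R" if "y \<in> unit_box" for y
    proof -
      have "norm (g (x - y) - g x) \<le> L * norm y" using lip[of "x - y" x] by simp
      also have "\<dots> \<le> \<bar>L\<bar> * R" using R that by (intro mult_mono) (auto intro: less_imp_le)
      finally show ?thesis .
    qed
  qed
  have ul: "uniform_limit UNIV v g sequentially"
  proof (rule uniform_limitI)
    fix e :: real assume e: "e > 0"
    obtain N where N: "real N > \<bar>L\<bar> * R / e" using reals_Archimedean2 by blast
    have "dist (v m x) (g x) < e" if "m \<ge> N" for m x
    proof -
      let ?t = "real (Suc m)"
      have "v m x - g x = of_real (inverse ?t) * (U (?t *\<^sub>R x) - g (?t *\<^sub>R x))"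
        using hom[of ?t x] by (simp add: v_def right_diff_distrib del: of_nat_Suc)
      then have "norm (v m x - g x) = inverse ?t * norm (U (?t *\<^sub>R x) - g (?t *\<^sub>R x))"
        by (simp add: norm_mult norm_inverse del: of_nat_Suc)
      also have "\<dots> \<le> inverse ?t * (\<bar>L\<bar> * R)" by (intro mult_left_mono Ug) auto
      also have "\<dots> < e"
      proof -
        have "\<bar>L\<bar> * R / e < ?t" using N that by linarith
        then show ?thesis using e by (simp add: field_simps del: of_nat_Suc)
      qed
      finally show ?thesis by (simp add: dist_norm)
    qed
    then show "\<forall>\<^sub>F m in sequentially. \<forall>x\<in>UNIV. dist (v m x) (g x) < e" 
      unfolding eventually_sequentially by blast
  qed
  have bd: "\<exists>C. \<forall>m x. x \<noteq> 0 \<longrightarrow> norm (pd a (pd b (v m)) x) \<le> C * inverse (norm x)" if a: "a \<in> Basis" and b: "b \<in> Basis" for a b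
  proof -
    obtain Cg where Cg: "\<And>x. x \<noteq> 0 \<Longrightarrow> norm (pd a (pd b g) x) \<le> Cg * inverse (norm x)" using pd2_bound_one[OF a b] by blast
    have "bounded (pd a (pd b U) ` cball 0 (2 * R))"
      by (intro compact_imp_bounded compact_continuous_image compact_cball smooth_continuous smooth_pd smU a b)
    then obtain M where M: "\<And>x. x \<in> cball 0 (2 * R) \<Longrightarrow> norm (pd a (pd b U) x) \<le> M" unfolding bounded_iff by blast
    \<comment> \<open>The first entry covers |w| \<le> 2R, where M \<le> M 2R / |w|. The second
      covers |w| > 2R, where |w - y| \<ge> |w|/2 doubles the constant of g.\<close>
    define C where "C = max (\<bar>M\<bar> * (2 * R)) (2 * \<bar>Cg\<bar>)"
    have CU: "norm (pd a (pd b U) w) \<le> C * inverse (norm w)" if w: "w \<noteq> 0" for w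
    proof (cases "norm w \<le> 2 * R")
      case True
      have "norm (pd a (pd b U) w) \<le> \<bar>M\<bar> * 1" using M[of w] True by simp
      also have "\<dots> \<le> \<bar>M\<bar> * ((2 * R) * inverse (norm w))" 
        by (intro mult_left_mono) (use True w in \<open>auto simp: field_simps\<close>)
      also have "\<dots> \<le> C * inverse (norm w)"
        unfolding mult.assoc[symmetric] C_def by (intro mult_right_mono) auto
      finally show ?thesis .
    next
      case False
      then have wR: "norm w > R" using R by simp
      have "norm (integral unit_box (\<lambda>y. ?\<rho> y * pd a (pd b g) (w - y)) - 0) \<le> C * inverse (norm w)"
      proof (rule weighted_integral_dist[OF \<rho>(4,2,5) cshift[OF wR a b]])
        fix y :: 'a assume y: "y \<in> unit_box"
        have n: "norm (w - y) \<ge> norm w / 2" using False R(2)[OF y] norm_triangle_sub[of w y] by simp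
        then have "w - y \<noteq> 0" "norm (w - y) > 0" using w by (auto simp: field_simps)
        then have "norm (pd a (pd b g) (w - y)) \<le> \<bar>Cg\<bar> * inverse (norm (w - y))"
          by (intro order_trans[OF Cg] mult_right_mono) auto
        also have "\<dots> \<le> \<bar>Cg\<bar> * inverse (norm w / 2)"
          by (intro mult_left_mono le_imp_inverse_le n) (use w in auto)
        also have "\<dots> = (2 * \<bar>Cg\<bar>) * inverse (norm w)"
          by (simp only: inverse_divide) (simp only: divide_inverse mult_ac)
        also have "\<dots> \<le> C * inverse (norm w)" unfolding C_def by (intro mult_right_mono) auto
        finally show "norm (pd a (pd b g) (w - y) - 0) \<le> C * inverse (norm w)" by simp
      qed
      then show ?thesis using p2[OF wR a b] by simp
    qed
    \<comment> \<open>The factor m + 1 left by two derivatives cancels against the decay of order -1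
      of the second derivatives of U.\<close>
    have "norm (pd a (pd b (v m)) x) \<le> C * inverse (norm x)" if x: "x \<noteq> 0" for m x
    proof -
      have "norm (pd a (pd b (v m)) x) = real (Suc m) * norm (pd a (pd b U) (real (Suc m) *\<^sub>R x))"
        by (simp add: v2[OF b] norm_mult del: of_nat_Suc)
      also have "\<dots> \<le> real (Suc m) * (C * inverse (norm (real (Suc m) *\<^sub>R x)))"
        by (intro mult_left_mono CU) (use x in auto)
      also have "\<dots> = C * inverse (norm x)" by (simp add: field_simps del: of_nat_Suc)
      finally show ?thesis .
    qed
    then show ?thesis by blast
  qed
  have lim: "(\<lambda>m. pd a (pd b (v m)) x) \<longlonglongrightarrow> pd a (pd b g) x" if a: "a \<in> Basis" and b: "b \<in> Basis" and x: "x \<noteq> 0" for a b x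
  proof (rule LIMSEQ_I)
    fix e :: real assume e: "e > 0"
    have "isCont (pd a (pd b g)) x" using c2[OF a b] x by (simp add: continuous_on_eq_continuous_at open_Compl)
    then obtain d where d: "d > 0" "\<And>y. dist y x < d \<Longrightarrow> dist (pd a (pd b g) y) (pd a (pd b g) x) < e / 2"
      unfolding continuous_at_eps_delta using e half_gt_zero by metis
    \<comment> \<open>The first bound puts t x outside the ball of radius R, the second keeps the
      shift y/t shorter than d.\<close>
    obtain N where N: "real N > max (R / norm x) (R / d)" using reals_Archimedean2 by blast
    have "norm (pd a (pd b (v m)) x - pd a (pd b g) x) < e" if m: "m \<ge> N" for m
    proof -
      let ?t = "real (Suc m)"
      have t: "?t > 0" "R / norm x < ?t" "R / d < ?t" using N m by (auto simp del: of_nat_Suc)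
      then have tx: "norm (?t *\<^sub>R x) > R" and td: "R / ?t < d" using x d(1) by (auto simp: field_simps simp del: of_nat_Suc)
      \<comment> \<open>Homogeneity turns the rescaled average over the unit box into an average
        over the shrinking neighbourhood x - y/t.\<close>
      have "of_real ?t * pd a (pd b g) (?t *\<^sub>R x - y) = pd a (pd b g) (x - inverse ?t *\<^sub>R y)" if "y \<in> unit_box" for y
      proof -
        have e1: "?t *\<^sub>R x - y = ?t *\<^sub>R (x - inverse ?t *\<^sub>R y)" by (simp add: scaleR_diff_right del: of_nat_Suc)
        have "?t *\<^sub>R x - y \<noteq> 0" using tx R(2)[OF that] by auto
        then have "x - inverse ?t *\<^sub>R y \<noteq> 0" using e1 by auto
        then show ?thesis unfolding e1 by (rule pd2_hom[OF t(1) _ b])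
      qed
      then have eq: "pd a (pd b (v m)) x = integral unit_box (\<lambda>y. ?\<rho> y * pd a (pd b g) (x - inverse ?t *\<^sub>R y))"
        unfolding v2[OF b] p2[OF tx a b] integral_mult_right[symmetric] 
        by (intro integral_cong) (metis mult.left_commute)
      have near: "dist (x - inverse ?t *\<^sub>R y) x < min d (norm x)" if "y \<in> unit_box" for y
      proof -
        have "dist (x - inverse ?t *\<^sub>R y) x = inverse ?t * norm y" by (simp add: dist_norm del: of_nat_Suc)
        also have "\<dots> < R / ?t" using R(2)[OF that] t(1) by (simp add: field_simps del: of_nat_Suc)
        finally have "dist (x - inverse ?t *\<^sub>R y) x < R / ?t" .
        moreover have "R / ?t < norm x" using t x by (simp add: field_simps del: of_nat_Suc)
        ultimately show ?thesis using td by simp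
      qed
      have "norm (pd a (pd b (v m)) x - pd a (pd b g) x) \<le> e / 2"
        unfolding eq
      proof (rule weighted_integral_dist[OF \<rho>(4,2,5)])
        show "continuous_on unit_box (\<lambda>y. pd a (pd b g) (x - inverse ?t *\<^sub>R y))"
          by (rule continuous_on_compose2[OF c2[OF a b]]) 
            (use near in \<open>force intro!: continuous_intros simp: dist_norm\<close>)+
        show "norm (pd a (pd b g) (x - inverse ?t *\<^sub>R y) - pd a (pd b g) x) \<le> e / 2" if "y \<in> unit_box" for y
          using d(2)[of "x - inverse ?t *\<^sub>R y"] near[OF that] by (simp add: dist_norm)
      qed
      then show ?thesis using e by simp
    qed
    then show "\<exists>N. \<forall>m\<ge>N. norm (pd a (pd b (v m)) x - pd a (pd b g) x) < e" by blast
  qed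
  show ?thesis by (rule that[OF smv ul bd lim])
qed

section \<open>The complex Hessian of a conical function\<close>

lemma hess_expand:
  assumes "\<forall>b\<in>Basis. pd b f differentiable (at z)"
  shows "hess f z j k = (pd (axis j 1) (pd (axis k 1) f) z + \<i> * pd (axis j 1) (pd (axis k \<i>) f) z
     - \<i> * pd (axis j \<i>) (pd (axis k 1) f) z + pd (axis j \<i>) (pd (axis k \<i>) f) z) / 4"
proof -
  have *: "wd \<i> k f = (\<lambda>z. (1/2) * (pd (axis k 1) f z + \<i> * pd (axis k \<i>) f z))"
    by (auto simp: wd_def fun_eq_iff)
  have d: "pd (axis k 1) f differentiable (at z)" "pd (axis k \<i>) f differentiable (at z)"
    "(\<lambda>z. \<i> * pd (axis k \<i>) f z) differentiable (at z)"
    "(\<lambda>z. pd (axis k 1) f z + \<i> * pd (axis k \<i>) f z) differentiable (at z)"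
    by (intro differentiable_add differentiable_mult differentiable_const assms[rule_format] axis_Basis_complex)+
  have "pd b (wd \<i> k f) z = (1/2) * (pd b (pd (axis k 1) f) z + \<i> * pd b (pd (axis k \<i>) f) z)" for b
    unfolding * pd_cmult[OF d(4)] pd_add[OF d(1,3)] pd_cmult[OF d(2)] ..
  moreover have "((1/2) * (p + \<i> * q) + - \<i> * ((1/2) * (r + \<i> * s))) / 2 = (p + \<i> * q - \<i> * r + s) / 4" for p q r s
    by (simp add: complex_eq_iff field_simps)
  ultimately show ?thesis unfolding hess_def wd_def[of "- \<i>"] by (simp only:)
qed

lemma finite_family_bounded:
  fixes B :: "'n::finite \<Rightarrow> 'n \<Rightarrow> real"
  obtains C where "\<And>j k. B j k \<le> C"
proof
  fix j k
  have "B (fst (j, k)) (snd (j, k)) \<le> Max (range (\<lambda>p. B (fst p) (snd p)))" 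
    by (rule Max_ge[OF _ rangeI]) simp
  then show "B j k \<le> Max (range (\<lambda>p. B (fst p) (snd p)))" by simp
qed

text \<open>The index m makes the constant uniform along a sequence; a constant sequence covers a
  single function.\<close>

lemma hess_bound_from_pd:
  fixes f :: "nat \<Rightarrow> complex ^ 'n \<Rightarrow> complex"
  assumes d: "\<And>m b x. b \<in> Basis \<Longrightarrow> x \<noteq> 0 \<Longrightarrow> pd b (f m) differentiable (at x)"
    and B: "\<And>a b. a \<in> Basis \<Longrightarrow> b \<in> Basis \<Longrightarrow> \<exists>C. \<forall>m x. x \<noteq> 0 \<longrightarrow> norm (pd a (pd b (f m)) x) \<le> C * inverse (norm x)"
  shows "\<exists>C. \<forall>m z j k. z \<noteq> 0 \<longrightarrow> norm (hess (f m) z j k) \<le> C * inverse (norm z)"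
proof -
  have "\<exists>C. \<forall>m z. z \<noteq> 0 \<longrightarrow> norm (hess (f m) z j k) \<le> C * inverse (norm z)" for j k
  proof -
    obtain C1 C2 C3 C4 where C: "\<And>m x. x \<noteq> 0 \<Longrightarrow> norm (pd (axis j 1) (pd (axis k 1) (f m)) x) \<le> C1 * inverse (norm x)"
        "\<And>m x. x \<noteq> 0 \<Longrightarrow> norm (pd (axis j 1) (pd (axis k \<i>) (f m)) x) \<le> C2 * inverse (norm x)"
        "\<And>m x. x \<noteq> 0 \<Longrightarrow> norm (pd (axis j \<i>) (pd (axis k 1) (f m)) x) \<le> C3 * inverse (norm x)"
        "\<And>m x. x \<noteq> 0 \<Longrightarrow> norm (pd (axis j \<i>) (pd (axis k \<i>) (f m)) x) \<le> C4 * inverse (norm x)"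
      using B[of "axis j 1" "axis k 1"] B[of "axis j 1" "axis k \<i>"] B[of "axis j \<i>" "axis k 1"] B[of "axis j \<i>" "axis k \<i>"]
      by (simp only: axis_Basis_complex) blast
    have "norm (hess (f m) z j k) \<le> ((C1 + C2 + C3 + C4) / 4) * inverse (norm z)" if z: "z \<noteq> 0" for m z
    proof -
      have t: "norm (p + \<i> * q - \<i> * r + s) \<le> norm p + norm q + norm r + norm s" for p q r s :: complex
      proof -
        have "norm (p + \<i> * q - \<i> * r + s) \<le> norm (p + \<i> * q) + norm (\<i> * r) + norm s"
          by (intro order_trans[OF norm_triangle_ineq] add_right_mono norm_triangle_ineq4)
        also have "\<dots> \<le> norm p + norm (\<i> * q) + norm (\<i> * r) + norm s"
          by (intro add_right_mono norm_triangle_ineq)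
        finally show ?thesis by (simp add: norm_mult)
      qed
      have "norm (hess (f m) z j k) = norm (pd (axis j 1) (pd (axis k 1) (f m)) z + \<i> * pd (axis j 1) (pd (axis k \<i>) (f m)) z
          - \<i> * pd (axis j \<i>) (pd (axis k 1) (f m)) z + pd (axis j \<i>) (pd (axis k \<i>) (f m)) z) / 4"
      proof -
        have "\<forall>b\<in>Basis. pd b (f m) differentiable (at z)" using d z by blast
        from hess_expand[OF this] show ?thesis by (simp only: norm_divide) simp
      qed
      also have "\<dots> \<le> (norm (pd (axis j 1) (pd (axis k 1) (f m)) z) + norm (pd (axis j 1) (pd (axis k \<i>) (f m)) z)
          + norm (pd (axis j \<i>) (pd (axis k 1) (f m)) z) + norm (pd (axis j \<i>) (pd (axis k \<i>) (f m)) z)) / 4"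
        by (intro divide_right_mono t) simp
      also have "\<dots> \<le> (C1 * inverse (norm z) + C2 * inverse (norm z) + C3 * inverse (norm z) + C4 * inverse (norm z)) / 4"
        by (intro divide_right_mono add_mono C z) simp
      finally show ?thesis by (simp add: algebra_simps)
    qed
    then show ?thesis by blast
  qed
  then obtain B where B: "\<And>j k m z. z \<noteq> 0 \<Longrightarrow> norm (hess (f m) z j k) \<le> B j k * inverse (norm z)" by metis
  obtain C where C: "\<And>j k. B j k \<le> C" using finite_family_bounded[of B] by blast
  have "norm (hess (f m) z j k) \<le> C * inverse (norm z)" if "z \<noteq> 0" for m z j k
    by (rule order_trans[OF B[OF that] mult_right_mono[OF C]]) simp
  then show ?thesis by blast
qed

lemma hess_continuous_from_pd:
  assumes d: "\<And>b x. b \<in> Basis \<Longrightarrow> x \<noteq> 0 \<Longrightarrow> pd b f differentiable (at x)"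
    and c: "\<And>a b. a \<in> Basis \<Longrightarrow> b \<in> Basis \<Longrightarrow> continuous_on (- {0}) (pd a (pd b f))"
  shows "continuous_on (- {0}) (\<lambda>z. hess f z j k)"
proof -
  have "continuous_on (- {0}) (\<lambda>z. (pd (axis j 1) (pd (axis k 1) f) z + \<i> * pd (axis j 1) (pd (axis k \<i>) f) z
     - \<i> * pd (axis j \<i>) (pd (axis k 1) f) z + pd (axis j \<i>) (pd (axis k \<i>) f) z) / 4)"
    by (intro continuous_intros c axis_Basis_complex) auto
  then show ?thesis by (rule continuous_on_eq) (subst hess_expand; use d in simp)
qed

lemma conical_mild:
  fixes g :: "complex ^ 'n \<Rightarrow> complex"
  assumes "conical g L"
  shows "mild g"
proof -
  interpret conical g L by fact
  have "continuous_on (- {0}) (\<lambda>z. hess g z j k)" for j k by (rule hess_continuous_from_pd[OF d2 c2])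
  \<comment> \<open>The value at the origin may be arbitrary: continuity off a countable set
    suffices for Borel measurability.\<close>
  then have "(\<lambda>z. hess g z j k) \<in> borel_measurable borel" for j k
    by (intro borel_measurable_continuous_countable_exceptions[of "{0}"]) auto
  moreover have "\<exists>C. \<forall>m::nat. \<forall>z j k. z \<noteq> 0 \<longrightarrow> norm (hess g z j k) \<le> C * inverse (norm z)"
    by (rule hess_bound_from_pd[of "\<lambda>_. g", OF d2]) (use pd2_bound_one in auto)
  ultimately show ?thesis using continuous by (auto simp: mild_def)
qed

lemma conical_smoothly_approximable:
  fixes g :: "complex ^ 'n \<Rightarrow> complex"
  assumes "conical g L"
  shows "smoothly_approximable g"
proof -
  interpret conical g L by fact
  obtain v where v: "\<And>m::nat. smooth_on (v m) UNIV" "uniform_limit UNIV v g sequentially"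
    "\<And>a b. a \<in> Basis \<Longrightarrow> b \<in> Basis \<Longrightarrow> \<exists>C. \<forall>m x. x \<noteq> 0 \<longrightarrow> norm (pd a (pd b (v m)) x) \<le> C * inverse (norm x)"
    "\<And>a b x. a \<in> Basis \<Longrightarrow> b \<in> Basis \<Longrightarrow> x \<noteq> 0 \<Longrightarrow> (\<lambda>m. pd a (pd b (v m)) x) \<longlonglongrightarrow> pd a (pd b g) x"
    using smooth_approximation by blast
  have dv: "pd b (v m) differentiable (at x)" if "b \<in> Basis" for b m x
    by (intro smooth_differentiable smooth_pd v that)
  have "\<exists>C. \<forall>m z j k. z \<noteq> 0 \<longrightarrow> norm (hess (v m) z j k) \<le> C * inverse (norm z)"
    by (rule hess_bound_from_pd[OF dv v(3)])
  moreover have "(\<lambda>m. hess (v m) z j k) \<longlonglongrightarrow> hess g z j k" if z: "z \<noteq> 0" for z j k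
  proof -
    have d: "\<forall>b\<in>Basis. pd b (v m) differentiable (at z)" "\<forall>b\<in>Basis. pd b g differentiable (at z)" for m
      using dv d2 z by blast+
    show ?thesis unfolding hess_expand[OF d(1)] hess_expand[OF d(2)] by (intro tendsto_intros v(4) axis_Basis_complex z) auto
  qed
  moreover have "uniform_limit K v g sequentially" for K using uniform_limit_on_subset[OF v(2)] by blast
  ultimately show ?thesis unfolding smoothly_approximable_def using v(1) by blast
qed

section \<open>Support functions\<close>

text \<open>Turns \<open>support_fun\<close> into the support function for the real inner
  product.\<close>

lemma Re_herm: "Re (herm z v) = z \<bullet> v"
  by (simp add: herm_def inner_vec_def inner_complex_def)

lemma support_fun_attained:
  assumes "convex_body A"
  obtains v where "v \<in> A" "support_fun A z = z \<bullet> v" 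
proof -
  have "\<exists>v\<in>A. \<forall>w\<in>A. z \<bullet> w \<le> z \<bullet> v"
    using assms by (intro continuous_attains_sup continuous_intros) (auto simp: convex_body_def)
  then obtain v where v: "v \<in> A" "\<And>w. w \<in> A \<Longrightarrow> z \<bullet> w \<le> z \<bullet> v" by blast
  have "support_fun A z = z \<bullet> v" unfolding support_fun_def Re_herm
    by (rule cSup_eq_maximum) (use v in auto)
  then show ?thesis using that v by blast
qed

lemma support_fun_ge:
  assumes "convex_body A" "w \<in> A"
  shows "z \<bullet> w \<le> support_fun A z"
proof -
  have "bdd_above ((\<lambda>v. z \<bullet> v) ` A)"
    using assms by (intro bounded_imp_bdd_above compact_imp_bounded compact_continuous_image continuous_intros) (auto simp: convex_body_def)
  then show ?thesis unfolding support_fun_def Re_herm by (rule cSUP_upper[OF assms(2)])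
qed

lemma support_fun_hom:
  assumes A: "convex_body A" and t: "t > 0"
  shows "support_fun A (t *\<^sub>R z) = t * support_fun A z"
proof -
  obtain v where v: "v \<in> A" "support_fun A z = z \<bullet> v" using support_fun_attained[OF A] .
  obtain w where w: "w \<in> A" "support_fun A (t *\<^sub>R z) = (t *\<^sub>R z) \<bullet> w" using support_fun_attained[OF A] .
  have "t * (z \<bullet> w) \<le> t * support_fun A z" by (intro mult_left_mono support_fun_ge A w) (use t in simp)
  moreover have "t * (z \<bullet> v) \<le> support_fun A (t *\<^sub>R z)" using support_fun_ge[OF A v(1), of "t *\<^sub>R z"] by simp
  ultimately show ?thesis using v w by (intro antisym) simp_all
qed

lemma support_fun_lipschitz:
  assumes A: "convex_body A"
  shows "\<exists>L. \<forall>x y. \<bar>support_fun A x - support_fun A y\<bar> \<le> L * norm (x - y)"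
proof -
  obtain L where L: "\<And>v. v \<in> A \<Longrightarrow> norm v \<le> L" 
  proof -
    have "bounded A" using A compact_imp_bounded[of A] by (simp add: convex_body_def)
    then show ?thesis using that unfolding bounded_iff by blast
  qed
  have "support_fun A x - support_fun A y \<le> L * norm (x - y)" for x y
  proof -
    obtain v where v: "v \<in> A" "support_fun A x = x \<bullet> v" using support_fun_attained[OF A] .
    have "support_fun A x - support_fun A y \<le> (x - y) \<bullet> v" using support_fun_ge[OF A v(1), of y] v by (simp add: inner_diff_left)
    also have "\<dots> \<le> norm (x - y) * norm v" by (rule norm_cauchy_schwarz)
    also have "\<dots> \<le> norm (x - y) * L" by (intro mult_left_mono L v) auto
    finally show ?thesis by (simp add: mult.commute)
  qed
  then have "\<bar>support_fun A x - support_fun A y\<bar> \<le> L * norm (x - y)" for x y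
    using norm_minus_commute[of x y] by (metis abs_le_iff minus_diff_eq)
  then show ?thesis by blast
qed

lemma support_fun_convex:
  assumes A: "convex_body A"
  shows "convex_on UNIV (support_fun A)"
proof (rule convex_onI)
  fix t :: real and x y assume t: "0 < t" "t < 1"
  obtain v where v: "v \<in> A" "support_fun A ((1 - t) *\<^sub>R x + t *\<^sub>R y) = ((1 - t) *\<^sub>R x + t *\<^sub>R y) \<bullet> v" using support_fun_attained[OF A] .
  have "(1 - t) * (x \<bullet> v) + t * (y \<bullet> v) \<le> (1 - t) * support_fun A x + t * support_fun A y"
    by (intro add_mono mult_left_mono support_fun_ge A v) (use t in auto)
  then show "support_fun A ((1 - t) *\<^sub>R x + t *\<^sub>R y) \<le> (1 - t) * support_fun A x + t * support_fun A y"
    using v(2) by (simp add: inner_add_left)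
qed simp

lemma C2_support_fun:
  assumes "Ck_on 2 h (- {0})"
  shows "x \<noteq> 0 \<Longrightarrow> h differentiable (at x)" "x \<noteq> 0 \<Longrightarrow> b \<in> Basis \<Longrightarrow> pd b h differentiable (at x)"
    "a \<in> Basis \<Longrightarrow> b \<in> Basis \<Longrightarrow> continuous_on (- {0}) (pd a (pd b h))"
  using assms by (auto simp: numeral_2_eq_2)

lemma support_fun_conical:
  assumes A: "convex_body A" and h: "Ck_on 2 (support_fun A) (- {0})"
  obtains L where "conical (\<lambda>z. complex_of_real (support_fun A z)) L"
proof -
  let ?h = "support_fun A" and ?g = "\<lambda>z. complex_of_real (support_fun A z)"
  note C = C2_support_fun[OF h]
  obtain L where L: "\<And>x y. \<bar>?h x - ?h y\<bar> \<le> L * norm (x - y)" using support_fun_lipschitz[OF A] by blast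
  have op: "open (- {0::complex ^ 'a})" by auto
  have d: "(\<lambda>z. complex_of_real (f z)) differentiable (at x)" if "f differentiable (at x)" for f and x :: "complex ^ 'a"
    by (rule differentiableI[OF bounded_linear.has_derivative[OF bounded_linear_of_real pd_has_derivative[OF that]]])
  have p1: "pd b ?g x = of_real (pd b ?h x)" if "x \<noteq> 0" for b x
    by (rule pd_linear[OF bounded_linear_of_real C(1)[OF that]])
  have p2: "pd a (pd b ?g) x = of_real (pd a (pd b ?h) x)" if "x \<noteq> 0" "b \<in> Basis" for a b x
  proof -
    have "pd a (pd b ?g) x = pd a (\<lambda>x. of_real (pd b ?h x)) x"
      by (rule pd_eq_on_open[OF op]) (use that p1 in auto)
    then show ?thesis using pd_linear[OF bounded_linear_of_real C(2)[OF that]] by simp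
  qed
  have "conical ?g L"
  proof
    show "norm (?g x - ?g y) \<le> L * norm (x - y)" for x y using L[of x y] by (simp flip: of_real_diff)
    show "?g (t *\<^sub>R x) = of_real t * ?g x" if "t > 0" for t x using support_fun_hom[OF A that] by simp
    show "?g differentiable (at x)" if "x \<noteq> 0" for x by (rule d[OF C(1)[OF that]])
    show "pd b ?g differentiable (at x)" if "x \<noteq> 0" "b \<in> Basis" for b x
      by (rule differentiable_eq_on_open[OF op _ _ d[OF C(2)[OF that]]]) (use p1 that in auto)
    show "continuous_on (- {0}) (pd a (pd b ?g))" if "a \<in> Basis" "b \<in> Basis" for a b
    proof -
      have "continuous_on (- {0}) (\<lambda>x. complex_of_real (pd a (pd b ?h) x))" by (intro continuous_intros C that)
      then show ?thesis by (rule continuous_on_eq) (use p2 that in auto)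
    qed
  qed
  then show ?thesis using that by blast
qed

section \<open>The top coefficient of a wedge product\<close>

text \<open>The constant 0-form 1.\<close>

definition unit_arr :: "'n arr" where
  "unit_arr I J = (if I = {} \<and> J = {} then 1 else 0)"

abbreviation efws :: "'i list \<Rightarrow> ('i \<Rightarrow> 'n::{finite,linorder}) \<Rightarrow> ('i \<Rightarrow> 'n) \<Rightarrow> 'n arr \<Rightarrow> 'n arr" where
  "efws ls \<sigma> \<tau> \<equiv> fold (\<lambda>l. efw (\<sigma> l) (\<tau> l)) ls"

lemma efws_sum: "efws ls \<sigma> \<tau> (\<lambda>I J. \<Sum>s\<in>S. c s * a s I J) I J = (\<Sum>s\<in>S. c s * efws ls \<sigma> \<tau> (a s) I J)"
proof (induction ls arbitrary: a)
  case (Cons l ls)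
  have "efw (\<sigma> l) (\<tau> l) (\<lambda>I J. \<Sum>s\<in>S. c s * a s I J) = (\<lambda>I J. \<Sum>s\<in>S. c s * efw (\<sigma> l) (\<tau> l) (a s) I J)"
    by (intro ext) (simp only: efw_sum efw_cmult)
  then show ?case by (simp only: fold_Cons o_apply Cons.IH)
qed simp

lemma efws_minus: "efws ls \<sigma> \<tau> (\<lambda>I J. - a I J) I J = - efws ls \<sigma> \<tau> a I J"
  using efws_sum[where c="\<lambda>_. -1" and a="\<lambda>_. a" and S="{()}"] by simp

lemma sum_PiE_insert:
  assumes "x \<notin> S"
  shows "(\<Sum>\<sigma>\<in>PiE (insert x S) (\<lambda>_. UNIV). F \<sigma>) = (\<Sum>j\<in>UNIV. \<Sum>\<sigma>\<in>PiE S (\<lambda>_. UNIV). F (\<sigma>(x := j)))"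
  unfolding PiE_insert_eq 
  by (subst sum.reindex[OF inj_combinator[OF assms]]) (simp add: sum.cartesian_product split_def)

text \<open>Multilinear expansion: each factor l contributes an independent choice of \<sigma> l and
  \<tau> l. With extensional functions on \<open>set ls\<close>, adding an index splits off exactly
  one summation variable for each of \<sigma> and \<tau>.\<close>

lemma wedge11_fold_expand:
  fixes a :: "'n::{finite,linorder} arr"
  assumes "distinct ls"
  shows "fold (\<lambda>l. wedge11 (M l)) ls a I J = (2 * \<i>) ^ length ls * 
    (\<Sum>\<sigma>\<in>PiE (set ls) (\<lambda>_. UNIV). \<Sum>\<tau>\<in>PiE (set ls) (\<lambda>_. UNIV). 
       (\<Prod>l\<in>set ls. M l (\<sigma> l) (\<tau> l)) * efws ls \<sigma> \<tau> a I J)"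
  using assms
proof (induction ls arbitrary: a)
  case (Cons l ls)
  let ?P = "PiE (set ls) (\<lambda>_. UNIV :: 'n set)"
  have l: "l \<notin> set ls" using Cons.prems by simp
  let ?a = "wedge11 (M l) a"
  have a: "?a = (\<lambda>I J. \<Sum>p\<in>UNIV. (2 * \<i> * M l (fst p) (snd p)) * efw (fst p) (snd p) a I J)"
    by (intro ext) (simp add: wedge11_def sum_distrib_left sum.cartesian_product split_def mult_ac)
  have upd: "(\<Prod>x\<in>set (l # ls). M x ((\<sigma>(l := j)) x) ((\<tau>(l := k)) x)) = M l j k * (\<Prod>x\<in>set ls. M x (\<sigma> x) (\<tau> x))"
    "efws (l # ls) (\<sigma>(l := j)) (\<tau>(l := k)) a I J = efws ls \<sigma> \<tau> (efw j k a) I J" for \<sigma> \<tau> j k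
  proof -
    have "(\<Prod>x\<in>set ls. M x ((\<sigma>(l := j)) x) ((\<tau>(l := k)) x)) = (\<Prod>x\<in>set ls. M x (\<sigma> x) (\<tau> x))"
      by (rule prod.cong) (use l in auto)
    then show "(\<Prod>x\<in>set (l # ls). M x ((\<sigma>(l := j)) x) ((\<tau>(l := k)) x)) = M l j k * (\<Prod>x\<in>set ls. M x (\<sigma> x) (\<tau> x))"
      using l by simp
    have "efws ls (\<sigma>(l := j)) (\<tau>(l := k)) = efws ls \<sigma> \<tau>"
      by (rule ext, rule List.fold_cong) (use l in auto)
    then show "efws (l # ls) (\<sigma>(l := j)) (\<tau>(l := k)) a I J = efws ls \<sigma> \<tau> (efw j k a) I J" by simp
  qed
  have "fold (\<lambda>l. wedge11 (M l)) (l # ls) a I J = fold (\<lambda>l. wedge11 (M l)) ls ?a I J" by simp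
  also have "\<dots> = (2 * \<i>) ^ length ls * (\<Sum>\<sigma>\<in>?P. \<Sum>\<tau>\<in>?P. (\<Prod>x\<in>set ls. M x (\<sigma> x) (\<tau> x)) * efws ls \<sigma> \<tau> ?a I J)"
    by (rule Cons.IH) (use Cons.prems in simp)
  also have "\<dots> = (2 * \<i>) ^ length ls * (\<Sum>\<sigma>\<in>?P. \<Sum>\<tau>\<in>?P. \<Sum>p\<in>UNIV. 
      2 * \<i> * ((M l (fst p) (snd p) * (\<Prod>x\<in>set ls. M x (\<sigma> x) (\<tau> x))) * efws ls \<sigma> \<tau> (efw (fst p) (snd p) a) I J))"
    unfolding a efws_sum sum_distrib_left by (intro sum.cong refl) (simp only: mult_ac)
  also have "\<dots> = (2 * \<i>) ^ length (l # ls) * (\<Sum>\<sigma>\<in>?P. \<Sum>\<tau>\<in>?P. \<Sum>p\<in>UNIV. 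
      (M l (fst p) (snd p) * (\<Prod>x\<in>set ls. M x (\<sigma> x) (\<tau> x))) * efws ls \<sigma> \<tau> (efw (fst p) (snd p) a) I J)"
    (is "_ = ?c * ?S")
    by (simp only: sum_distrib_left[symmetric] length_Cons power_Suc mult_ac)
  also have "?S = (\<Sum>j\<in>UNIV. \<Sum>\<sigma>\<in>?P. \<Sum>k\<in>UNIV. \<Sum>\<tau>\<in>?P. 
      (M l j k * (\<Prod>x\<in>set ls. M x (\<sigma> x) (\<tau> x))) * efws ls \<sigma> \<tau> (efw j k a) I J)"
  proof -
    have "(\<Sum>\<sigma>\<in>?P. \<Sum>\<tau>\<in>?P. \<Sum>p\<in>UNIV. G (fst p) (snd p) \<sigma> \<tau>) = (\<Sum>j\<in>UNIV. \<Sum>\<sigma>\<in>?P. \<Sum>k\<in>UNIV. \<Sum>\<tau>\<in>?P. G j k \<sigma> \<tau>)" 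
      for G :: "'n \<Rightarrow> 'n \<Rightarrow> _ \<Rightarrow> _ \<Rightarrow> complex"
      by (simp only: sum.cartesian_product split_def UNIV_Times_UNIV[symmetric])
        (rule sum.reindex_bij_witness[of _ "\<lambda>(j,\<sigma>,k,\<tau>). (\<sigma>,\<tau>,(j,k))" "\<lambda>(\<sigma>,\<tau>,(j,k)). (j,\<sigma>,k,\<tau>)"]; auto)
    from this[of "\<lambda>j k \<sigma> \<tau>. (M l j k * (\<Prod>x\<in>set ls. M x (\<sigma> x) (\<tau> x))) * efws ls \<sigma> \<tau> (efw j k a) I J"]
    show ?thesis .
  qed
  also have "\<dots> = (\<Sum>\<sigma>\<in>PiE (set (l # ls)) (\<lambda>_. UNIV). \<Sum>\<tau>\<in>PiE (set (l # ls)) (\<lambda>_. UNIV). 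
       (\<Prod>x\<in>set (l # ls). M x (\<sigma> x) (\<tau> x)) * efws (l # ls) \<sigma> \<tau> a I J)"
    unfolding list.set(2) sum_PiE_insert[OF l] upd[unfolded list.set(2)] ..
  finally show ?case .
qed simp

text \<open>All \<open>efw\<close> factors commute, so those of p and q can be brought to the front,
  where \<open>efw_efw_left\<close> or \<open>efw_efw_right\<close> gives the sign.\<close>

lemma efws_swap:
  fixes \<sigma> \<tau> :: "'n::{finite,linorder} \<Rightarrow> 'n"
  assumes "distinct ls" "set ls = UNIV" "p \<noteq> q"
  shows "efws ls (\<sigma> \<circ> Transposition.transpose p q) \<tau> a I J = - efws ls \<sigma> \<tau> a I J"
    and "efws ls \<sigma> (\<tau> \<circ> Transposition.transpose p q) a I J = - efws ls \<sigma> \<tau> a I J"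
proof -
  let ?t = "Transposition.transpose p q"
  define rest where "rest = filter (\<lambda>x. x \<noteq> p \<and> x \<noteq> q) ls"
  have "mset ls = mset (p # q # rest)"
    by (rule set_eq_iff_mset_eq_distinct[THEN iffD1]) (use assms in \<open>auto simp: rest_def\<close>)
  then have perm: "efws ls \<sigma> \<tau> = efws (p # q # rest) \<sigma> \<tau>" for \<sigma> \<tau> :: "'n \<Rightarrow> 'n"
    by (intro fold_multiset_equiv) (auto simp: efw_commute fun_eq_iff)
  have r: "efws rest (\<sigma> \<circ> ?t) \<tau> = efws rest \<sigma> \<tau>" "efws rest \<sigma> (\<tau> \<circ> ?t) = efws rest \<sigma> \<tau>"
    by (rule ext, rule List.fold_cong; auto simp: rest_def Transposition.transpose_def)+
  have 1: "efw (\<sigma> p) (\<tau> q) (efw (\<sigma> q) (\<tau> p) a) = (\<lambda>I J. - efw (\<sigma> q) (\<tau> q) (efw (\<sigma> p) (\<tau> p) a) I J)"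
    by (intro ext) (rule efw_efw_left)
  have 2: "efw (\<sigma> q) (\<tau> p) (efw (\<sigma> p) (\<tau> q) a) = (\<lambda>I J. - efw (\<sigma> q) (\<tau> q) (efw (\<sigma> p) (\<tau> p) a) I J)"
    by (intro ext) (rule efw_efw_right)
  have t: "(\<rho> \<circ> ?t) p = \<rho> q" "(\<rho> \<circ> ?t) q = \<rho> p" for \<rho> :: "'n \<Rightarrow> 'n" by simp_all
  show "efws ls (\<sigma> \<circ> ?t) \<tau> a I J = - efws ls \<sigma> \<tau> a I J"
    by (simp only: perm fold_simps r 1 t efws_minus)
  show "efws ls \<sigma> (\<tau> \<circ> ?t) a I J = - efws ls \<sigma> \<tau> a I J"
    by (simp only: perm fold_simps r 2 t efws_minus)
qed

lemma not_permutes_UNIV_obtain: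
  fixes \<sigma> :: "'n::finite \<Rightarrow> 'n"
  assumes "\<not> \<sigma> permutes UNIV"
  obtains p q where "p \<noteq> q" "\<sigma> \<circ> Transposition.transpose p q = \<sigma>"
proof -
  have "\<not> inj \<sigma>" using assms finite_UNIV_inj_surj[of \<sigma>] bij_imp_permutes[of \<sigma> UNIV] by (auto simp: bij_def)
  then obtain p q where "p \<noteq> q" "\<sigma> p = \<sigma> q" by (auto simp: inj_def)
  then show ?thesis using that[of p q] by (auto simp: fun_eq_iff Transposition.transpose_def)
qed

text \<open>A permutation is a product of transpositions, each flipping the sign. A map that is not
  injective is fixed by some transposition, so its value equals its own negative.\<close>

lemma alternating_permutes:
  fixes X :: "('n::finite \<Rightarrow> 'n) \<Rightarrow> complex"
  assumes X: "\<And>\<sigma> p q. p \<noteq> q \<Longrightarrow> X (\<sigma> \<circ> Transposition.transpose p q) = - X \<sigma>"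
  shows "\<sigma> permutes UNIV \<Longrightarrow> X \<sigma> = of_int (sign \<sigma>) * X id" and "\<not> \<sigma> permutes UNIV \<Longrightarrow> X \<sigma> = 0"
proof -
  show "X \<sigma> = of_int (sign \<sigma>) * X id" if "\<sigma> permutes UNIV"
    using finite[of "UNIV::'n set"] that
  proof (induction rule: permutes_rev_induct)
    case (swap a b p)
    then have "sign (p \<circ> Transposition.transpose a b) = - sign p"
      by (simp add: sign_compose permutation_swap_id permutes_imp_permutation[OF finite] sign_swap_id)
    moreover have "X (p \<circ> Transposition.transpose a b) = - X p" by (rule X) fact
    moreover have "X p = of_int (sign p) * X id" by fact
    ultimately show ?case by (simp only: of_int_minus mult_minus_left)
  qed simp
  show "X \<sigma> = 0" if n: "\<not> \<sigma> permutes UNIV"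
  proof -
    obtain p q where "p \<noteq> q" "\<sigma> \<circ> Transposition.transpose p q = \<sigma>" using not_permutes_UNIV_obtain[OF n] .
    then have "X \<sigma> = - X \<sigma>" using X[of p q \<sigma>] by simp
    then show ?thesis by simp
  qed
qed

text \<open>Appending the largest index l to k smaller ones moves dz_l past k factors, while d
  zbar_l contributes (-1)^(2k) = 1. The exponents 0 + 1 + ... + (n - 1) add up to n(n -
  1)/2.\<close>

lemma efws_id_sorted:
  fixes ls :: "'n::{finite,linorder} list"
  assumes "sorted_wrt (<) ls"
  shows "efws ls id id unit_arr I J = (if I = set ls \<and> J = set ls then (-1) ^ (length ls * (length ls - 1) div 2) else 0)"
  using assms
proof (induction ls arbitrary: I J rule: rev_induct)
  case Nil
  then show ?case by (simp add: unit_arr_def)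
next
  case (snoc l ls)
  let ?k = "length ls"
  have less: "\<And>x. x \<in> set ls \<Longrightarrow> x < l" and so: "sorted_wrt (<) ls" using snoc.prems by (auto simp: sorted_wrt_append)
  have d: "distinct ls" using so by (simp add: strict_sorted_iff)
  then have card: "card (set ls) = ?k" by (rule distinct_card)
  have l: "l \<notin> set ls" using less by blast
  have IH: "efws ls id id unit_arr = (\<lambda>I J. if I = set ls \<and> J = set ls then (-1) ^ (?k * (?k - 1) div 2) else 0)"
    by (intro ext snoc.IH so)
  have step: "efws (ls @ [l]) id id unit_arr I J = efw l l (\<lambda>I J. if I = set ls \<and> J = set ls then (-1) ^ (?k * (?k - 1) div 2) else 0) I J"
  proof -
    have "efws (ls @ [l]) id id unit_arr = efw l l (efws ls id id unit_arr)" by simp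
    then show ?thesis unfolding IH by simp
  qed
  have "efw l l (\<lambda>I J. if I = set ls \<and> J = set ls then (-1) ^ (?k * (?k - 1) div 2) else 0) I J = 
    (if I = set (ls @ [l]) \<and> J = set (ls @ [l]) then (-1) ^ (length (ls @ [l]) * (length (ls @ [l]) - 1) div 2) else 0)"
  proof (cases "I = insert l (set ls) \<and> J = insert l (set ls)")
    case True
    have e: "{i \<in> I. i < l} = set ls" "{i \<in> J. i < l} = set ls" "I - {l} = set ls" "J - {l} = set ls" "l \<in> I" "l \<in> J" 
      using True less l by auto
    have "?k * (?k - 1) div 2 + ?k = Suc ?k * (Suc ?k - 1) div 2"
    proof -
      have "Suc ?k * (Suc ?k - 1) = ?k * (?k - 1) + 2 * ?k" by (cases ?k) (auto simp: algebra_simps)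
      then show ?thesis by simp
    qed
    then have p: "(-1::complex) ^ ?k * (-1) ^ (?k * (?k - 1) div 2) = (-1) ^ (Suc ?k * (Suc ?k - 1) div 2)"
      by (metis add.commute power_add)
    have m: "(-1::complex) ^ (?k + ?k) = 1" by (simp add: mult_2[symmetric])
    have "efw l l (\<lambda>I J. if I = set ls \<and> J = set ls then (-1) ^ (?k * (?k - 1) div 2) else 0) I J = 
       (-1) ^ ?k * ((-1) ^ (?k + ?k) * (-1) ^ (?k * (?k - 1) div 2))"
      unfolding efw_def ew_def fw_def e card using e(5,6) by simp
    also have "\<dots> = (-1) ^ (Suc ?k * (Suc ?k - 1) div 2)" unfolding m mult_1_left p ..
    finally show ?thesis using True by simp
  next
    case False
    have "\<not> (l \<in> I \<and> l \<in> J \<and> I - {l} = set ls \<and> J - {l} = set ls)" using False by blast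
    then have "efw l l (\<lambda>I J. if I = set ls \<and> J = set ls then (-1) ^ (?k * (?k - 1) div 2) else 0) I J = 0"
      unfolding efw_def ew_def fw_def by auto
    moreover have "\<not> (I = set (ls @ [l]) \<and> J = set (ls @ [l]))" using False by simp
    ultimately show ?thesis by (simp only: if_False)
  qed
  from trans[OF step this] show ?case .
qed

text \<open>Alternation holds in \<sigma> and in \<tau> separately, which reduces every value to the
  identity pair.\<close>

lemma efws_top:
  fixes \<sigma> \<tau> :: "'n::{finite,linorder} \<Rightarrow> 'n"
  defines "ls \<equiv> sorted_list_of_set (UNIV :: 'n set)"
  shows "efws ls \<sigma> \<tau> unit_arr UNIV UNIV = (if \<sigma> permutes UNIV \<and> \<tau> permutes UNIV
     then of_int (sign (\<sigma> \<circ> \<tau>)) * (-1) ^ (CARD('n) * (CARD('n) - 1) div 2) else 0)"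
proof -
  have ls: "distinct ls" "set ls = UNIV" "sorted_wrt (<) ls" "length ls = CARD('n)" by (auto simp: ls_def)
  note A = alternating_permutes[where X="\<lambda>\<sigma>. efws ls \<sigma> \<tau> unit_arr UNIV UNIV" for \<tau>, OF efws_swap(1)[OF ls(1,2)]]
  note B = alternating_permutes[where X="\<lambda>\<tau>. efws ls id \<tau> unit_arr UNIV UNIV", OF efws_swap(2)[OF ls(1,2)]]
  have "efws ls id id unit_arr UNIV UNIV = (-1) ^ (CARD('n) * (CARD('n) - 1) div 2)"
    using efws_id_sorted[OF ls(3), of UNIV UNIV] ls by simp
  moreover have "sign (\<sigma> \<circ> \<tau>) = sign \<sigma> * sign \<tau>" if "\<sigma> permutes UNIV" "\<tau> permutes UNIV"
    using that by (intro sign_compose permutes_imp_permutation[OF finite])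
  ultimately show ?thesis using A[of \<sigma> \<tau>] B[of \<tau>] by (cases "\<sigma> permutes UNIV"; cases "\<tau> permutes UNIV"; simp)
qed

text \<open>The sign from the orientation and the sign from reordering the wedge product are equal
  and square to 1, while (-2\<i>)^n (2\<i>)^n = 4^n. The factorial undoes the normalisation in
  \<open>mixed_discriminant\<close>.\<close>

lemma wedge_top_coefficient:
  fixes M :: "'n::{finite,linorder} \<Rightarrow> complex ^ 'n::{finite,linorder} ^ 'n::{finite,linorder}"
  shows "(-1) ^ (CARD('n) * (CARD('n) - 1) div 2) * (- 2 * \<i>) ^ CARD('n) * 
    fold (\<lambda>l. wedge11 (\<lambda>j k. M l $ j $ k)) (sorted_list_of_set UNIV) unit_arr UNIV UNIV = 
    4 ^ CARD('n) * fact CARD('n) * mixed_discriminant M"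
proof -
  let ?ls = "sorted_list_of_set (UNIV :: 'n set)" and ?e = "(-1::complex) ^ (CARD('n) * (CARD('n) - 1) div 2)"
  let ?P = "{\<sigma>::'n \<Rightarrow> 'n. \<sigma> permutes UNIV}"
  have "fold (\<lambda>l. wedge11 (\<lambda>j k. M l $ j $ k)) ?ls unit_arr UNIV UNIV = (2 * \<i>) ^ CARD('n) * 
    (\<Sum>\<sigma>\<in>UNIV. \<Sum>\<tau>\<in>UNIV. (\<Prod>l\<in>UNIV. M l $ \<sigma> l $ \<tau> l) * efws ?ls \<sigma> \<tau> unit_arr UNIV UNIV)"
    using wedge11_fold_expand[of ?ls "\<lambda>l j k. M l $ j $ k" unit_arr UNIV UNIV] by (simp add: PiE_UNIV_domain)
  also have "(\<Sum>\<sigma>\<in>UNIV. \<Sum>\<tau>\<in>UNIV. (\<Prod>l\<in>UNIV. M l $ \<sigma> l $ \<tau> l) * efws ?ls \<sigma> \<tau> unit_arr UNIV UNIV)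
     = (\<Sum>\<sigma>\<in>?P. \<Sum>\<tau>\<in>UNIV. (\<Prod>l\<in>UNIV. M l $ \<sigma> l $ \<tau> l) * efws ?ls \<sigma> \<tau> unit_arr UNIV UNIV)"
    by (rule sum.mono_neutral_right) (auto simp: efws_top)
  also have "\<dots> = (\<Sum>\<sigma>\<in>?P. \<Sum>\<tau>\<in>?P. (\<Prod>l\<in>UNIV. M l $ \<sigma> l $ \<tau> l) * efws ?ls \<sigma> \<tau> unit_arr UNIV UNIV)"
    by (intro sum.cong refl sum.mono_neutral_right) (auto simp: efws_top)
  also have "\<dots> = (\<Sum>\<sigma>\<in>?P. \<Sum>\<tau>\<in>?P. ?e * (of_int (sign (\<sigma> \<circ> \<tau>)) * (\<Prod>l\<in>UNIV. M l $ \<sigma> l $ \<tau> l)))"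
    by (intro sum.cong refl) (simp add: efws_top)
  also have "\<dots> = ?e * (fact CARD('n) * mixed_discriminant M)"
    unfolding sum_distrib_left[symmetric] by (simp add: mixed_discriminant_def)
  finally have "fold (\<lambda>l. wedge11 (\<lambda>j k. M l $ j $ k)) ?ls unit_arr UNIV UNIV = 
      (2 * \<i>) ^ CARD('n) * (?e * (fact CARD('n) * mixed_discriminant M))" .
  note f = this
  have p: "(- 2 * \<i>) ^ CARD('n) * (2 * \<i>) ^ CARD('n) = 4 ^ CARD('n)"
    unfolding power_mult_distrib[symmetric] by simp
  have e: "?e * ?e = 1" by (simp add: power_mult_distrib[symmetric])
  have r: "E * A * (B * (E * X)) = (A * B) * (E * E) * X" for E A B X :: complex by (simp add: mult_ac)
  show ?thesis unfolding f r p e by (simp only: mult_1_right mult.assoc)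
qed

section \<open>Mixed discriminants of positive semidefinite matrices\<close>

definition herm_form :: "('n::finite \<Rightarrow> 'n \<Rightarrow> complex) \<Rightarrow> ('n \<Rightarrow> complex) \<Rightarrow> complex" where
  "herm_form M c = (\<Sum>j\<in>UNIV. \<Sum>k\<in>UNIV. c j * cnj (c k) * M j k)"

definition psd :: "('n::finite \<Rightarrow> 'n \<Rightarrow> complex) \<Rightarrow> bool" where
  "psd M \<longleftrightarrow> (\<forall>j k. M k j = cnj (M j k)) \<and> (\<forall>c. 0 \<le> Re (herm_form M c))"

lemma psd_hermitian: "psd M \<Longrightarrow> M a b = cnj (M b a)"
  unfolding psd_def by blast

lemma psd_form_nonneg: "psd M \<Longrightarrow> 0 \<le> Re (herm_form M c)"
  unfolding psd_def by blast

text \<open>The effect of changing one coordinate of the vector; a suitable t completes the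
  square.\<close>

lemma herm_form_shift:
  "herm_form M (\<lambda>x. c x + (if x = j then t else 0)) = herm_form M c + cnj t * (\<Sum>a\<in>UNIV. c a * M a j)
     + t * (\<Sum>b\<in>UNIV. cnj (c b) * M j b) + t * cnj t * M j j"
proof -
  have "(c a + (if a = j then t else 0)) * cnj (c b + (if b = j then t else 0)) * M a b = 
     c a * cnj (c b) * M a b + (if b = j then c a * cnj t * M a b else 0) 
     + (if a = j then t * cnj (c b) * M a b else 0) + (if a = j then (if b = j then t * cnj t * M a b else 0) else 0)" for a b
    by (simp add: algebra_simps)
  then have "herm_form M (\<lambda>x. c x + (if x = j then t else 0)) = herm_form M c 
     + (\<Sum>a\<in>UNIV. \<Sum>b\<in>UNIV. if b = j then c a * cnj t * M a b else 0) 
     + (\<Sum>a\<in>UNIV. \<Sum>b\<in>UNIV. if a = j then t * cnj (c b) * M a b else 0) 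
     + (\<Sum>a\<in>UNIV. \<Sum>b\<in>UNIV. if a = j then (if b = j then t * cnj t * M a b else 0) else 0)"
    unfolding herm_form_def by (simp only: sum.distrib)
  also have "(\<Sum>a\<in>UNIV. \<Sum>b\<in>UNIV. if b = j then c a * cnj t * M a b else 0) = cnj t * (\<Sum>a\<in>UNIV. c a * M a j)"
    by (simp add: sum_distrib_left mult_ac)
  also have "(\<Sum>a\<in>UNIV. \<Sum>b\<in>UNIV. if a = j then t * cnj (c b) * M a b else 0) = t * (\<Sum>b\<in>UNIV. cnj (c b) * M j b)"
    by (subst sum.swap) (simp add: sum_distrib_left mult_ac)
  also have "(\<Sum>a\<in>UNIV. \<Sum>b\<in>UNIV. if a = j then (if b = j then t * cnj t * M a b else 0) else 0) = t * cnj t * M j j"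
    by (subst sum.swap) simp
  finally show ?thesis .
qed

lemma herm_form_axis: "herm_form M (\<lambda>x. if x = j then t else 0) = t * cnj t * M j j"
  using herm_form_shift[of M "\<lambda>_. 0" j t] by (simp add: herm_form_def)

lemma psd_diagonal: 
  assumes "psd M"
  shows "M j j = of_real (Re (M j j))" "0 \<le> Re (M j j)"
proof -
  have "M j j = cnj (M j j)" by (rule psd_hermitian[OF assms])
  then show "M j j = of_real (Re (M j j))" by (simp add: complex_eq_iff)
  show "0 \<le> Re (M j j)" using psd_form_nonneg[OF assms, of "\<lambda>x. if x = j then 1 else 0"] by (simp add: herm_form_axis)
qed

lemma psd_zero_diagonal:
  assumes M: "psd M" and 0: "\<And>j. M j j = 0"
  shows "M a b = 0"
proof (cases "a = b")
  case False
  \<comment> \<open>With zero diagonal, the form at e_b + t e_a becomes -2 |M a b|^2, which must be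
    nonnegative.\<close>
  define t where "t = - cnj (M a b)"
  have "herm_form M (\<lambda>x. (if x = b then 1 else 0) + (if x = a then t else 0)) = cnj t * M b a + t * M a b"
    unfolding herm_form_shift herm_form_axis by (simp add: 0 if_distrib[of cnj] if_distrib[of "\<lambda>x. x * _"] cong: if_cong)
  also have "\<dots> = - 2 * (M a b * cnj (M a b))" by (simp add: t_def psd_hermitian[OF M, of b a] mult.commute)
  finally have "0 \<le> Re (- 2 * (M a b * cnj (M a b)))" using psd_form_nonneg[OF M] by metis
  then have "(cmod (M a b))\<^sup>2 \<le> 0" unfolding complex_norm_square[symmetric] by simp
  then show ?thesis by simp
qed (use 0 in simp)

text \<open>Cholesky elimination: subtracting a rank one matrix built from a column with nonzero
  diagonal entry leaves a positive semidefinite Schur complement with fewer nonzero diagonal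
  entries.\<close>

lemma psd_induct [consumes 1, case_names zero step]:
  fixes M :: "'n::finite \<Rightarrow> 'n \<Rightarrow> complex"
  assumes "psd M" and "Q (\<lambda>_ _. 0)" and step: "\<And>N v. Q N \<Longrightarrow> Q (\<lambda>j k. N j k + v j * cnj (v k))"
  shows "Q M"
  using assms(1)
proof (induction "card {a. M a a \<noteq> 0}" arbitrary: M rule: less_induct)
  case less
  note M = less.prems
  show ?case
  proof (cases "\<exists>j. M j j \<noteq> 0")
    case False
    then have "M = (\<lambda>_ _. 0)" using psd_zero_diagonal[OF M] by (intro ext) auto
    then show ?thesis using assms(2) by simp
  next
    case True
    then obtain j where j: "M j j \<noteq> 0" by blast
    define r where "r = Re (M j j)"
    have Mr: "M j j = of_real r" and r: "r > 0" using psd_diagonal[OF M, of j] j by (auto simp: r_def less_le)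
    define v where "v a = M a j / of_real (sqrt r)" for a
    define N where "N = (\<lambda>a b. M a b - v a * cnj (v b))"
    have MN: "M = (\<lambda>a b. N a b + v a * cnj (v b))" by (simp add: N_def)
    have sq: "complex_of_real (sqrt r) * of_real (sqrt r) = of_real r" using r by (simp flip: of_real_mult)
    have vv: "v a * cnj (v b) = M a j * cnj (M b j) / of_real r" for a b 
      using sq by (simp add: v_def)
    have psdN: "psd N"
      unfolding psd_def
    proof (intro conjI allI)
      show "N k i = cnj (N i k)" for i k by (simp add: N_def psd_hermitian[OF M, of k i] mult.commute)
      fix c
      define S where "S = (\<Sum>a\<in>UNIV. c a * M a j)"
      have cS: "(\<Sum>b\<in>UNIV. cnj (c b) * M j b) = cnj S" 
        unfolding S_def cnj_sum complex_cnj_mult by (intro sum.cong refl) (subst psd_hermitian[OF M, of j], rule refl)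
      have "herm_form N c = herm_form M c - (\<Sum>a\<in>UNIV. \<Sum>b\<in>UNIV. (c a * M a j) * (cnj (c b) * cnj (M b j)) / of_real r)"
        unfolding herm_form_def N_def vv sum_subtractf[symmetric] by (simp add: algebra_simps)
      also have "(\<Sum>a\<in>UNIV. \<Sum>b\<in>UNIV. (c a * M a j) * (cnj (c b) * cnj (M b j)) / of_real r) = S * cnj S / of_real r"
        unfolding S_def cnj_sum complex_cnj_mult sum_product sum_divide_distrib ..
      \<comment> \<open>The form of N at c is the form of M at c with coordinate j shifted by -S/r,
        which inherits nonnegativity.\<close>
      also have "herm_form M c - S * cnj S / of_real r = herm_form M (\<lambda>x. c x + (if x = j then - S / of_real r else 0))"
        unfolding herm_form_shift cS S_def[symmetric] Mr using r by (simp add: field_simps)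
      finally show "0 \<le> Re (herm_form N c)" using psd_form_nonneg[OF M] by simp
    qed
    have "N j j = 0" using vv[of j j] r by (simp add: N_def Mr)
    \<comment> \<open>Such an entry of N equals -|v a|^2 and is nonnegative because N is positive
      semidefinite.\<close>
    moreover have "N a a = 0" if "M a a = 0" for a
    proof -
      have "N a a = - of_real ((cmod (v a))\<^sup>2)" using that by (simp add: N_def complex_norm_square[symmetric])
      then have "Re (N a a) = - (cmod (v a))\<^sup>2" by simp
      then have "Re (N a a) = 0" using psd_diagonal(2)[OF psdN, of a] by (simp add: antisym)
      then show ?thesis using psd_diagonal(1)[OF psdN, of a] by simp
    qed
    ultimately have "{a. N a a \<noteq> 0} \<subset> {a. M a a \<noteq> 0}" using j by blast
    then have "Q N" using psdN by (intro less.hyps psubset_card_mono) auto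
    then show ?thesis using step[of N v] by (subst MN) simp
  qed
qed

text \<open>\<open>mixed_discriminant\<close> before division by n!, with matrices as functions so
  that one slot can be replaced by a function update.\<close>

definition disc :: "('n::finite \<Rightarrow> 'n \<Rightarrow> 'n \<Rightarrow> complex) \<Rightarrow> complex" where
  "disc M = (\<Sum>\<sigma> | \<sigma> permutes UNIV. \<Sum>\<tau> | \<tau> permutes UNIV.
        of_int (sign (\<sigma> \<circ> \<tau>)) * (\<Prod>l\<in>UNIV. M l (\<sigma> l) (\<tau> l)))"

lemma prod_fun_upd:
  fixes M :: "'n::finite \<Rightarrow> 'n \<Rightarrow> 'n \<Rightarrow> complex"
  shows "(\<Prod>x\<in>UNIV. (M(l := N)) x (\<sigma> x) (\<tau> x)) = N (\<sigma> l) (\<tau> l) * (\<Prod>x\<in>UNIV - {l}. M x (\<sigma> x) (\<tau> x))"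
  by (subst prod.remove[of _ l]) (auto intro!: prod.cong)

lemma disc_upd_add: "disc (M(l := (\<lambda>j k. N j k + P j k))) = disc (M(l := N)) + disc (M(l := P))"
  unfolding disc_def prod_fun_upd by (simp add: algebra_simps sum.distrib)

lemma disc_upd_zero: "disc (M(l := (\<lambda>_ _. 0))) = 0"
  unfolding disc_def prod_fun_upd by simp

text \<open>The double sum factors as s times its conjugate, where s is the determinant of the
  matrix with rows v l.\<close>

lemma disc_rank_one_nonneg:
  fixes v :: "'n::finite \<Rightarrow> 'n \<Rightarrow> complex"
  assumes "\<And>l. M l = (\<lambda>j k. v l j * cnj (v l k))"
  shows "disc M \<in> \<real>\<^sub>\<ge>\<^sub>0"
proof -
  define s where "s = (\<Sum>\<sigma> | \<sigma> permutes UNIV. of_int (sign \<sigma>) * (\<Prod>l\<in>UNIV. v l (\<sigma> l)))"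
  have "sign (\<sigma> \<circ> \<tau>) = sign \<sigma> * sign \<tau>" if "\<sigma> permutes (UNIV::'n set)" "\<tau> permutes UNIV" for \<sigma> \<tau> :: "'n \<Rightarrow> 'n"
    using that by (intro sign_compose permutes_imp_permutation[OF finite])
  then have "disc M = (\<Sum>\<sigma> | \<sigma> permutes UNIV. \<Sum>\<tau> | \<tau> permutes UNIV.
        (of_int (sign \<sigma>) * (\<Prod>l\<in>UNIV. v l (\<sigma> l))) * (of_int (sign \<tau>) * (\<Prod>l\<in>UNIV. cnj (v l (\<tau> l)))))"
    unfolding disc_def assms by (intro sum.cong refl) (simp add: prod.distrib mult_ac)
  also have "\<dots> = s * cnj s" by (simp add: s_def sum_product)
  finally show ?thesis by (simp add: complex_norm_square[symmetric])
qed

text \<open>Induction on the set of slots not yet known to be of rank one: \<open>psd_induct\<close>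
  decomposes the matrix in one slot, and additivity there reduces to fewer general slots.\<close>

lemma disc_psd_nonneg:
  assumes "\<And>l. psd (M l)"
  shows "disc M \<in> \<real>\<^sub>\<ge>\<^sub>0"
proof -
  have "disc M \<in> \<real>\<^sub>\<ge>\<^sub>0" if "finite S" "\<And>l. l \<in> S \<Longrightarrow> psd (M l)" "\<And>l. l \<notin> S \<Longrightarrow> \<exists>v. M l = (\<lambda>j k. v j * cnj (v k))" for S M
    using that
  proof (induction S arbitrary: M rule: finite_induct)
    case empty
    then have "\<forall>l. \<exists>v. M l = (\<lambda>j k. v j * cnj (v k))" by blast
    then obtain v where "\<And>l. M l = (\<lambda>j k. v l j * cnj (v l k))" by metis
    then show ?case by (rule disc_rank_one_nonneg)
  next
    case (insert l S)
    have "disc (M(l := N)) \<in> \<real>\<^sub>\<ge>\<^sub>0" if "psd N" for N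
      using that
    proof (induction rule: psd_induct)
      case zero
      then show ?case by (simp only: disc_upd_zero nonneg_Reals_zero_I)
    next
      case (step N v)
      have "disc (M(l := (\<lambda>j k. v j * cnj (v k)))) \<in> \<real>\<^sub>\<ge>\<^sub>0"
      proof (rule insert.IH)
        show "psd ((M(l := (\<lambda>j k. v j * cnj (v k)))) x)" if "x \<in> S" for x using that insert.hyps insert.prems(1) by auto
        show "\<exists>v'. (M(l := (\<lambda>j k. v j * cnj (v k)))) x = (\<lambda>j k. v' j * cnj (v' k))" if "x \<notin> S" for x
          using that insert.prems(2)[of x] by (cases "x = l") auto
      qed
      then show ?case using step by (simp only: disc_upd_add nonneg_Reals_add_I)
    qed
    from this[OF insert.prems(1)[of l]] show ?case by simp
  qed
  note * = this
  show ?thesis by (rule *[of UNIV M]) (use assms in auto)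
qed

lemma mixed_discriminant_psd_nonneg:
  assumes "\<And>l. psd (\<lambda>j k. M l $ j $ k)"
  shows "mixed_discriminant M \<in> \<real>\<^sub>\<ge>\<^sub>0"
proof -
  have "mixed_discriminant M = disc (\<lambda>l j k. M l $ j $ k) / of_real (fact CARD('a))"
    by (simp add: mixed_discriminant_def disc_def)
  moreover obtain r where "disc (\<lambda>l j k. M l $ j $ k) = of_real r" "r \<ge> 0" 
    using disc_psd_nonneg[of "\<lambda>l j k. M l $ j $ k", OF assms] by (auto elim!: nonneg_Reals_cases)
  ultimately have "mixed_discriminant M = of_real (r / fact CARD('a))" by (simp only: of_real_divide)
  then show ?thesis using \<open>r \<ge> 0\<close> by (simp only: nonneg_Reals_of_real_iff) simp
qed

section \<open>The complex Hessian of a convex function\<close>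

lemma sum_Basis_vec_complex:
  "(\<Sum>b\<in>(Basis::(complex ^ 'n) set). F b) = (\<Sum>j\<in>UNIV. F (axis j 1) + F (axis j \<i>))"
proof -
  have B: "(Basis::(complex ^ 'n) set) = (\<lambda>(j, u). axis j u) ` (UNIV \<times> {1, \<i>})"
    by (auto simp: Basis_vec_def Basis_complex_def image_iff)
  have "inj_on (\<lambda>(j, u). axis j u :: complex ^ 'n) (UNIV \<times> {1, \<i>})"
    by (auto simp: inj_on_def axis_eq_axis)
  then have "(\<Sum>b\<in>(Basis::(complex ^ 'n) set). F b) = (\<Sum>(j, u)\<in>UNIV \<times> {1, \<i>}. F (axis j u))"
    unfolding B by (subst sum.reindex) (auto simp: split_def)
  also have "\<dots> = (\<Sum>j\<in>UNIV. \<Sum>u\<in>{1, \<i>}. F (axis j u))" by (rule sum.cartesian_product[symmetric])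
  also have "\<dots> = (\<Sum>j\<in>UNIV. F (axis j 1) + F (axis j \<i>))" by simp
  finally show ?thesis .
qed

text \<open>On the line through z in direction X, \<psi> is the derivative of the convex function
  \<phi> for small t \<ge> 0, and D is its slope at 0. If D < 0, then \<psi> decreases just after 0,
  against the tangent inequalities at 0 and at t.\<close>

lemma convex_second_derivative_nonneg:
  fixes h :: "'a::euclidean_space \<Rightarrow> real"
  assumes h: "convex_on UNIV h" and S: "open S" "z \<in> S"
    and d1: "\<And>x. x \<in> S \<Longrightarrow> h differentiable (at x)"
    and d2: "\<And>x b. x \<in> S \<Longrightarrow> b \<in> Basis \<Longrightarrow> pd b h differentiable (at x)"
  shows "0 \<le> (\<Sum>b\<in>Basis. \<Sum>a\<in>Basis. (X \<bullet> b) * (X \<bullet> a) * pd a (pd b h) z)"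
proof (rule ccontr)
  define \<phi> where "\<phi> t = h (z + t *\<^sub>R X)" for t
  define \<psi> where "\<psi> t = (\<Sum>b\<in>Basis. (X \<bullet> b) * pd b h (z + t *\<^sub>R X))" for t
  define D where "D = (\<Sum>b\<in>Basis. (X \<bullet> b) * pd X (pd b h) z)"
  have DD: "D = (\<Sum>b\<in>Basis. \<Sum>a\<in>Basis. (X \<bullet> b) * (X \<bullet> a) * pd a (pd b h) z)"
    unfolding D_def by (intro sum.cong refl) (simp add: pd_linear_sum[OF d2[OF S(2)], of _ X] sum_distrib_left mult.assoc)
  assume "\<not> 0 \<le> (\<Sum>b\<in>Basis. \<Sum>a\<in>Basis. (X \<bullet> b) * (X \<bullet> a) * pd a (pd b h) z)"
  then have D: "D < 0" using DD by simp
  obtain r where r: "r > 0" "ball z r \<subseteq> S" using S by (meson open_contains_ball)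
  define e where "e = r / (norm X + 1)"
  have np: "norm X + 1 > 0" by (simp add: add_nonneg_pos)
  have e: "e > 0" unfolding e_def using r np by simp
  have inS: "z + t *\<^sub>R X \<in> S" if "0 \<le> t" "t < e" for t
  proof -
    have "t * norm X \<le> t * (norm X + 1)" using that by (intro mult_left_mono) auto
    also have "\<dots> < r" using that np by (simp add: e_def pos_less_divide_eq)
    finally have "z + t *\<^sub>R X \<in> ball z r" using that by (simp add: dist_norm)
    then show ?thesis using r by blast
  qed
  have \<phi>': "(\<phi> has_real_derivative \<psi> t) (at t)" if "0 \<le> t" "t < e" for t
    unfolding \<phi>_def[abs_def] \<psi>_def using pd_has_vector_derivative_line[OF d1[OF inS[OF that]]] pd_linear_sum[OF d1[OF inS[OF that]], of X]
    by (simp add: has_real_derivative_iff_has_vector_derivative)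
  have "((\<lambda>t. pd b h (z + t *\<^sub>R X)) has_real_derivative pd X (pd b h) z) (at 0)" if "b \<in> Basis" for b
    using pd_has_vector_derivative_line[of "pd b h" z 0 X] d2[OF S(2) that]
    by (simp add: has_real_derivative_iff_has_vector_derivative)
  then have "(\<psi> has_real_derivative D) (at 0)"
    unfolding \<psi>_def[abs_def] D_def by (intro DERIV_sum DERIV_cmult)
  from DERIV_neg_dec_right[OF this D] obtain d where d: "d > 0" "\<And>t. 0 < t \<Longrightarrow> t < d \<Longrightarrow> \<psi> t < \<psi> 0" by auto
  define t where "t = min d e / 2"
  have t: "0 < t" "t < d" "t < e" using d(1) e by (auto simp: t_def min_def)
  have conv: "convex_on UNIV \<phi>"
  proof (rule convex_onI)
    fix u s t :: real assume u: "0 < u" "u < 1"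
    have "z + ((1 - u) *\<^sub>R s + u *\<^sub>R t) *\<^sub>R X = (1 - u) *\<^sub>R (z + s *\<^sub>R X) + u *\<^sub>R (z + t *\<^sub>R X)"
      by (simp add: algebra_simps)
    then show "\<phi> ((1 - u) *\<^sub>R s + u *\<^sub>R t) \<le> (1 - u) * \<phi> s + u * \<phi> t"
      using convex_onD[OF h, of u "z + s *\<^sub>R X" "z + t *\<^sub>R X"] u by (simp add: \<phi>_def)
  qed simp
  have "\<psi> 0 * (t - 0) \<le> \<phi> t - \<phi> 0"
    by (rule convex_on_imp_above_tangent[OF conv]) (use \<phi>'[of 0] e in auto)
  moreover have "\<psi> t * (0 - t) \<le> \<phi> 0 - \<phi> t"
    by (rule convex_on_imp_above_tangent[OF conv]) (use \<phi>'[of t] t in auto)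
  ultimately have "t * (\<psi> t - \<psi> 0) \<ge> 0" by (simp add: algebra_simps)
  then show False using t d(2)[of t] by (simp add: zero_le_mult_iff)
qed

lemma pd2_of_real:
  fixes h :: "'a::euclidean_space \<Rightarrow> real"
  assumes S: "open S" "x \<in> S" and d1: "\<And>y. y \<in> S \<Longrightarrow> h differentiable (at y)" and d2: "pd b h differentiable (at x)"
  shows "pd b (\<lambda>z. complex_of_real (h z)) differentiable (at x)"
    and "pd a (pd b (\<lambda>z. complex_of_real (h z))) x = complex_of_real (pd a (pd b h) x)"
proof -
  have p1: "pd b (\<lambda>z. complex_of_real (h z)) y = of_real (pd b h y)" if "y \<in> S" for y
    by (rule pd_linear[OF bounded_linear_of_real d1[OF that]])
  have "(\<lambda>y. complex_of_real (pd b h y)) differentiable (at x)"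
    by (rule differentiableI[OF bounded_linear.has_derivative[OF bounded_linear_of_real pd_has_derivative[OF d2]]])
  then show "pd b (\<lambda>z. complex_of_real (h z)) differentiable (at x)"
    by (rule differentiable_eq_on_open[OF S, rotated]) (simp add: p1)
  have "pd a (pd b (\<lambda>z. complex_of_real (h z))) x = pd a (\<lambda>y. of_real (pd b h y)) x"
    by (rule pd_eq_on_open[OF S]) (rule p1)
  then show "pd a (pd b (\<lambda>z. complex_of_real (h z))) x = complex_of_real (pd a (pd b h) x)"
    using pd_linear[OF bounded_linear_of_real d2] by simp
qed

text \<open>
  $4\sum_{j,k}c_j\bar c_k\,\partial_j\bar\partial_k h=D^2h(X,X)+D^2h(Y,Y)$ for $X=c$ and $Y=-ic$.
\<close>

lemma psd_hess_convex:
  fixes h :: "complex ^ 'n \<Rightarrow> real"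
  assumes h: "convex_on UNIV h" and S: "open S" "z \<in> S"
    and d1: "\<And>x. x \<in> S \<Longrightarrow> h differentiable (at x)"
    and d2: "\<And>x b. x \<in> S \<Longrightarrow> b \<in> Basis \<Longrightarrow> pd b h differentiable (at x)"
    and c2: "\<And>a b. a \<in> Basis \<Longrightarrow> b \<in> Basis \<Longrightarrow> continuous_on S (pd a (pd b h))"
  shows "psd (hess (\<lambda>w. complex_of_real (h w)) z)"
proof -
  let ?g = "\<lambda>w. complex_of_real (h w)"
  define H where "H u j v k = pd (axis j u) (pd (axis k v) h) z" for u v and j k :: 'n
  have "\<forall>b\<in>Basis. pd b ?g differentiable (at z)"
    using pd2_of_real(1)[OF S d1 d2[OF S(2)]] by blast
  note ex = hess_expand[OF this]
  have hess: "hess ?g z j k = (of_real (H 1 j 1 k) + \<i> * of_real (H 1 j \<i> k) - \<i> * of_real (H \<i> j 1 k) + of_real (H \<i> j \<i> k)) / 4" for j k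
    unfolding ex H_def by (simp only: pd2_of_real(2)[OF S d1 d2[OF S(2) axis_Basis_complex(1)]] pd2_of_real(2)[OF S d1 d2[OF S(2) axis_Basis_complex(2)]])
  have sym: "H u j v k = H v k u j" if "u \<in> {1, \<i>}" "v \<in> {1, \<i>}" for u v j k
  proof -
    have B: "axis j u \<in> Basis" "axis k v \<in> Basis" using that by auto
    show ?thesis unfolding H_def by (rule pd_commute_real[OF S d1 d2[OF _ B(1)] d2[OF _ B(2)] c2[OF B] c2[OF B(2,1)]])
  qed
  have quad: "0 \<le> (\<Sum>k\<in>UNIV. \<Sum>j\<in>UNIV. Re (X k) * Re (X j) * H 1 j 1 k + Re (X k) * Im (X j) * H \<i> j 1 k 
      + (Im (X k) * Re (X j) * H 1 j \<i> k + Im (X k) * Im (X j) * H \<i> j \<i> k))" for X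
  proof -
    have i: "(\<chi> i. X i) \<bullet> axis j u = X j \<bullet> u" for j u by (simp add: inner_axis)
    have "0 \<le> (\<Sum>b\<in>Basis. \<Sum>a\<in>Basis. ((\<chi> i. X i) \<bullet> b) * ((\<chi> i. X i) \<bullet> a) * pd a (pd b h) z)"
      by (rule convex_second_derivative_nonneg[OF h S d1 d2])
    then show ?thesis unfolding sum_Basis_vec_complex i H_def by (simp add: inner_complex_def sum.distrib algebra_simps)
  qed
  have form: "0 \<le> Re (herm_form (hess ?g z) c)" for c
  proof -
    define Y where "Y j = - \<i> * c j" for j
    have "4 * Re (c j * cnj (c k) * hess ?g z j k) = 
       (Re (c k) * Re (c j) * H 1 j 1 k + Re (c k) * Im (c j) * H \<i> j 1 k 
        + (Im (c k) * Re (c j) * H 1 j \<i> k + Im (c k) * Im (c j) * H \<i> j \<i> k))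
      + (Re (Y k) * Re (Y j) * H 1 j 1 k + Re (Y k) * Im (Y j) * H \<i> j 1 k 
        + (Im (Y k) * Re (Y j) * H 1 j \<i> k + Im (Y k) * Im (Y j) * H \<i> j \<i> k))" for j k
    proof -
      have "4 * Re (c j * cnj (c k) * hess ?g z j k) = Re (c j * cnj (c k) * (4 * hess ?g z j k))"
        by (simp add: algebra_simps)
      also have "4 * hess ?g z j k = of_real (H 1 j 1 k) + \<i> * of_real (H 1 j \<i> k) - \<i> * of_real (H \<i> j 1 k) + of_real (H \<i> j \<i> k)"
        unfolding hess by simp
      finally show ?thesis unfolding Y_def by (simp add: algebra_simps)
    qed
    then have "4 * Re (herm_form (hess ?g z) c) = 
       (\<Sum>j\<in>UNIV. \<Sum>k\<in>UNIV. (Re (c k) * Re (c j) * H 1 j 1 k + Re (c k) * Im (c j) * H \<i> j 1 k 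
        + (Im (c k) * Re (c j) * H 1 j \<i> k + Im (c k) * Im (c j) * H \<i> j \<i> k)))
      + (\<Sum>j\<in>UNIV. \<Sum>k\<in>UNIV. (Re (Y k) * Re (Y j) * H 1 j 1 k + Re (Y k) * Im (Y j) * H \<i> j 1 k 
        + (Im (Y k) * Re (Y j) * H 1 j \<i> k + Im (Y k) * Im (Y j) * H \<i> j \<i> k)))"
      unfolding herm_form_def Re_sum sum_distrib_left sum.distrib[symmetric] by (intro sum.cong refl) (simp only:)
    also have "\<dots> \<ge> 0" by (subst (1 2) sum.swap) (intro add_nonneg_nonneg quad)
    finally show ?thesis by simp
  qed
  \<comment> \<open>Exchanging j and k swaps the two imaginary terms, by symmetry of the real second
    derivatives.\<close>
  have "hess ?g z k j = cnj (hess ?g z j k)" for j k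
  proof -
    have s: "H 1 k 1 j = H 1 j 1 k" "H 1 k \<i> j = H \<i> j 1 k" "H \<i> k 1 j = H 1 j \<i> k" "H \<i> k \<i> j = H \<i> j \<i> k"
      by (rule sym, simp, simp)+
    show ?thesis unfolding hess s by (rule complex_eqI) simp_all
  qed
  then show ?thesis unfolding psd_def using form by blast
qed

section \<open>Radon measures are determined by test functions\<close>

text \<open>Bumps are dominated by the indicator of the closed box, which is integrable because the
  measure is finite on compact sets.\<close>

lemma measure_box_bump_limit:
  fixes \<mu> :: "'a::euclidean_space measure"
  assumes s: "sets \<mu> = sets borel" and fin: "\<And>K. compact K \<Longrightarrow> emeasure \<mu> K < \<infinity>"
  shows "(\<lambda>m. LINT z|\<mu>. complex_of_real (bump l u m z)) \<longlonglongrightarrow> complex_of_real (measure \<mu> (box l u))"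
proof -
  have m: "(\<lambda>z. complex_of_real (bump l u m z)) \<in> borel_measurable \<mu>" for m
    using borel_measurable_continuous_onI[OF smooth_continuous[OF smooth_bump]] s by (simp cong: measurable_cong_sets)
  have "(\<lambda>m. LINT z|\<mu>. complex_of_real (bump l u m z)) \<longlonglongrightarrow> (LINT z|\<mu>. complex_of_real (indicator (box l u) z))"
  proof (rule integral_dominated_convergence[where w="indicator (cbox l u)"])
    show "integrable \<mu> (indicator (cbox l u) :: 'a \<Rightarrow> real)"
      using fin[OF compact_cbox[of l u]] s by (intro integrable_real_indicator) auto
    show "(\<lambda>z. complex_of_real (indicator (box l u) z)) \<in> borel_measurable \<mu>"
    proof -
      have "(\<lambda>z. complex_of_real (indicator (box l u) z)) \<in> borel_measurable borel" by simp
      then show ?thesis using s by (simp cong: measurable_cong_sets)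
    qed
    show "AE z in \<mu>. (\<lambda>m. complex_of_real (bump l u m z)) \<longlonglongrightarrow> complex_of_real (indicator (box l u) z)"
      by (intro AE_I2 tendsto_of_real bump_tendsto)
    show "AE z in \<mu>. norm (complex_of_real (bump l u m z)) \<le> indicator (cbox l u) z" for m
    proof (rule AE_I2)
      fix z show "norm (complex_of_real (bump l u m z)) \<le> indicator (cbox l u) z"
        using bump_bounds[of l u m z] bump_outside[of z l u m] box_subset_cbox[of l u] by (cases "z \<in> cbox l u") auto
    qed
  qed (rule m)
  moreover have "(LINT z|\<mu>. complex_of_real (indicator (box l u) z)) = complex_of_real (measure \<mu> (box l u))"
  proof -
    have "(LINT z|\<mu>. complex_of_real (indicator (box l u) z)) = complex_of_real (LINT z|\<mu>. indicator (box l u) z)"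
      by (rule integral_complex_of_real)
    then show ?thesis using s by (simp add: sets_eq_imp_space_eq[OF s])
  qed
  ultimately show ?thesis by simp
qed

text \<open>Open boxes form an intersection-stable generator of the Borel sets, exhausted by boxes
  of finite measure, and bump integrals determine their measures.\<close>

lemma radon_measure_eqI:
  fixes \<mu> \<nu> :: "'a::euclidean_space measure"
  assumes s: "sets \<mu> = sets borel" "sets \<nu> = sets borel" 
    and fin: "\<And>K. compact K \<Longrightarrow> emeasure \<mu> K < \<infinity>" "\<And>K. compact K \<Longrightarrow> emeasure \<nu> K < \<infinity>"
    and eq: "\<And>l u m. (LINT z|\<mu>. complex_of_real (bump l u m z)) = (LINT z|\<nu>. complex_of_real (bump l u m z))"
  shows "\<mu> = \<nu>"
proof (rule measure_eqI_generator_eq)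
  let ?E = "range (\<lambda>(a, b). box a b::'a set)"
  show "Int_stable ?E" by (auto simp: Int_stable_def box_Int_box)
  show "?E \<subseteq> Pow UNIV" "sets \<mu> = sigma_sets UNIV ?E" "sets \<nu> = sigma_sets UNIV ?E"
    by (simp_all add: borel_eq_box s)
  let ?A = "\<lambda>n::nat. box (- (real n *\<^sub>R One)) (real n *\<^sub>R One) :: 'a set"
  show "range ?A \<subseteq> ?E" "(\<Union>i. ?A i) = UNIV" unfolding UN_box_eq_UNIV by auto
  have f: "emeasure \<rho> (box l u) \<noteq> \<infinity>" if "sets \<rho> = sets borel" "\<And>K. compact K \<Longrightarrow> emeasure \<rho> K < \<infinity>" for \<rho> :: "'a measure" and l u
  proof -
    have "emeasure \<rho> (box l u) \<le> emeasure \<rho> (cbox l u)" by (rule emeasure_mono[OF box_subset_cbox]) (simp add: that(1))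
    also have "\<dots> < \<infinity>" by (rule that(2)[OF compact_cbox])
    finally show ?thesis by simp
  qed
  have f1: "emeasure \<mu> (box l u) \<noteq> \<infinity>" for l u by (rule f) (rule s(1), rule fin(1))
  have f2: "emeasure \<nu> (box l u) \<noteq> \<infinity>" for l u by (rule f) (rule s(2), rule fin(2))
  show "emeasure \<mu> (?A i) \<noteq> \<infinity>" for i by (rule f1)
  fix B assume "B \<in> ?E"
  then obtain l u where B: "B = box l u" by auto
  have "complex_of_real (measure \<mu> (box l u)) = complex_of_real (measure \<nu> (box l u))"
    using LIMSEQ_unique measure_box_bump_limit[OF s(1) fin(1), of l u] measure_box_bump_limit[OF s(2) fin(2), of l u] 
    unfolding eq by blast
  then show "emeasure \<mu> B = emeasure \<nu> B"
    unfolding B using f1[of l u] f2[of l u] by (simp add: emeasure_eq_ennreal_measure)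
qed

lemma test_form_bump: "test_form (function_form (\<lambda>z. complex_of_real (bump l u m z)))"
proof -
  have "smooth_on (\<lambda>z. function_form (\<lambda>z. complex_of_real (bump l u m z)) z I J) UNIV" for I J
  proof (cases "I = {} \<and> J = {}")
    case True
    then show ?thesis by (simp add: function_form_def smooth_bump)
  next
    case False
    then have "(\<lambda>z. function_form (\<lambda>z. complex_of_real (bump l u m z)) z I J) = (\<lambda>z. 0)" 
      by (auto simp: function_form_def)
    then show ?thesis by (simp add: smooth_const)
  qed
  moreover have "form_supported_in (function_form (\<lambda>z. complex_of_real (bump l u m z))) (cbox l u)"
    using bump_outside[of _ l u m] box_subset_cbox[of l u] by (auto simp: form_supported_in_def function_form_def)
  ultimately show ?thesis unfolding test_form_def using compact_cbox by blast
qed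

section \<open>The mixed pseudovolume\<close>

lemma fold_wedge11_scale:
  "fold (\<lambda>l. wedge11 (M l)) ls (\<lambda>I J. c * a I J) = (\<lambda>I J. c * fold (\<lambda>l. wedge11 (M l)) ls a I J)"
proof (induction ls arbitrary: a)
  case (Cons l ls)
  have "wedge11 (M l) (\<lambda>I J. c * a I J) = (\<lambda>I J. c * wedge11 (M l) a I J)"
    by (intro ext) (simp add: wedge11_def efw_cmult sum_distrib_left mult_ac)
  then show ?case by (simp add: Cons.IH)
qed simp

text \<open>Integrability is part of the conclusion because the integral of a non-integrable
  function would default to 0.\<close>

theorem mainTheorem4:
  fixes A :: "'n \<Rightarrow> (complex ^ 'n::{finite,linorder}) set"
  assumes "\<And>l. convex_body (A l)"
    and "\<And>l. Ck_on 2 (support_fun (A l)) (- {0})"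
  shows "set_integrable lborel (cball 0 1)
           (\<lambda>z. mixed_discriminant (\<lambda>l. Hess_C (support_fun (A l)) z)) \<and>
         complex_of_real (mixed_pseudovolume A) =
           4 ^ CARD('n) / complex_of_real (measure lborel (cball (0 :: real ^ 'n::{finite,linorder}) 1)) *
           (LINT z:cball 0 1|lborel. mixed_discriminant (\<lambda>l. Hess_C (support_fun (A l)) z))"
proof -
  define ls where "ls = sorted_list_of_set (UNIV :: 'n set)"
  define us where "us = map (\<lambda>l. support_fun (A l)) ls"
  define cx :: "(complex ^ 'n::{finite,linorder} \<Rightarrow> real) \<Rightarrow> complex ^ 'n::{finite,linorder} \<Rightarrow> complex" where "cx = (\<lambda>u z. complex_of_real (u z))"
  define D where "D z = mixed_discriminant (\<lambda>l. Hess_C (support_fun (A l)) z)" for z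
  define c where "c = (4 ^ CARD('n) * fact CARD('n) :: real)"
  \<comment> \<open>The orientation constant in \<open>integrate_form\<close>.\<close>
  define \<kappa> where "\<kappa> = (-1) ^ (CARD('n) * (CARD('n) - 1) div 2) * (- 2 * \<i>) ^ CARD('n)"
  define top where "top z = fold (\<lambda>l. wedge11 (\<lambda>j k. Hess_C (support_fun (A l)) z $ j $ k)) ls unit_arr UNIV UNIV" for z
  have c: "c > 0" by (simp add: c_def)
  have top: "\<kappa> * top z = of_real c * D z" for z
    unfolding \<kappa>_def top_def ls_def D_def c_def by (subst wedge_top_coefficient) simp
  have con: "\<exists>L. conical (cx (support_fun (A l))) L" for l
    unfolding cx_def by (rule support_fun_conical[OF assms(1)[of l] assms(2)[of l]]) blast
  have mild: "mild (cx u)" and appr: "smoothly_approximable (cx u)" if "u \<in> set us" for u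
    using con that conical_mild conical_smoothly_approximable unfolding us_def by fastforce+
  have len: "length us = CARD('n)" by (simp add: us_def ls_def)
  have T: "bedford_taylor us \<phi> = hess_current (map cx us) \<phi>" if "test_form \<phi>" for \<phi>
    unfolding cx_def by (rule bedford_taylor_eq_hess_current) (use mild appr len that in \<open>auto simp: cx_def\<close>)
  have wedge: "wedges (map cx us) z (\<lambda>I J. s * unit_arr I J) UNIV UNIV = s * top z" for z s
    unfolding us_def fold_map o_def cx_def top_def Hess_C_eq_hess fold_wedge11_scale ..
  have mild': "\<forall>u\<in>set (map cx us). mild u" using mild by auto
  \<comment> \<open>The wedge estimate is applied to the indicator of K as a 0-form; its top
    coefficient is D up to the nonzero constant c / \<kappa>.\<close>
  have int: "integrable lborel (\<lambda>z. indicator K z * D z)" if K: "compact K" for K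
  proof -
    have "integrable lborel (\<lambda>z. wedges (map cx us) z (\<lambda>I J. indicator K z * unit_arr I J) UNIV UNIV)"
    proof (rule wedges_integrable[OF mild' K])
      show "(\<lambda>z. indicator K z * unit_arr I J) \<in> borel_measurable borel" for I J
        using borel_compact[OF K] by simp
      show "norm (indicator K z * unit_arr I J) \<le> 1 * indicator K z" for z I J
        by (auto simp: unit_arr_def indicator_def)
    qed (use len in simp)
    then have "integrable lborel (\<lambda>z. inverse (of_real c) * \<kappa> * (indicator K z * top z))" unfolding wedge by (rule integrable_mult_right)
    moreover have "inverse (of_real c) * \<kappa> * (indicator K z * top z) = indicator K z * D z" for z
    proof -
      have "inverse (of_real c) * \<kappa> * (indicator K z * top z) = indicator K z * (inverse (of_real c) * (\<kappa> * top z))" by (simp add: mult_ac)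
      also have "\<dots> = indicator K z * D z" unfolding top using c by simp
      finally show ?thesis .
    qed
    ultimately show ?thesis by simp
  qed
  have Dm: "D \<in> borel_measurable borel"
  proof -
    have "(\<lambda>z. Hess_C (support_fun (A l)) z $ j $ k) \<in> borel_measurable borel" for l j k
      using con[of l] conical_mild unfolding Hess_C_eq_hess cx_def mild_def by blast
    then show ?thesis unfolding D_def[abs_def] mixed_discriminant_def
      by (intro borel_measurable_divide borel_measurable_sum borel_measurable_times borel_measurable_prod borel_measurable_const)
  qed
  have Dnn: "D z \<in> \<real>\<^sub>\<ge>\<^sub>0" if "z \<noteq> 0" for z
    unfolding D_def
  proof (rule mixed_discriminant_psd_nonneg)
    fix l
    note C = C2_support_fun[OF assms(2)[of l]]
    show "psd (\<lambda>j k. Hess_C (support_fun (A l)) z $ j $ k)"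
      unfolding Hess_C_eq_hess 
      by (rule psd_hess_convex[OF support_fun_convex[OF assms(1)], of "- {0}"]) (use that C in auto)
  qed
  \<comment> \<open>Off the origin D is real and nonnegative, so taking the real part, and
    truncation by \<open>ennreal\<close> later, can matter only on a null set.\<close>
  define \<delta> where "\<delta> z = c * Re (D z)" for z
  have Dre: "complex_of_real (Re (D z)) = D z" "0 \<le> Re (D z)" if "z \<noteq> 0" for z
    using Dnn[OF that] by (auto simp: complex_nonneg_Reals_iff complex_eq_iff)
  have \<delta>m: "\<delta> \<in> borel_measurable lborel" unfolding \<delta>_def using Dm by simp
  have \<delta>0: "AE z in lborel. 0 \<le> \<delta> z"
    using AE_lborel_singleton[of 0] by eventually_elim (use c Dre in \<open>simp add: \<delta>_def\<close>)
  define \<mu> where "\<mu> = density lborel (\<lambda>z. ennreal (\<delta> z))"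
  have \<mu>K: "emeasure \<mu> K = ennreal (LINT z|lborel. indicator K z * \<delta> z)" if K: "compact K" for K
  proof -
    have "integrable lborel (\<lambda>z. Re (indicator K z * D z))" using int[OF K] by (rule integrable_Re)
    moreover have "Re (indicator K z * D z) = indicator K z * Re (D z)" for z by (simp add: indicator_def)
    ultimately have i: "integrable lborel (\<lambda>z. indicator K z * \<delta> z)"
      unfolding \<delta>_def using integrable_mult_right[of c] by (simp add: mult.left_commute)
    have "emeasure \<mu> K = (\<integral>\<^sup>+z. ennreal (\<delta> z) * indicator K z \<partial>lborel)"
      unfolding \<mu>_def by (rule emeasure_density) (use \<delta>m borel_compact[OF K] in auto)
    also have "\<dots> = (\<integral>\<^sup>+z. ennreal (indicator K z * \<delta> z) \<partial>lborel)"
      by (intro nn_integral_cong) (simp add: indicator_def)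
    also have "\<dots> = ennreal (LINT z|lborel. indicator K z * \<delta> z)"
      by (rule nn_integral_eq_integral[OF i]) (use \<delta>0 in eventually_elim, simp)
    finally show ?thesis .
  qed
  have \<mu>s: "sets \<mu> = sets borel" by (simp add: \<mu>_def)
  have \<mu>T: "bedford_taylor us (function_form f) = (LINT z|\<mu>. f z)" if f: "test_form (function_form f)" for f
  proof -
    have "smooth_on (\<lambda>z. function_form f z {} {}) UNIV" using f unfolding test_form_def by blast
    then have sf: "smooth_on f UNIV" by (simp add: function_form_def)
    then have fm: "f \<in> borel_measurable borel" using borel_measurable_continuous_onI smooth_continuous by blast
    have "function_form f z = (\<lambda>I J. f z * unit_arr I J)" for z
      by (intro ext) (simp add: function_form_def unit_arr_def)
    then have "bedford_taylor us (function_form f) = \<kappa> * (LINT z|lborel. f z * top z)"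
      unfolding T[OF f] hess_current_def integrate_form_def \<kappa>_def by (simp only: wedge)
    also have "\<dots> = (LINT z|lborel. \<kappa> * (f z * top z))" by (rule integral_mult_right_zero[symmetric])
    also have "\<dots> = (LINT z|lborel. \<delta> z *\<^sub>R f z)"
    proof (rule integral_cong_AE)
      have tm: "(\<lambda>z. \<kappa> * top z) \<in> borel_measurable borel" unfolding top using Dm by simp
      have "(\<lambda>z. f z * (\<kappa> * top z)) \<in> borel_measurable lborel" using tm fm by simp
      then show "(\<lambda>z. \<kappa> * (f z * top z)) \<in> borel_measurable lborel" by (simp add: mult.left_commute)
      show "(\<lambda>z. \<delta> z *\<^sub>R f z) \<in> borel_measurable lborel" using \<delta>m fm by simp
      show "AE z in lborel. \<kappa> * (f z * top z) = \<delta> z *\<^sub>R f z"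
        using AE_lborel_singleton[of 0]
      proof eventually_elim
        case (elim z)
        have "\<kappa> * (f z * top z) = f z * (of_real c * D z)" unfolding top[symmetric] by (rule mult.left_commute)
        also have "\<dots> = f z * (of_real c * of_real (Re (D z)))" by (simp only: Dre(1)[OF elim])
        finally show ?case by (simp add: \<delta>_def scaleR_conv_of_real mult_ac)
      qed
    qed
    also have "\<dots> = (LINT z|\<mu>. f z)"
      unfolding \<mu>_def by (rule integral_density[symmetric]) (use fm \<delta>m \<delta>0 in auto)
    finally show ?thesis .
  qed
  \<comment> \<open>Bumps are admissible test functions, so any competing Radon measure agrees with
    \<mu> on them and hence equals \<mu>.\<close>
  have cm: "current_measure (bedford_taylor us) = \<mu>"
    unfolding current_measure_def
  proof (rule the_equality)
    show "sets \<mu> = sets borel \<and> (\<forall>K. compact K \<longrightarrow> emeasure \<mu> K < \<infinity>) \<and>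
        (\<forall>f. test_form (function_form f) \<longrightarrow> bedford_taylor us (function_form f) = (LINT z|\<mu>. f z))"
      using \<mu>s \<mu>K \<mu>T by simp
    fix \<nu> assume \<nu>: "sets \<nu> = sets borel \<and> (\<forall>K. compact K \<longrightarrow> emeasure \<nu> K < \<infinity>) \<and>
        (\<forall>f. test_form (function_form f) \<longrightarrow> bedford_taylor us (function_form f) = (LINT z|\<nu>. f z))"
    show "\<nu> = \<mu>"
    proof (rule radon_measure_eqI)
      show "(LINT z|\<nu>. complex_of_real (bump l u m z)) = (LINT z|\<mu>. complex_of_real (bump l u m z))" for l u m
        using \<nu> \<mu>T[OF test_form_bump, of l u m] test_form_bump[of l u m] by metis
    qed (use \<nu> \<mu>s \<mu>K in auto)
  qed
  let ?B = "cball (0 :: complex ^ 'n::{finite,linorder}) 1" and ?v = "measure lborel (cball (0 :: real ^ 'n::{finite,linorder}) 1)"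
  have iB: "integrable lborel (\<lambda>z. indicator ?B z * D z)" by (rule int[OF compact_cball])
  have ind: "indicat_real ?B z *\<^sub>R D z = indicator ?B z * D z" for z by (simp add: indicator_def)
  have "0 \<le> (LINT z|lborel. indicator ?B z * \<delta> z)"
    by (rule integral_nonneg_AE) (use \<delta>0 in eventually_elim, simp)
  then have meas: "measure \<mu> ?B = (LINT z|lborel. indicator ?B z * \<delta> z)"
    using \<mu>K[OF compact_cball] by (simp add: measure_def)
  have "complex_of_real (LINT z|lborel. indicator ?B z * \<delta> z) = (LINT z|lborel. complex_of_real (indicator ?B z * \<delta> z))"
    by (rule integral_complex_of_real[symmetric])
  also have "\<dots> = (LINT z|lborel. of_real c * (indicator ?B z * D z))"
  proof (rule integral_cong_AE)
    show "AE z in lborel. complex_of_real (indicator ?B z * \<delta> z) = of_real c * (indicator ?B z * D z)"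
      using AE_lborel_singleton[of 0]
    proof eventually_elim
      case (elim z)
      have "complex_of_real (indicator ?B z * \<delta> z) = indicator ?B z * (of_real c * of_real (Re (D z)))"
        by (simp add: \<delta>_def indicator_def)
      then show ?case by (simp only: Dre(1)[OF elim] mult.left_commute)
    qed
    have B: "?B \<in> sets borel" by simp
    show "(\<lambda>z. complex_of_real (indicator ?B z * \<delta> z)) \<in> borel_measurable lborel"
    proof -
      have "(\<lambda>z. indicator ?B z * \<delta> z) \<in> borel_measurable lborel"
        by (intro borel_measurable_times borel_measurable_indicator \<delta>m) (simp add: B)
      then show ?thesis by (rule measurable_compose[OF _ borel_measurable_of_real])
    qed
    show "(\<lambda>z. of_real c * (indicator ?B z * D z)) \<in> borel_measurable lborel"
      by (intro borel_measurable_times borel_measurable_const borel_measurable_indicator) (use B Dm in simp_all)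
  qed
  also have "\<dots> = of_real c * (LINT z|lborel. indicator ?B z * D z)" by (rule integral_mult_right_zero)
  finally have "complex_of_real (measure \<mu> ?B) = of_real c * (LINT z|lborel. indicator ?B z * D z)" unfolding meas .
  moreover have "mixed_pseudovolume A = measure \<mu> ?B / (fact CARD('n) * ?v)"
    unfolding mixed_pseudovolume_def cm[unfolded us_def ls_def] ..
  ultimately have "complex_of_real (mixed_pseudovolume A) = 4 ^ CARD('n) / complex_of_real ?v * (LINT z|lborel. indicator ?B z * D z)"
    by (simp add: c_def)
  then show ?thesis
    using iB unfolding set_integrable_def set_lebesgue_integral_def D_def[symmetric] ind by simp
qed

end
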